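(* Let $\alpha>0$ and let $\Theta=(\theta_k)_{k\ge1}$ be a sequence with $\theta_k\ge 0$ for all $k\geq 1$ and $\theta_k\sim k^\alpha$ as $k\to\infty$. Let $\mathbb{P}_\Theta$ be the associated weighted measure on the symmetric group $\mathfrak{S}_n$, let $n^*$ and $\ell_n$ be the quantities defined in the context, and let $L_k=L_k(\sigma)$ denote the length of the $k$-th longest cycle of $\sigma\in\mathfrak{S}_n$, counted with multiplicity. Let $K\in\mathbb{N}$, $K\ge 1$, be given. Then, under $\mathbb{P}_\Theta$, as $n\to\infty$, $$\frac{1}{n^*}\cdot\bigl(L_1-n^*\ell_n,\dots,L_K-n^*\ell_n\bigr)\stackrel{d}{\longrightarrow}\Bigl(-\log(E_1),\,-\log(E_1+E_2),\,\ldots,\,-\log\Bigl(\sum_{j=1}^K E_j\Bigr)\Bigr),$$ where $(E_j)_{j=1}^K$ is a sequence of i.i.d. $\mathrm{Exp}(1)$ distributed random variables (exponential with mean $1$), i.e. the $i$-th component of the limit vector is $-\log\bigl(\sum_{j=1}^i E_j\bigr)$ for $1\le i\le K$.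
   Context: $\mathfrak{S}_n$ is the group of permutations of $\{1,\dots,n\}$. For $\sigma\in\mathfrak{S}_n$, $C_k=C_k(\sigma)$ is the number of cycles of length $k$ in the cycle decomposition of $\sigma$ (fixed points are cycles of length $1$), so $\sum_{k=1}^n kC_k=n$. The weighted measure is $\mathbb{P}_\Theta[\sigma]:=\frac{1}{h_n\, n!}\prod_{k=1}^n\theta_k^{C_k}$ for $\sigma\in\mathfrak{S}_n$, where $h_n=h_n(\Theta)$ is the normalization constant making this a probability measure (it is positive for all large $n$, since $\theta_k\sim k^\alpha$). For $n\ge 1$, $v_n>0$ is the unique solution of $\sum_{k=1}^\infty\theta_k e^{-kv_n}=n$. One has $v_n\to0$. Set $$n^*:=(v_n)^{-1},\qquad \ell_n:=\alpha\log(n^* )+(\alpha-1)\log\bigl(\alpha\log(n^* )\bigr),$$ the latter being defined for all $n$ large enough that $n^*>1$. $L_k(\sigma)$ is the $k$-th entry of the list of all cycle lengths of $\sigma$ arranged in non-increasing order with multiplicity (with, say, $L_k(\sigma)=0$ if $\sigma$ has fewer than $k$ cycles). $a_n\sim b_n$ means $a_n/b_n\to1$. *)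

theory Defs
  imports
    "HOL-Probability.Probability"
    "HOL-Combinatorics.Orbits"
    "HOL-Library.Multiset"
    "HOL-Library.Landau_Symbols"
begin

definition cycle_supports :: "nat \<Rightarrow> (nat \<Rightarrow> nat) \<Rightarrow> nat set set" where
  "cycle_supports n \<sigma> = orbit \<sigma> ` {1..n}"

definition cycle_count :: "nat \<Rightarrow> (nat \<Rightarrow> nat) \<Rightarrow> nat \<Rightarrow> nat" where
  "cycle_count n \<sigma> k = card {c \<in> cycle_supports n \<sigma>. card c = k}"

definition cycle_lengths :: "nat \<Rightarrow> (nat \<Rightarrow> nat) \<Rightarrow> nat list" where
  "cycle_lengths n \<sigma> =
     rev (sorted_list_of_multiset (image_mset card (mset_set (cycle_supports n \<sigma>))))"

text \<open>The index \<open>k\<close> counts from 1.\<close>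

definition longest_cycle :: "nat \<Rightarrow> nat \<Rightarrow> (nat \<Rightarrow> nat) \<Rightarrow> nat" where
  "longest_cycle n k \<sigma> =
     (if k \<le> length (cycle_lengths n \<sigma>) then cycle_lengths n \<sigma> ! (k - 1) else 0)"

text \<open>A weight sequence is a function \<open>\<theta> :: nat \<Rightarrow> real\<close> of which only the values at
  positive arguments are used.\<close>

definition cycle_weight :: "(nat \<Rightarrow> real) \<Rightarrow> nat \<Rightarrow> (nat \<Rightarrow> nat) \<Rightarrow> real" where
  "cycle_weight \<theta> n \<sigma> = (\<Prod>k=1..n. \<theta> k ^ cycle_count n \<sigma> k)"

definition normalization :: "(nat \<Rightarrow> real) \<Rightarrow> nat \<Rightarrow> real" where
  "normalization \<theta> n = (\<Sum>\<sigma> | \<sigma> permutes {1..n}. cycle_weight \<theta> n \<sigma>) / fact n"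

text \<open>This is a probability measure whenever \<open>normalization \<theta> n > 0\<close>, and the null
  measure if \<open>normalization \<theta> n = 0\<close> (by division by zero).\<close>

definition weighted_measure :: "(nat \<Rightarrow> real) \<Rightarrow> nat \<Rightarrow> (nat \<Rightarrow> nat) measure" where
  "weighted_measure \<theta> n =
     point_measure {\<sigma>. \<sigma> permutes {1..n}}
       (\<lambda>\<sigma>. ennreal (1 / (normalization \<theta> n * fact n) * cycle_weight \<theta> n \<sigma>))"

text \<open>The series is indexed by \<open>k + 1\<close> since it starts at 1.\<close>

definition saddle_point :: "(nat \<Rightarrow> real) \<Rightarrow> nat \<Rightarrow> real" where
  "saddle_point \<theta> n =
     (THE v. v > 0 \<and> (\<lambda>k. \<theta> (Suc k) * exp (- real (Suc k) * v)) sums real n)"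

definition nstar :: "(nat \<Rightarrow> real) \<Rightarrow> nat \<Rightarrow> real" where
  "nstar \<theta> n = inverse (saddle_point \<theta> n)"

definition ell :: "real \<Rightarrow> (nat \<Rightarrow> real) \<Rightarrow> nat \<Rightarrow> real" where
  "ell \<alpha> \<theta> n = \<alpha> * ln (nstar \<theta> n) + (\<alpha> - 1) * ln (\<alpha> * ln (nstar \<theta> n))"

text \<open>Convergence in distribution of \<open>X n\<close>, defined on \<open>M n\<close>, to \<open>Y\<close>, defined on \<open>N\<close>,
  for random variables with values in a topological space \<open>T\<close>: the expectations of all
  bounded continuous functions converge.  The measures may live on different spaces.\<close>

definition converges_in_distribution ::
  "'b topology \<Rightarrow> (nat \<Rightarrow> 'a measure) \<Rightarrow> (nat \<Rightarrow> 'a \<Rightarrow> 'b) \<Rightarrow> 'c measure \<Rightarrow> ('c \<Rightarrow> 'b) \<Rightarrow> bool" where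
  "converges_in_distribution T M X N Y \<longleftrightarrow>
     (\<forall>f. continuous_map T euclideanreal f \<and> bounded (f ` topspace T) \<longrightarrow>
        (\<lambda>n. \<integral>\<omega>. f (X n \<omega>) \<partial>M n) \<longlonglongrightarrow> (\<integral>\<omega>. f (Y \<omega>) \<partial>N))"

end

(* Put v = saddle_point n and w_k = theta_k/k * exp(-k v). The cycle counts under the weighted
   measure are independent Poisson(w_k) variables conditioned on sum k C_k = n, so for
   k_1 > ... > k_K the probability that the longest cycles have exactly these lengths is
   w_{k_1} ... w_{k_K} times a ratio of two coefficients of exp (sum w_k z^k). A local limit
   theorem (Fourier inversion and dominated convergence) gives the ratio the limit exp(-s) when
   the tail sum of the w_k over k >= k_K tends to s.

   Coupling the lengths with the partial sums of the E_j by the quantile transform of the tail sums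
   makes the sum over (k_1,...,k_K) an integral on the space of the E_j whose integrand
   converges pointwise, and Fatou's lemma bounds the liminf of expectations from below. Applied to
   B + f and B - f this gives convergence. *)

theory Submission
  imports Defs "HOL-Complex_Analysis.Complex_Analysis" "HOL-Real_Asymp.Real_Asymp"
begin

section \<open>Cycle types of permutations\<close>

text \<open>The tilt exp(-k v) cancels in every ratio of coefficients, so v is free; the saddle
  point makes the mean of the Poisson sum equal to n. Its standard deviation is of order
  v^(-(\<alpha>+2)/2), far above the order log(1/v)/v of the leading lengths, so the coefficient
  that remains after removing K of them falls under the same local limit theorem. Only the
  truncation below k_K is felt, through the total weight that it cuts off, and this is the origin of
  exp(-s).

  The partial sums S_1 < ... < S_K of the E_j have joint density exp(-s_K). The quantile interval of
  a length k has Lebesgue measure w_k, so exp(S_K) times the indicators of K such intervals has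
  expectation at most the product of the w_{k_i}. In the pointwise limit this exp(S_K) cancels the
  limit exp(-S_K) of the coefficient ratio, and the integrand tends to f without a remaining factor.

  Since Fatou's lemma asks only for a lower bound at finite n, permutations with ties among the
  leading lengths are discarded without estimating their probability.\<close>

definition cycle_type :: "'a set \<Rightarrow> ('a \<Rightarrow> 'a) \<Rightarrow> nat multiset" where
  "cycle_type S \<sigma> = image_mset card (mset_set (orbit \<sigma> ` S))"

definition partitions :: "nat \<Rightarrow> nat multiset set" where
  "partitions N = {\<mu>. sum_mset \<mu> = N \<and> 0 \<notin># \<mu>}"

text \<open>Up to the factor exp(-sum w_k), the probability that independent Poisson(w_k) counts
  equal the multiplicities of \<open>\<mu>\<close>.\<close>

definition type_weight :: "(nat \<Rightarrow> real) \<Rightarrow> nat multiset \<Rightarrow> real" where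
  "type_weight w \<mu> = (\<Prod>k\<in>set_mset \<mu>. w k ^ count \<mu> k / fact (count \<mu> k))"

text \<open>The coefficient of z^N in exp(sum_k w_k z^k), written as a finite sum so that no
  convergence is involved. The identification with an analytic function comes later, for finitely
  supported w.\<close>

definition exp_coeff :: "(nat \<Rightarrow> real) \<Rightarrow> nat \<Rightarrow> real" where
  "exp_coeff w N = (\<Sum>\<mu>\<in>partitions N. type_weight w \<mu>)"

lemma size_le_sum_mset: "0 \<notin># \<mu> \<Longrightarrow> size \<mu> \<le> sum_mset (\<mu> :: nat multiset)"
  by (induction \<mu>) auto

lemma finite_partitions [simp]: "finite (partitions N)"
proof -
  have "partitions N \<subseteq> mset ` {xs. set xs \<subseteq> {..N} \<and> length xs \<le> N}"
  proof
    fix \<mu> assume \<mu>: "\<mu> \<in> partitions N"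
    obtain xs where xs: "mset xs = \<mu>" using ex_mset by blast
    have "size \<mu> \<le> N" using \<mu> size_le_sum_mset by (auto simp: partitions_def)
    moreover have "k \<le> N" if "k \<in># \<mu>" for k
      using \<mu> that sum_mset.remove[of k \<mu>] by (auto simp: partitions_def)
    ultimately show "\<mu> \<in> mset ` {xs. set xs \<subseteq> {..N} \<and> length xs \<le> N}"
      using xs by (intro image_eqI[of _ _ xs]) auto
  qed
  thus ?thesis by (rule finite_subset) (intro finite_imageI finite_lists_length_le, simp)
qed

lemma in_partitions_le: "\<mu> \<in> partitions N \<Longrightarrow> k \<in># \<mu> \<Longrightarrow> 1 \<le> k \<and> k \<le> N"
  using sum_mset.remove[of k \<mu>] by (cases "k = 0") (auto simp: partitions_def)

lemma type_weight_superset: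
  assumes "finite A" "set_mset \<mu> \<subseteq> A"
  shows "type_weight w \<mu> = (\<Prod>k\<in>A. w k ^ count \<mu> k / fact (count \<mu> k))"
  unfolding type_weight_def
  by (rule prod.mono_neutral_left) (use assms in \<open>auto simp: not_in_iff\<close>)

lemma type_weight_add:
  "real (Suc (count R k)) * type_weight w (add_mset k R) = w k * type_weight w R"
proof -
  let ?A = "insert k (set_mset R)"
  have eq: "type_weight w \<mu> = w k ^ count \<mu> k / fact (count \<mu> k) *
      (\<Prod>j\<in>set_mset R - {k}. w j ^ count \<mu> j / fact (count \<mu> j))"
    if "set_mset \<mu> \<subseteq> ?A" for \<mu>
    using that by (subst type_weight_superset[of ?A]) (auto simp: prod.insert_remove)
  define X where "X = (\<Prod>j\<in>set_mset R - {k}. w j ^ count R j / fact (count R j))"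
  have "(\<Prod>j\<in>set_mset R - {k}. w j ^ count (add_mset k R) j / fact (count (add_mset k R) j)) = X"
    unfolding X_def by (rule prod.cong) auto
  hence 1: "type_weight w (add_mset k R) = w k ^ Suc (count R k) / fact (Suc (count R k)) * X"
    by (subst eq) auto
  have 2: "type_weight w R = w k ^ count R k / fact (count R k) * X"
    by (subst eq) (auto simp: X_def)
  show ?thesis unfolding 1 2 by (simp add: field_simps fact_Suc del: of_nat_Suc)
qed

text \<open>Marking a part: the pairs (\<mu>, k) with k in \<mu> correspond to the pairs (k, R) with
  \<mu> = R + k, and the multiplicity of k, counting the copies that may be marked, cancels against
  the factorial. This serves both the recursion for the coefficients and the count of permutations
  by cycle type.\<close>

lemma sum_partitions_remove_part:
  "(\<Sum>\<mu>\<in>partitions N. \<Sum>k\<in>set_mset \<mu>. real (count \<mu> k) * type_weight w \<mu> * f (\<mu> - {#k#}) k)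
   = (\<Sum>k=1..N. \<Sum>R\<in>partitions (N - k). w k * type_weight w R * f R k)"
proof -
  have "(\<Sum>\<mu>\<in>partitions N. \<Sum>k\<in>set_mset \<mu>. real (count \<mu> k) * type_weight w \<mu> * f (\<mu> - {#k#}) k)
    = (\<Sum>(\<mu>,k)\<in>Sigma (partitions N) set_mset. real (count \<mu> k) * type_weight w \<mu> * f (\<mu> - {#k#}) k)"
    by (subst sum.Sigma) auto
  also have "\<dots> = (\<Sum>(k,R)\<in>Sigma {1..N} (\<lambda>k. partitions (N - k)). w k * type_weight w R * f R k)"
  proof (rule sum.reindex_bij_witness[where i = "\<lambda>(k,R). (add_mset k R, k)" and j = "\<lambda>(\<mu>,k). (k, \<mu> - {#k#})"])
    fix a assume "a \<in> Sigma (partitions N) set_mset"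
    then obtain \<mu> k where a: "a = (\<mu>,k)" "\<mu> \<in> partitions N" "k \<in># \<mu>" by auto
    then obtain R where R: "\<mu> = add_mset k R" by (metis multi_member_split)
    show "(case case a of (\<mu>, k) \<Rightarrow> (k, \<mu> - {#k#}) of (k, R) \<Rightarrow> (add_mset k R, k)) = a"
      using a R by auto
    show "(case a of (\<mu>, k) \<Rightarrow> (k, \<mu> - {#k#})) \<in> Sigma {1..N} (\<lambda>k. partitions (N - k))"
      using a R in_partitions_le[of \<mu> N k] by (auto simp: partitions_def)
    show "(case case a of (\<mu>, k) \<Rightarrow> (k, \<mu> - {#k#}) of (k, R) \<Rightarrow> w k * type_weight w R * f R k) =
         (case a of (\<mu>, k) \<Rightarrow> real (count \<mu> k) * type_weight w \<mu> * f (\<mu> - {#k#}) k)"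
      using a R type_weight_add[of R k w] by auto
  qed (auto simp: partitions_def)
  also have "\<dots> = (\<Sum>k=1..N. \<Sum>R\<in>partitions (N - k). w k * type_weight w R * f R k)"
    by (subst sum.Sigma) auto
  finally show ?thesis .
qed

lemma sum_mset_count: "sum_mset \<mu> = (\<Sum>k\<in>set_mset \<mu>. count \<mu> k * (k::nat))"
proof -
  have "finite A \<Longrightarrow> set_mset \<mu> \<subseteq> A \<Longrightarrow> sum_mset \<mu> = (\<Sum>k\<in>A. count \<mu> k * (k::nat))" for A
  proof (induction \<mu>)
    case (add x \<mu>)
    have "(\<Sum>k\<in>A. count (add_mset x \<mu>) k * k) = (\<Sum>k\<in>A. count \<mu> k * k + (if k = x then k else 0))"
      by (rule sum.cong) auto
    also have "\<dots> = sum_mset \<mu> + x"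
      using add by (simp add: sum.distrib)
    finally show ?case by simp
  qed simp
  from this[of "set_mset \<mu>"] show ?thesis by simp
qed

lemma partitions_0 [simp]: "partitions 0 = {{#}}"
proof -
  have "\<mu> = {#}" if "sum_mset \<mu> = 0" "0 \<notin># \<mu>" for \<mu> :: "nat multiset"
    using that by (cases \<mu>) auto
  thus ?thesis by (auto simp: partitions_def)
qed

lemma exp_coeff_0 [simp]: "exp_coeff w 0 = 1"
  by (simp add: exp_coeff_def type_weight_def)

text \<open>Coefficient form of z A' = z P' A for A = exp P. Each part is marked with its size as
  weight, and the sizes add up to N.\<close>

lemma exp_coeff_rec: "real N * exp_coeff w N = (\<Sum>k=1..N. real k * w k * exp_coeff w (N - k))"
proof -
  have "real N * exp_coeff w N =
    (\<Sum>\<mu>\<in>partitions N. \<Sum>k\<in>set_mset \<mu>. real (count \<mu> k) * type_weight w \<mu> * real k)"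
    unfolding exp_coeff_def sum_distrib_left
  proof (rule sum.cong)
    fix \<mu> assume "\<mu> \<in> partitions N"
    hence "N = sum_mset \<mu>" by (simp add: partitions_def)
    hence "real N = (\<Sum>k\<in>set_mset \<mu>. real (count \<mu> k) * real k)"
      by (simp only: sum_mset_count of_nat_sum of_nat_mult)
    thus "real N * type_weight w \<mu> = (\<Sum>k\<in>set_mset \<mu>. real (count \<mu> k) * type_weight w \<mu> * real k)"
      by (simp add: sum_distrib_right sum_distrib_left mult_ac)
  qed simp
  also have "\<dots> = (\<Sum>k=1..N. \<Sum>R\<in>partitions (N - k). w k * type_weight w R * real k)"
    by (rule sum_partitions_remove_part)
  also have "\<dots> = (\<Sum>k=1..N. real k * w k * exp_coeff w (N - k))"
    by (simp add: exp_coeff_def sum_distrib_left mult_ac)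
  finally show ?thesis .
qed

section \<open>Cycle types after the insertion of one point, and Cauchy's formula\<close>

lemma cycle_type_fixed:
  assumes "finite S" "a \<notin> S" "p permutes S"
  shows "cycle_type (insert a S) p = add_mset 1 (cycle_type S p)"
proof -
  have "p a = a" using assms by (simp add: permutes_def)
  hence "orbit p a = {a}" by (simp add: orbit_eq_singleton_iff)
  moreover have "{a} \<notin> orbit p ` S"
    using permutes_orbit_subset[OF assms(3)] assms(2) by blast
  ultimately show ?thesis using assms(1) by (simp add: cycle_type_def)
qed

text \<open>The composition inserts a into the cycle of b, right before b: it sends a to b and the
  former preimage of b to a, and agrees with p elsewhere.\<close>

lemma orbit_transpose_comp:
  assumes "finite S" "a \<notin> S" "p permutes S" "b \<in> S"
  shows "orbit (Transposition.transpose a b \<circ> p) a = insert a (orbit p b)"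
    and "\<And>x. x \<in> orbit p b \<Longrightarrow> orbit (Transposition.transpose a b \<circ> p) x = insert a (orbit p b)"
    and "\<And>x. x \<in> S \<Longrightarrow> x \<notin> orbit p b \<Longrightarrow> orbit (Transposition.transpose a b \<circ> p) x = orbit p x"
proof -
  define q where "q = Transposition.transpose a b \<circ> p"
  have pa: "p a = a" using assms by (simp add: permutes_def)
  have perm_p: "permutation p" using assms by (auto simp: permutation_permutes)
  have "q permutes insert a S" unfolding q_def using assms
    by (intro permutes_compose[of p] permutes_swap_id permutes_imp_permutes_insert) auto
  hence perm_q: "permutation q" using assms(1) by (auto simp: permutation_permutes)
  have sub: "orbit p x \<subseteq> S" if "x \<in> S" for x using permutes_orbit_subset[OF assms(3) that] .
  have qa: "q a = b" by (simp add: q_def pa)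
  have bb: "b \<in> orbit p b" by (rule permutation_self_in_orbit[OF perm_p])
  have aq: "a \<in> orbit q a" by (rule permutation_self_in_orbit[OF perm_q])
  have bq: "b \<in> orbit q a" using orbit.base[of q a] qa by simp
  have ne: "a \<noteq> b" using assms by auto
  \<comment> \<open>The new orbit of a is closed under p on \<open>S\<close>: only the preimage of b
    is treated differently by q, and its p-value b is in the orbit already.\<close>
  have step: "p y \<in> orbit q a" if "y \<in> orbit q a" "y \<in> S" for y
  proof (cases "p y = b")
    case False
    have "p y \<in> S" using that assms(3) by (simp add: permutes_in_image)
    hence "p y \<noteq> a" using assms by auto
    hence "q y = p y" using False by (simp add: q_def Transposition.transpose_def)
    thus ?thesis using orbit.step[OF that(1)] by simp
  qed (simp add: bq)
  have "y \<in> orbit q a" if "y \<in> orbit p b" for y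
    using that
  proof induction
    case base
    show ?case by (rule step[OF bq assms(4)])
  next
    case (step y)
    thus ?case using sub[OF assms(4)] \<open>\<And>y. y \<in> orbit q a \<Longrightarrow> y \<in> S \<Longrightarrow> p y \<in> orbit q a\<close> by blast
  qed
  moreover have "y \<in> insert a (orbit p b)" if "y \<in> orbit q a" for y
    using that
  proof induction
    case base
    show ?case using bb qa by simp
  next
    case (step y)
    show ?case
    proof (cases "y = a")
      case True thus ?thesis using bb qa by simp
    next
      case False
      hence "p y \<in> orbit p b" using step by (auto intro: orbit.step)
      moreover have "p y \<noteq> a" using calculation sub[OF assms(4)] assms(2) by blast
      ultimately show ?thesis by (auto simp: q_def Transposition.transpose_def)
    qed
  qed
  ultimately show 1: "orbit (Transposition.transpose a b \<circ> p) a = insert a (orbit p b)"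
    using aq by (auto simp: q_def)
  show "orbit (Transposition.transpose a b \<circ> p) x = insert a (orbit p b)" if "x \<in> orbit p b" for x
  proof -
    have "cyclic_on q (orbit q a)" by (rule cyclic_on_orbit'[OF perm_q])
    moreover have "x \<in> orbit q a" using that 1 by (auto simp: q_def)
    ultimately show ?thesis using orbit_cyclic_eq3 1 by (metis q_def)
  qed
  show "orbit (Transposition.transpose a b \<circ> p) x = orbit p x" if "x \<in> S" "x \<notin> orbit p b" for x
  proof -
    have bx: "b \<notin> orbit p x"
    proof
      assume "b \<in> orbit p x"
      hence "orbit p b = orbit p x"
        by (rule orbit_cyclic_eq3[OF cyclic_on_orbit'[OF perm_p]])
      thus False using that permutation_self_in_orbit[OF perm_p, of x] by auto
    qed
    have "orbit p x = orbit q x"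
    proof (rule orbit_cong0[where A = "orbit p x"])
      show "x \<in> orbit p x" by (rule permutation_self_in_orbit[OF perm_p])
      show "p \<in> orbit p x \<rightarrow> orbit p x" by (auto intro: orbit.step)
      fix y assume y: "y \<in> orbit p x"
      hence "p y \<in> orbit p x" by (rule orbit.step)
      thus "p y = q y" using bx sub[OF that(1)] assms(2) by (auto simp: q_def Transposition.transpose_def)
    qed
    thus ?thesis by (simp add: q_def)
  qed
qed

lemma cycle_type_transpose_comp:
  assumes "finite S" "a \<notin> S" "p permutes S" "b \<in> S"
  shows "card (orbit p b) \<in># cycle_type S p"
    "cycle_type (insert a S) (Transposition.transpose a b \<circ> p) =
      add_mset (Suc (card (orbit p b))) (cycle_type S p - {#card (orbit p b)#})"
proof -
  note o = orbit_transpose_comp[OF assms]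
  let ?C = "orbit p b" let ?q = "Transposition.transpose a b \<circ> p"
  define X where "X = orbit p ` S - {?C}"
  have perm_p: "permutation p" using assms by (auto simp: permutation_permutes)
  have sub: "orbit p x \<subseteq> S" if "x \<in> S" for x using permutes_orbit_subset[OF assms(3) that] .
  have finC: "finite ?C" using sub[OF assms(4)] assms(1) by (rule finite_subset)
  have aC: "a \<notin> ?C" using sub[OF assms(4)] assms(2) by auto
  have eq: "orbit p x = ?C" if "x \<in> ?C" for x
    by (rule orbit_cyclic_eq3[OF cyclic_on_orbit'[OF perm_p] that])
  have self: "x \<in> orbit p x" for x by (rule permutation_self_in_orbit[OF perm_p])
  have old: "orbit p ` S = insert ?C X" using assms(4) by (auto simp: X_def)
  have X: "?C \<notin> X" "finite X" using assms(1) by (auto simp: X_def)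
  have aX: "insert a ?C \<notin> X" using sub assms(2) by (auto simp: X_def)
  have new: "orbit ?q ` insert a S = insert (insert a ?C) X"
  proof (intro equalityI subsetI)
    fix Y assume "Y \<in> orbit ?q ` insert a S"
    then obtain x where x: "x \<in> insert a S" "Y = orbit ?q x" by auto
    consider "x = a" | "x \<in> ?C" | "x \<in> S" "x \<notin> ?C" using x by auto
    thus "Y \<in> insert (insert a ?C) X"
    proof cases
      case 3
      thus ?thesis using x o(3)[of x] self[of x] by (auto simp: X_def)
    qed (use o x in auto)
  next
    fix Y assume "Y \<in> insert (insert a ?C) X"
    then consider "Y = insert a ?C" | x where "x \<in> S" "Y = orbit p x" "orbit p x \<noteq> ?C"
      by (auto simp: X_def)
    thus "Y \<in> orbit ?q ` insert a S"
    proof cases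
      case 1 thus ?thesis using o(1) by auto
    next
      case 2
      hence "x \<notin> ?C" using eq by auto
      thus ?thesis using 2 o(3) by (metis image_eqI insertCI)
    qed
  qed
  have t: "cycle_type S p = add_mset (card ?C) (image_mset card (mset_set X))"
    unfolding cycle_type_def old using X by simp
  show "card ?C \<in># cycle_type S p" by (simp add: t)
  show "cycle_type (insert a S) ?q = add_mset (Suc (card ?C)) (cycle_type S p - {#card ?C#})"
    unfolding t unfolding cycle_type_def new using X aX aC finC by simp
qed

lemma count_cycle_type: 
  assumes "finite S"
  shows "count (cycle_type S p) k = card {c \<in> orbit p ` S. card c = k}"
proof -
  have "count (cycle_type S p) k = (\<Sum>y\<in>card -` {k} \<inter> orbit p ` S. count (mset_set (orbit p ` S)) y)"
    using assms by (simp add: cycle_type_def count_image_mset)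
  also have "\<dots> = (\<Sum>y\<in>card -` {k} \<inter> orbit p ` S. 1)"
    by (rule sum.cong) (use assms in auto)
  also have "\<dots> = card (card -` {k} \<inter> orbit p ` S)" by simp
  also have "card -` {k} \<inter> orbit p ` S = {c \<in> orbit p ` S. card c = k}" by blast
  finally show ?thesis .
qed

text \<open>The cycles partition \<open>S\<close>, and each cycle of length k contributes k points.
  The product counts the places where a new element can enter a cycle of length k.\<close>

lemma card_orbit_eq:
  assumes "finite S" "p permutes S"
  shows "card {b\<in>S. card (orbit p b) = k} = k * count (cycle_type S p) k"
proof -
  let ?X = "{c \<in> orbit p ` S. card c = k}"
  have perm_p: "permutation p" using assms by (auto simp: permutation_permutes)
  have eq: "orbit p x = orbit p y" if "x \<in> orbit p y" for x y
    by (rule orbit_cyclic_eq3[OF cyclic_on_orbit'[OF perm_p] that])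
  have self: "x \<in> orbit p x" for x by (rule permutation_self_in_orbit[OF perm_p])
  have sub: "orbit p x \<subseteq> S" if "x \<in> S" for x using permutes_orbit_subset[OF assms(2) that] .
  have "{b\<in>S. card (orbit p b) = k} = \<Union>?X"
  proof (intro equalityI subsetI)
    fix x assume "x \<in> \<Union>?X"
    then obtain y where y: "y \<in> S" "card (orbit p y) = k" "x \<in> orbit p y" by auto
    thus "x \<in> {b\<in>S. card (orbit p b) = k}" using eq[OF y(3)] sub[OF y(1)] by auto
  qed (use self in blast)
  moreover have "k * card ?X = card (\<Union>?X)"
  proof (rule card_partition)
    show "finite ?X" using assms by auto
    have "\<Union>?X \<subseteq> S" using sub by auto
    thus "finite (\<Union>?X)" using assms(1) finite_subset by blast
    fix c1 c2 assume "c1 \<in> ?X" "c2 \<in> ?X" "c1 \<noteq> c2"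
    thus "c1 \<inter> c2 = {}" using eq by blast
  qed auto
  ultimately show ?thesis using count_cycle_type[OF assms(1), of p k] by simp
qed

text \<open>Cauchy's count of permutations with given cycle multiplicities m_k, namely n! divided by
  the product of k^m_k m_k!, stated with a test function F so that induction on \<open>S\<close>
  goes through. Every permutation of \<open>insert a S\<close> arises once as p followed by the
  transposition of a and b, with p a permutation of \<open>S\<close>; the case b = a means that a is
  fixed.\<close>

theorem sum_permutes_cycle_type:
  fixes F :: "nat multiset \<Rightarrow> real"
  assumes "finite S"
  shows "(\<Sum>p | p permutes S. F (cycle_type S p)) =
    fact (card S) * (\<Sum>\<mu>\<in>partitions (card S). type_weight (\<lambda>k. 1 / real k) \<mu> * F \<mu>)"
  using assms
proof (induction S arbitrary: F)
  case empty
  show ?case by (simp add: cycle_type_def type_weight_def)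
next
  case (insert a S)
  let ?w = "\<lambda>k. 1 / real k" let ?n = "card S"
  \<comment> \<open>The sum of F over the types reachable from M by inserting a: as a fixed point,
    or at one of the k * count M k points in cycles of length k, whereby a part k becomes k +
    1.\<close>
  define G where "G M = F (add_mset 1 M) +
    (\<Sum>k\<in>set_mset M. real (count M k) * (real k * F (add_mset (Suc k) (M - {#k#}))))" for M
  have split: "F (cycle_type (insert a S) p) + (\<Sum>b\<in>S. F (cycle_type (insert a S) (Transposition.transpose a b \<circ> p)))
      = G (cycle_type S p)" if p: "p permutes S" for p
  proof -
    let ?M = "cycle_type S p"
    have "(\<Sum>b\<in>S. F (cycle_type (insert a S) (Transposition.transpose a b \<circ> p)))
      = (\<Sum>b\<in>S. F (add_mset (Suc (card (orbit p b))) (?M - {#card (orbit p b)#})))"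
      by (rule sum.cong) (use cycle_type_transpose_comp(2)[OF insert.hyps(1,2) p] in auto)
    also have "\<dots> = (\<Sum>k\<in>set_mset ?M. \<Sum>b | b \<in> S \<and> card (orbit p b) = k.
        F (add_mset (Suc (card (orbit p b))) (?M - {#card (orbit p b)#})))"
      by (rule sum.group[symmetric])
         (use insert.hyps cycle_type_transpose_comp(1)[OF insert.hyps(1,2) p] in auto)
    also have "\<dots> = (\<Sum>k\<in>set_mset ?M. real (count ?M k) * (real k * F (add_mset (Suc k) (?M - {#k#}))))"
      using card_orbit_eq[OF insert.hyps(1) p] by (intro sum.cong) (auto simp: mult_ac)
    finally show ?thesis
      using cycle_type_fixed[OF insert.hyps(1,2) p] by (simp add: G_def)
  qed
  have "(\<Sum>p | p permutes insert a S. F (cycle_type (insert a S) p))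
    = (\<Sum>p | p permutes S. \<Sum>b\<in>insert a S. F (cycle_type (insert a S) (Transposition.transpose a b \<circ> p)))"
    unfolding sum_over_permutations_insert[OF insert.hyps(1,2)] by (rule sum.swap)
  also have "\<dots> = (\<Sum>p | p permutes S. G (cycle_type S p))"
    using insert.hyps split by (intro sum.cong) auto
  also have "\<dots> = fact ?n * (\<Sum>\<mu>\<in>partitions ?n. type_weight ?w \<mu> * G \<mu>)"
    by (rule insert.IH)
  also have "(\<Sum>\<mu>\<in>partitions ?n. type_weight ?w \<mu> * G \<mu>) =
     (\<Sum>\<mu>\<in>partitions ?n. type_weight ?w \<mu> * F (add_mset 1 \<mu>)) +
     (\<Sum>\<mu>\<in>partitions ?n. \<Sum>k\<in>set_mset \<mu>. real (count \<mu> k) * type_weight ?w \<mu> *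
         (real k * F (add_mset (Suc k) (\<mu> - {#k#}))))"
    by (simp add: G_def distrib_left sum.distrib sum_distrib_left mult_ac)
  also have "(\<Sum>\<mu>\<in>partitions ?n. \<Sum>k\<in>set_mset \<mu>. real (count \<mu> k) * type_weight ?w \<mu> *
         (real k * F (add_mset (Suc k) (\<mu> - {#k#})))) =
     (\<Sum>k=1..?n. \<Sum>R\<in>partitions (?n - k). ?w k * type_weight ?w R * (real k * F (add_mset (Suc k) R)))"
    by (rule sum_partitions_remove_part)
  also have "\<dots> = (\<Sum>k=1..?n. \<Sum>R\<in>partitions (?n - k). type_weight ?w R * F (add_mset (Suc k) R))"
    by (intro sum.cong) auto
  \<comment> \<open>Reindexed by the length of the cycle that contains a. The k choices within a
    cycle have cancelled the weight 1/k, and the fixed-point term supplies the missing length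
    1.\<close>
  also have "\<dots> = (\<Sum>k=2..Suc ?n. \<Sum>R\<in>partitions (Suc ?n - k). type_weight ?w R * F (add_mset k R))"
    by (rule sum.reindex_bij_witness[of _ "\<lambda>k. k - 1" Suc]) auto
  also have "(\<Sum>\<mu>\<in>partitions ?n. type_weight ?w \<mu> * F (add_mset 1 \<mu>)) + \<dots> =
     (\<Sum>k=1..Suc ?n. \<Sum>R\<in>partitions (Suc ?n - k). type_weight ?w R * F (add_mset k R))"
    by (subst (2) sum.atLeast_Suc_atMost) (auto simp: numeral_2_eq_2)
  \<comment> \<open>The factor 1 is split as (1/k) k, so that the part k can be put back into the
    weight.\<close>
  also have "\<dots> = (\<Sum>k=1..Suc ?n. \<Sum>R\<in>partitions (Suc ?n - k). ?w k * type_weight ?w R * (real k * F (add_mset k R)))"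
    by (intro sum.cong) auto
  also have "\<dots> = (\<Sum>\<mu>\<in>partitions (Suc ?n). \<Sum>k\<in>set_mset \<mu>. real (count \<mu> k) * type_weight ?w \<mu> *
         (real k * F (add_mset k (\<mu> - {#k#}))))"
    by (rule sum_partitions_remove_part[symmetric])
  also have "\<dots> = (\<Sum>\<mu>\<in>partitions (Suc ?n). real (Suc ?n) * (type_weight ?w \<mu> * F \<mu>))"
  proof (rule sum.cong)
    fix \<mu> assume "\<mu> \<in> partitions (Suc ?n)"
    hence "Suc ?n = sum_mset \<mu>" by (simp add: partitions_def)
    hence "real (Suc ?n) = (\<Sum>k\<in>set_mset \<mu>. real (count \<mu> k) * real k)"
      by (simp only: sum_mset_count of_nat_sum of_nat_mult)
    thus "(\<Sum>k\<in>set_mset \<mu>. real (count \<mu> k) * type_weight ?w \<mu> * (real k * F (add_mset k (\<mu> - {#k#}))))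
       = real (Suc ?n) * (type_weight ?w \<mu> * F \<mu>)"
      by (simp only: sum_distrib_right, intro sum.cong) (auto simp: mult_ac)
  qed simp
  finally show ?case using insert.hyps
    by (simp add: sum_distrib_left mult_ac del: of_nat_Suc)
qed

section \<open>Positivity and tilting of the weights\<close>

lemma type_weight_nonneg: "(\<And>k. k \<in># \<mu> \<Longrightarrow> w k \<ge> 0) \<Longrightarrow> type_weight w \<mu> \<ge> 0"
  unfolding type_weight_def by (intro prod_nonneg) auto

lemma exp_coeff_nonneg: "(\<And>k. k \<ge> 1 \<Longrightarrow> w k \<ge> 0) \<Longrightarrow> exp_coeff w N \<ge> 0"
  unfolding exp_coeff_def
  by (intro sum_nonneg type_weight_nonneg) (use in_partitions_le in blast)

lemma type_weight_cong: "(\<And>k. k \<in># \<mu> \<Longrightarrow> w k = w' k) \<Longrightarrow> type_weight w \<mu> = type_weight w' \<mu>"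
  unfolding type_weight_def by (intro prod.cong) auto

lemma exp_coeff_cong:
  "(\<And>k. 1 \<le> k \<Longrightarrow> k \<le> N \<Longrightarrow> w k = w' k) \<Longrightarrow> exp_coeff w N = exp_coeff w' N"
  unfolding exp_coeff_def
  by (intro sum.cong type_weight_cong) (use in_partitions_le in blast)+

text \<open>The tilt depends on \<open>\<mu>\<close> only through its sum. On partitions of N it is
  a constant factor and leaves normalised expectations unchanged, so r can be adapted to n.\<close>

lemma type_weight_tilt: "type_weight (\<lambda>k. w k * r ^ k) \<mu> = type_weight w \<mu> * r ^ sum_mset \<mu>"
proof -
  have "type_weight (\<lambda>k. w k * r ^ k) \<mu> =
    (\<Prod>k\<in>set_mset \<mu>. w k ^ count \<mu> k / fact (count \<mu> k) * r ^ (count \<mu> k * k))"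
    unfolding type_weight_def
    by (intro prod.cong) (auto simp: power_mult_distrib power_mult mult.commute simp flip: power_mult)
  also have "\<dots> = type_weight w \<mu> * r ^ sum_mset \<mu>"
    unfolding prod.distrib type_weight_def sum_mset_count power_sum ..
  finally show ?thesis .
qed

lemma exp_coeff_tilt: "exp_coeff (\<lambda>k. w k * r ^ k) N = r ^ N * exp_coeff w N"
  unfolding exp_coeff_def type_weight_tilt sum_distrib_left
  by (intro sum.cong) (auto simp: partitions_def)

section \<open>Partitions with distinct leading parts\<close>

lemma type_weight_new_part: "k \<notin># R \<Longrightarrow> type_weight w (add_mset k R) = w k * type_weight w R"
  using type_weight_add[of R k w] by (simp add: not_in_iff)

lemma type_weight_add_list:
  assumes "distinct ks" "set ks \<inter> set_mset R = {}"
  shows "type_weight w (R + mset ks) = prod_list (map w ks) * type_weight w R"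
  using assms by (induction ks) (auto simp: type_weight_new_part)

lemma rev_sorted_list_add_larger:
  assumes "sorted_wrt (>) ks" "\<And>k r. k \<in> set ks \<Longrightarrow> r \<in># R \<Longrightarrow> r < k"
  shows "rev (sorted_list_of_multiset (R + mset ks)) = ks @ rev (sorted_list_of_multiset R)"
proof -
  have "sorted (sorted_list_of_multiset R @ rev ks)"
    using assms by (auto simp: sorted_append sorted_wrt_rev intro: less_imp_le sorted_wrt_mono_rel[of _ "(>)"])
  moreover have "mset (sorted_list_of_multiset R @ rev ks) = R + mset ks" by simp
  ultimately have "sorted_list_of_multiset (R + mset ks) = sorted_list_of_multiset R @ rev ks"
    using sorted_list_of_multiset_mset sorted_sort_id by metis
  thus ?thesis by simp
qed

text \<open>Strict decrease excludes ties; partitions with ties among the K largest parts are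
  dropped in the lower bound below.\<close>

definition leading_lengths :: "nat \<Rightarrow> nat \<Rightarrow> nat list set" where
  "leading_lengths K n = {ks. length ks = K \<and> sorted_wrt (>) ks \<and> 0 \<notin> set ks \<and> sum_list ks \<le> n}"

lemma finite_leading_lengths [simp]: "finite (leading_lengths K n)"
proof (rule finite_subset)
  show "leading_lengths K n \<subseteq> {ks. set ks \<subseteq> {..n} \<and> length ks = K}"
    using member_le_sum_list by (force simp: leading_lengths_def)
qed (rule finite_lists_length_eq, simp)

text \<open>The partitions R + ks, where all parts of R are below the last entry of ks, are pairwise
  distinct, and summing over R gives a truncated coefficient. Left out are the partitions with fewer
  than K parts and those with a tie that involves one of the K largest parts; as F \<ge> 0, this
  costs only an inequality.\<close>

lemma sum_partitions_ge_leading: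
  fixes w :: "nat \<Rightarrow> real" and F :: "nat multiset \<Rightarrow> real"
  assumes w: "\<And>k. k \<ge> 1 \<Longrightarrow> w k \<ge> 0" and K: "K \<ge> 1" and F: "\<And>\<mu>. F \<mu> \<ge> 0"
    and \<phi>: "\<And>\<mu>. K \<le> size \<mu> \<Longrightarrow> F \<mu> = \<phi> (take K (rev (sorted_list_of_multiset \<mu>)))"
  shows "(\<Sum>ks\<in>leading_lengths K n. \<phi> ks * prod_list (map w ks) *
            exp_coeff (\<lambda>k. if k < last ks then w k else 0) (n - sum_list ks))
       \<le> (\<Sum>\<mu>\<in>partitions n. type_weight w \<mu> * F \<mu>)"
proof -
  let ?L = "leading_lengths K n"
  define P where "P ks = {R \<in> partitions (n - sum_list ks). \<forall>r\<in>#R. r < last ks}" for ks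
  have larger: "r < k" if "ks \<in> ?L" "R \<in> P ks" "k \<in> set ks" "r \<in># R" for ks R k r
  proof -
    have "last ks \<le> k" using that(1,3)
    proof (induction ks rule: rev_induct)
      case (snoc x xs)
      thus ?case by (auto simp: leading_lengths_def sorted_wrt_append less_imp_le)
    qed simp
    thus ?thesis using that by (auto simp: P_def)
  qed
  have top: "rev (sorted_list_of_multiset (R + mset ks)) = ks @ rev (sorted_list_of_multiset R)"
    if "ks \<in> ?L" "R \<in> P ks" for ks R
    by (rule rev_sorted_list_add_larger) (use that larger[OF that] in \<open>auto simp: leading_lengths_def\<close>)
  have inP: "R + mset ks \<in> partitions n" if "ks \<in> ?L" "R \<in> P ks" for ks R
    using that by (auto simp: P_def leading_lengths_def partitions_def sum_mset_sum_list)
  have W: "type_weight w (R + mset ks) = prod_list (map w ks) * type_weight w R"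
    if "ks \<in> ?L" "R \<in> P ks" for ks R
    by (rule type_weight_add_list)
       (use that larger[OF that] in \<open>auto simp: leading_lengths_def sorted_wrt_iff_nth_less distinct_conv_nth
         intro: less_irrefl, metis less_irrefl linorder_neqE_nat\<close>)
  have FF: "F (R + mset ks) = \<phi> ks" if "ks \<in> ?L" "R \<in> P ks" for ks R
  proof -
    have "length ks = K" using that by (auto simp: leading_lengths_def)
    thus ?thesis using that by (subst \<phi>) (auto simp: top)
  qed
  have fin: "finite (P ks)" for ks unfolding P_def by simp
  \<comment> \<open>Weights set to zero from last ks on kill every partition with a part that large,
    so the truncated coefficient is a sum over \<open>P ks\<close>.\<close>
  have E: "exp_coeff (\<lambda>k. if k < last ks then w k else 0) (n - sum_list ks) = (\<Sum>R\<in>P ks. type_weight w R)"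
    for ks
    unfolding exp_coeff_def
  proof (rule sum.mono_neutral_cong_right)
    show "\<forall>i\<in>partitions (n - sum_list ks) - P ks. type_weight (\<lambda>k. if k < last ks then w k else 0) i = 0"
    proof
      fix R assume "R \<in> partitions (n - sum_list ks) - P ks"
      then obtain r where "r \<in># R" "\<not> r < last ks" by (auto simp: P_def)
      thus "type_weight (\<lambda>k. if k < last ks then w k else 0) R = 0"
        unfolding type_weight_def by (intro prod_zero bexI[of _ r]) auto
    qed
    show "type_weight (\<lambda>k. if k < last ks then w k else 0) x = type_weight w x" if "x \<in> P ks" for x
      using that by (intro type_weight_cong) (auto simp: P_def)
  qed (auto simp: P_def)
  have "(\<Sum>ks\<in>?L. \<phi> ks * prod_list (map w ks) * exp_coeff (\<lambda>k. if k < last ks then w k else 0) (n - sum_list ks))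
    = (\<Sum>ks\<in>?L. \<Sum>R\<in>P ks. type_weight w (R + mset ks) * F (R + mset ks))"
    unfolding E sum_distrib_left by (intro sum.cong) (auto simp: W FF)
  also have "\<dots> = (\<Sum>(ks,R)\<in>Sigma ?L P. type_weight w (R + mset ks) * F (R + mset ks))"
    using fin by (subst sum.Sigma) auto
  also have "\<dots> = (\<Sum>\<mu>\<in>(\<lambda>(ks,R). R + mset ks) ` Sigma ?L P. type_weight w \<mu> * F \<mu>)"
  proof (subst sum.reindex)
    \<comment> \<open>The list ks is recovered as the first K entries of the decreasing list of
      parts.\<close>
    show "inj_on (\<lambda>(ks, R). R + mset ks) (Sigma ?L P)"
    proof (rule inj_onI, clarify)
      fix ks R ks' R' assume a: "ks \<in> ?L" "R \<in> P ks" "ks' \<in> ?L" "R' \<in> P ks'" "R + mset ks = R' + mset ks'"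
      have "ks @ rev (sorted_list_of_multiset R) = ks' @ rev (sorted_list_of_multiset R')"
        using top[OF a(1,2)] top[OF a(3,4)] a(5) by simp
      moreover have "length ks = length ks'" using a by (auto simp: leading_lengths_def)
      ultimately have "ks = ks'" by simp
      thus "ks = ks' \<and> R = R'" using a(5) by simp
    qed
  qed (simp add: case_prod_beta o_def)
  also have "\<dots> \<le> (\<Sum>\<mu>\<in>partitions n. type_weight w \<mu> * F \<mu>)"
    using inP by (intro sum_mono2 mult_nonneg_nonneg F type_weight_nonneg w) (auto dest: in_partitions_le)
  finally show ?thesis .
qed

section \<open>Expectations under the weighted measure as sums over partitions\<close>

lemma cycle_weight_eq:
  "cycle_weight \<theta> n \<sigma> = (\<Prod>k=1..n. \<theta> k ^ count (cycle_type {1..n} \<sigma>) k)"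
  by (simp add: cycle_weight_def cycle_count_def count_cycle_type cycle_supports_def)

lemma type_weight_div:
  assumes "\<mu> \<in> partitions n"
  shows "(\<Prod>k=1..n. \<theta> k ^ count \<mu> k) * type_weight (\<lambda>k. 1 / real k) \<mu> = type_weight (\<lambda>k. \<theta> k / real k) \<mu>"
proof -
  have "set_mset \<mu> \<subseteq> {1..n}" using in_partitions_le[OF assms] by auto
  thus ?thesis
    by (simp add: type_weight_superset[of "{1..n}"] power_divide power_one_over flip: prod.distrib)
qed

lemma normalization_eq: "normalization \<theta> n = exp_coeff (\<lambda>k. \<theta> k / real k) n"
proof -
  have "normalization \<theta> n = (\<Sum>\<mu>\<in>partitions n. type_weight (\<lambda>k. 1 / real k) \<mu> * (\<Prod>k=1..n. \<theta> k ^ count \<mu> k))"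
    unfolding normalization_def cycle_weight_eq
    by (subst sum_permutes_cycle_type) auto
  also have "\<dots> = exp_coeff (\<lambda>k. \<theta> k / real k) n"
    unfolding exp_coeff_def by (intro sum.cong refl) (metis type_weight_div mult.commute)
  finally show ?thesis .
qed

lemma integral_weighted_measure:
  fixes F :: "nat multiset \<Rightarrow> real"
  assumes \<theta>: "\<And>k. k \<ge> 1 \<Longrightarrow> \<theta> k \<ge> 0"
  shows "(\<integral>\<sigma>. F (cycle_type {1..n} \<sigma>) \<partial>weighted_measure \<theta> n) =
    (\<Sum>\<mu>\<in>partitions n. type_weight (\<lambda>k. \<theta> k / real k) \<mu> * F \<mu>) / exp_coeff (\<lambda>k. \<theta> k / real k) n"
proof -
  let ?Z = "exp_coeff (\<lambda>k. \<theta> k / real k) n"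
  have Z: "?Z \<ge> 0" using \<theta> by (intro exp_coeff_nonneg) auto
  have cw: "cycle_weight \<theta> n \<sigma> \<ge> 0" for \<sigma> unfolding cycle_weight_def using \<theta> by (intro prod_nonneg) auto
  have "(\<integral>\<sigma>. F (cycle_type {1..n} \<sigma>) \<partial>weighted_measure \<theta> n) =
     (\<Sum>\<sigma> | \<sigma> permutes {1..n}. (1 / (?Z * fact n) * cycle_weight \<theta> n \<sigma>) * F (cycle_type {1..n} \<sigma>))"
    unfolding weighted_measure_def normalization_eq using Z cw
    by (subst lebesgue_integral_point_measure_finite) (auto simp: finite_permutations)
  also have "\<dots> = (\<Sum>\<sigma> | \<sigma> permutes {1..n}. (\<lambda>\<mu>. (\<Prod>k=1..n. \<theta> k ^ count \<mu> k) * F \<mu>) (cycle_type {1..n} \<sigma>)) / (?Z * fact n)"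
    by (simp add: cycle_weight_eq sum_divide_distrib mult_ac)
  also have "\<dots> = (fact n * (\<Sum>\<mu>\<in>partitions n. type_weight (\<lambda>k. 1 / real k) \<mu> * ((\<Prod>k=1..n. \<theta> k ^ count \<mu> k) * F \<mu>))) / (?Z * fact n)"
    by (subst sum_permutes_cycle_type) auto
  also have "\<dots> = (\<Sum>\<mu>\<in>partitions n. type_weight (\<lambda>k. 1 / real k) \<mu> * ((\<Prod>k=1..n. \<theta> k ^ count \<mu> k) * F \<mu>)) / ?Z"
    by simp
  also have "(\<Sum>\<mu>\<in>partitions n. type_weight (\<lambda>k. 1 / real k) \<mu> * ((\<Prod>k=1..n. \<theta> k ^ count \<mu> k) * F \<mu>))
    = (\<Sum>\<mu>\<in>partitions n. type_weight (\<lambda>k. \<theta> k / real k) \<mu> * F \<mu>)"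
    by (intro sum.cong refl) (subst type_weight_div[symmetric], auto simp: mult_ac)
  finally show ?thesis .
qed

lemma longest_cycle_eq:
  "longest_cycle n i \<sigma> = (let ls = rev (sorted_list_of_multiset (cycle_type {1..n} \<sigma>))
     in if i \<le> length ls then ls ! (i - 1) else 0)"
  by (simp add: longest_cycle_def cycle_lengths_def cycle_type_def cycle_supports_def)

text \<open>Tilting multiplies numerator and denominator by r^n, so the expectation does not depend
  on r, which is later set to exp(-v).\<close>

lemma expectation_longest_ge:
  fixes \<theta> :: "nat \<Rightarrow> real" and \<phi> :: "(nat \<Rightarrow> nat) \<Rightarrow> real" and r :: real
  assumes \<theta>: "\<And>k. k \<ge> 1 \<Longrightarrow> \<theta> k \<ge> 0" and K: "K \<ge> 1" and r: "r > 0"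
    and \<phi>0: "\<And>x. \<phi> x \<ge> 0" and \<phi>: "\<And>x y. (\<And>i. i \<in> {1..K} \<Longrightarrow> x i = y i) \<Longrightarrow> \<phi> x = \<phi> y"
  defines "w \<equiv> \<lambda>k. \<theta> k / real k * r ^ k"
  shows "(\<Sum>ks\<in>leading_lengths K n. \<phi> (\<lambda>i. ks ! (i - 1)) * prod_list (map w ks) *
            (exp_coeff (\<lambda>k. if k < last ks then w k else 0) (n - sum_list ks) / exp_coeff w n))
       \<le> (\<integral>\<sigma>. \<phi> (\<lambda>i. longest_cycle n i \<sigma>) \<partial>weighted_measure \<theta> n)"
proof -
  let ?w = "\<lambda>k. \<theta> k / real k"
  define F where "F \<mu> = \<phi> (\<lambda>i. let ls = rev (sorted_list_of_multiset \<mu>) in if i \<le> length ls then ls ! (i - 1) else 0)"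
    for \<mu> :: "nat multiset"
  have "(\<integral>\<sigma>. \<phi> (\<lambda>i. longest_cycle n i \<sigma>) \<partial>weighted_measure \<theta> n) =
     (\<integral>\<sigma>. F (cycle_type {1..n} \<sigma>) \<partial>weighted_measure \<theta> n)"
    by (simp add: F_def longest_cycle_eq)
  also have "\<dots> = (\<Sum>\<mu>\<in>partitions n. type_weight ?w \<mu> * F \<mu>) / exp_coeff ?w n"
    by (rule integral_weighted_measure[OF \<theta>])
  also have "\<dots> = (\<Sum>\<mu>\<in>partitions n. type_weight w \<mu> * F \<mu>) / exp_coeff w n"
  proof -
    have "(\<Sum>\<mu>\<in>partitions n. type_weight w \<mu> * F \<mu>) = r ^ n * (\<Sum>\<mu>\<in>partitions n. type_weight ?w \<mu> * F \<mu>)"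
      unfolding w_def type_weight_tilt sum_distrib_left
      by (intro sum.cong) (auto simp: partitions_def)
    moreover have "exp_coeff w n = r ^ n * exp_coeff ?w n" unfolding w_def by (rule exp_coeff_tilt)
    ultimately show ?thesis using r by simp
  qed
  finally have 1: "(\<integral>\<sigma>. \<phi> (\<lambda>i. longest_cycle n i \<sigma>) \<partial>weighted_measure \<theta> n) =
     (\<Sum>\<mu>\<in>partitions n. type_weight w \<mu> * F \<mu>) / exp_coeff w n" .
  have w: "w k \<ge> 0" if "k \<ge> 1" for k using \<theta>[OF that] r by (simp add: w_def)
  have "(\<Sum>ks\<in>leading_lengths K n. \<phi> (\<lambda>i. ks ! (i - 1)) * prod_list (map w ks) *
            exp_coeff (\<lambda>k. if k < last ks then w k else 0) (n - sum_list ks))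
       \<le> (\<Sum>\<mu>\<in>partitions n. type_weight w \<mu> * F \<mu>)"
  proof (rule sum_partitions_ge_leading[OF w K])
    \<comment> \<open>With at least K parts, the default length 0 for missing cycles is not seen by
      the first K coordinates.\<close>
    fix \<mu> :: "nat multiset" assume "K \<le> size \<mu>"
    moreover have "length (sorted_list_of_multiset \<mu>) = size \<mu>"
      by (metis mset_sorted_list_of_multiset size_mset)
    ultimately show "F \<mu> = \<phi> (\<lambda>i. take K (rev (sorted_list_of_multiset \<mu>)) ! (i - 1))"
      unfolding F_def by (intro \<phi>) (auto simp: Let_def)
  qed (auto simp: F_def \<phi>0)
  hence "(\<Sum>ks\<in>leading_lengths K n. \<phi> (\<lambda>i. ks ! (i - 1)) * prod_list (map w ks) *
            exp_coeff (\<lambda>k. if k < last ks then w k else 0) (n - sum_list ks)) / exp_coeff w n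
       \<le> (\<Sum>\<mu>\<in>partitions n. type_weight w \<mu> * F \<mu>) / exp_coeff w n"
    using exp_coeff_nonneg[of w n] w by (intro divide_right_mono) auto
  thus ?thesis unfolding 1 by (simp add: sum_divide_distrib)
qed

lemma prob_weighted_measure:
  assumes \<theta>: "\<And>k. k \<ge> 1 \<Longrightarrow> \<theta> k \<ge> 0" and "exp_coeff (\<lambda>k. \<theta> k / real k) n > 0"
  shows "prob_space (weighted_measure \<theta> n)"
proof
  have "(\<integral>\<sigma>. 1 \<partial>weighted_measure \<theta> n) =
      (\<Sum>\<mu>\<in>partitions n. type_weight (\<lambda>k. \<theta> k / real k) \<mu> * 1) / exp_coeff (\<lambda>k. \<theta> k / real k) n"
    by (rule integral_weighted_measure[OF \<theta>])
  also have "\<dots> = 1" using assms(2) by (simp add: exp_coeff_def)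
  finally have "measure (weighted_measure \<theta> n) (space (weighted_measure \<theta> n)) = 1" by simp
  \<comment> \<open>An infinite total mass would give \<open>measure\<close> the value 0, so the
    value 1 determines \<open>emeasure\<close>.\<close>
  thus "emeasure (weighted_measure \<theta> n) (space (weighted_measure \<theta> n)) = 1"
    by (subst emeasure_eq_ennreal_measure) (auto simp: measure_def)
qed

section \<open>Fourier inversion and a local limit theorem\<close>

text \<open>By f' = P' f, the Taylor coefficients of f = exp P satisfy the recursion
  \<open>exp_coeff_rec\<close>, and both sequences start with 1. Finite support of w makes P a
  polynomial and f entire.\<close>

lemma higher_deriv_exp_gen:
  fixes w :: "nat \<Rightarrow> real"
  assumes w: "\<And>k. k \<ge> b \<Longrightarrow> w k = 0"
  defines "f \<equiv> (\<lambda>z. exp (\<Sum>k=1..<b. of_real (w k) * z ^ k))"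
  shows "(deriv ^^ N) f 0 = fact N * complex_of_real (exp_coeff w N)"
proof -
  define P where "P = (\<Sum>k=1..<b. fps_const (complex_of_real (w k)) * fps_X ^ k)"
  define A where "A = fps_expansion f 0"
  have holo: "f holomorphic_on UNIV" unfolding f_def by (intro holomorphic_intros)
  hence A: "f has_fps_expansion A" unfolding A_def
    by (intro analytic_at_imp_has_fps_expansion_0) (simp add: holomorphic_on_imp_analytic_at)
  have P: "(\<lambda>z. \<Sum>k=1..<b. of_real (w k) * z ^ k) has_fps_expansion P"
    unfolding P_def by (intro fps_expansion_intros)
  have "deriv f = (\<lambda>z. deriv (\<lambda>z. \<Sum>k=1..<b. of_real (w k) * z ^ k) z * f z)"
  proof
    fix z :: complex
    define g where "g = (\<lambda>z. \<Sum>k=1..<b. complex_of_real (w k) * z ^ k)"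
    have "g holomorphic_on UNIV" unfolding g_def by (intro holomorphic_intros)
    hence "(g has_field_derivative deriv g z) (at z)"
      by (rule holomorphic_derivI) auto
    hence "((\<lambda>z. exp (g z)) has_field_derivative exp (g z) * deriv g z) (at z)"
      by (rule DERIV_fun_exp)
    hence "(f has_field_derivative deriv (\<lambda>z. \<Sum>k=1..<b. of_real (w k) * z ^ k) z * f z) (at z)"
      by (simp add: f_def g_def mult.commute)
    thus "deriv f z = deriv (\<lambda>z. \<Sum>k=1..<b. of_real (w k) * z ^ k) z * f z"
      by (rule DERIV_imp_deriv)
  qed
  hence "deriv f has_fps_expansion fps_deriv P * A"
    by (simp only:) (intro has_fps_expansion_mult has_fps_expansion_deriv P A)
  moreover have "deriv f has_fps_expansion fps_deriv A" by (intro has_fps_expansion_deriv A)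
  ultimately have dA: "fps_deriv A = fps_deriv P * A" by (rule fps_expansion_unique_complex[rotated])
  have Pk: "fps_nth P k = of_real (w k)" if "k \<ge> 1" for k
  proof -
    have "fps_nth P k = (\<Sum>j=1..<b. if j = k then complex_of_real (w j) else 0)"
      unfolding P_def fps_sum_nth by (rule sum.cong) (auto simp: fps_X_power_nth)
    also have "\<dots> = of_real (w k)" using that w[of k] by auto
    finally show ?thesis .
  qed
  have A0: "fps_nth A 0 = 1"
    using fps_nth_fps_expansion[OF A, of 0] by (simp add: f_def power_0_left)
  have rec: "of_nat (Suc n) * fps_nth A (Suc n) = (\<Sum>k=1..Suc n. of_nat k * of_real (w k) * fps_nth A (Suc n - k))" for n
  proof -
    have "of_nat (Suc n) * fps_nth A (Suc n) = fps_nth (fps_deriv A) n" by simp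
    also have "\<dots> = (\<Sum>i=0..n. of_nat (Suc i) * of_real (w (Suc i)) * fps_nth A (n - i))"
      unfolding dA fps_mult_nth by (intro sum.cong) (auto simp: Pk)
    also have "\<dots> = (\<Sum>k=1..Suc n. of_nat k * of_real (w k) * fps_nth A (Suc n - k))"
      by (rule sum.reindex_bij_witness[of _ "\<lambda>k. k - 1" Suc]) auto
    finally show ?thesis .
  qed
  have "fps_nth A N = of_real (exp_coeff w N)"
  proof (induction N rule: less_induct)
    case (less N)
    show ?case
    proof (cases N)
      case (Suc n)
      have "of_nat N * fps_nth A N = (\<Sum>k=1..N. of_nat k * of_real (w k) * fps_nth A (N - k))"
        using rec[of n] Suc by simp
      also have "\<dots> = (\<Sum>k=1..N. of_nat k * of_real (w k) * of_real (exp_coeff w (N - k)))"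
        by (intro sum.cong) (auto simp: less)
      also have "\<dots> = of_real (real N * exp_coeff w N)"
        unfolding exp_coeff_rec by simp
      finally show ?thesis using Suc by (simp del: of_nat_Suc)
    qed (simp add: A0)
  qed
  thus ?thesis using fps_nth_fps_expansion[OF A, of N] by (simp add: field_simps)
qed

text \<open>The contour integral arrives over [0, 2 pi], but the main contribution sits at t = 0;
  the interval is centred there before rescaling.\<close>

lemma integral_periodic_shift:
  fixes f :: "real \<Rightarrow> complex"
  assumes "continuous_on UNIV f" "\<And>t. f (t + 2 * pi) = f t"
  shows "integral {0..2*pi} f = integral {-pi..pi} f"
proof -
  have int: "f integrable_on {a..b}" for a b
    by (intro integrable_continuous_interval continuous_on_subset[OF assms(1)]) auto
  have "((f \<circ> (+) (2*pi)) has_integral integral {pi..2*pi} f) (cbox (-pi) 0)"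
    unfolding has_integral_shift_cbox_iff using integrable_integral[OF int[of pi "2*pi"]] by simp
  moreover have "f \<circ> (+) (2*pi) = f" using assms(2) by (auto simp: fun_eq_iff add.commute)
  ultimately have "integral {-pi..0} f = integral {pi..2*pi} f"
    by (auto intro: integral_unique)
  thus ?thesis
    using Henstock_Kurzweil_Integration.integral_combine[of 0 pi "2*pi" f]
      Henstock_Kurzweil_Integration.integral_combine[of "-pi" 0 "pi" f] int by (simp add: add.commute)
qed

text \<open>Cauchy's formula for the N-th derivative at 0. The unit circle is the right contour
  because the tilt is already part of the weights.\<close>

lemma exp_coeff_fourier:
  fixes w :: "nat \<Rightarrow> real"
  assumes w: "\<And>k. k \<ge> b \<Longrightarrow> w k = 0"
  shows "complex_of_real (exp_coeff w N) = 1 / (2 * pi) *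
     (LINT t|lborel. indicator {-pi..pi} t *\<^sub>R (exp (\<Sum>k=1..<b. of_real (w k) * cis (real k * t)) * cis (- (real N * t))))"
proof -
  define f where "f = (\<lambda>z. exp (\<Sum>k=1..<b. complex_of_real (w k) * z ^ k))"
  define g where "g t = exp (\<Sum>k=1..<b. complex_of_real (w k) * cis (real k * t)) * cis (- (real N * t))" for t
  have holo: "f holomorphic_on UNIV" unfolding f_def by (intro holomorphic_intros)
  have cont: "continuous_on A f" for A
    using holomorphic_on_imp_continuous_on[OF holo] continuous_on_subset by blast
  have "(deriv ^^ N) f 0 = (fact N) / (2 * pi * \<i>) * contour_integral (circlepath 0 1) (\<lambda>u. f u/(u-0)^(Suc N))"
    by (rule Cauchy_higher_derivative_integral_circlepath(2))
       (auto intro: cont holomorphic_on_subset[OF holo])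
  moreover have "(deriv ^^ N) f 0 = fact N * complex_of_real (exp_coeff w N)"
    unfolding f_def using higher_deriv_exp_gen[of b w N, OF w] by auto
  ultimately have "complex_of_real (exp_coeff w N) = 1 / (2 * pi * \<i>) * contour_integral (circlepath 0 1) (\<lambda>u. f u/u^(Suc N))"
    by (simp add: field_simps)
  also have "contour_integral (circlepath 0 1) (\<lambda>u. f u/u^(Suc N))
     = integral {0..2*pi} (\<lambda>t. f (cis t) / cis t ^ Suc N * \<i> * cis t)"
    unfolding circlepath_def by (subst contour_integral_part_circlepath_eq) auto
  also have "\<dots> = integral {0..2*pi} (\<lambda>t. \<i> * g t)"
    by (intro integral_cong) (simp add: f_def g_def Complex.DeMoivre cis_divide field_simps cis_mult flip: cis_inverse cis_cnj)
  also have "\<dots> = \<i> * integral {0..2*pi} g" by (rule integral_mult_right)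
  also have "integral {0..2*pi} g = integral {-pi..pi} g"
  proof (rule integral_periodic_shift)
    show "continuous_on UNIV g" unfolding g_def by (intro continuous_intros)
    have 1: "cis (real k * (t + 2 * pi)) = cis (real k * t)" for k t
      using cis_mult[of "real k * t" "2 * pi * real k"] cis_multiple_2pi[of "real k"] by (simp add: algebra_simps)
    have 2: "cis (- (real k * (t + 2 * pi))) = cis (- (real k * t))" for k t
      using 1[of k t] by (metis cis_cnj)
    show "g (t + 2 * pi) = g t" for t unfolding g_def 1 2 ..
  qed
  also have "integral {-pi..pi} g = (LINT t:{-pi..pi}|lborel. g t)"
  proof (rule set_borel_integral_eq_integral(2)[symmetric])
    show "set_integrable lborel {- pi..pi} g"
      by (rule borel_integrable_atLeastAtMost') (auto simp: g_def intro!: continuous_intros)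
  qed
  finally show ?thesis by (simp add: g_def set_lebesgue_integral_def)
qed

lemma integrable_cauchy_density: "integrable lborel (\<lambda>x::real. C / (1 + x\<^sup>2))"
proof -
  have "einterval (-\<infinity>) \<infinity> = (UNIV :: real set)" by (auto simp: einterval_def)
  hence "integrable lborel (\<lambda>x::real. inverse (1 + x\<^sup>2))"
    using integrable_inverse_1_plus_square by (simp add: set_integrable_def)
  hence "integrable lborel (\<lambda>x::real. C * inverse (1 + x\<^sup>2))" by simp
  thus ?thesis by (simp add: field_simps)
qed

text \<open>Fourier inversion with t = x / s n. The normalised integrand is the characteristic
  function of a compound Poisson sum; the hypotheses on mean and second moment yield its Gaussian
  limit from a second-order expansion, and the third moment controls the error. The bound C / (1 +
  x^2) is much weaker than a Gaussian one but integrable, which is enough for dominated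
  convergence.\<close>

lemma local_limit_exp_coeff:
  fixes w :: "nat \<Rightarrow> nat \<Rightarrow> real" and b N :: "nat \<Rightarrow> nat" and s :: "nat \<Rightarrow> real"
  assumes s: "filterlim s at_top sequentially"
    and w: "\<And>n k. k \<ge> 1 \<Longrightarrow> w n k \<ge> 0"
    and mean: "(\<lambda>n. ((\<Sum>k=1..<b n. real k * w n k) - real (N n)) / s n) \<longlonglongrightarrow> 0"
    and var: "(\<lambda>n. (\<Sum>k=1..<b n. real k ^ 2 * w n k) / s n ^ 2) \<longlonglongrightarrow> 1"
    and third: "(\<lambda>n. (\<Sum>k=1..<b n. real k ^ 3 * w n k) / s n ^ 3) \<longlonglongrightarrow> 0"
    and dom: "\<forall>\<^sub>F n in sequentially. \<forall>t. \<bar>t\<bar> \<le> pi \<longrightarrow>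
        exp (- (\<Sum>k=1..<b n. w n k * (1 - cos (real k * t)))) \<le> C / (1 + (s n * t)\<^sup>2)"
  shows "(\<lambda>n. s n * exp (- (\<Sum>k=1..<b n. w n k)) * exp_coeff (\<lambda>k. if k < b n then w n k else 0) (N n))
     \<longlonglongrightarrow> (LINT x|lborel. exp (- (x\<^sup>2) / 2)) / (2 * pi)"
proof -
  define \<phi> where "\<phi> n x = indicator {-pi..pi} (x / s n) *\<^sub>R
     (exp (\<Sum>k=1..<b n. of_real (w n k) * (cis (real k * (x / s n)) - 1)) * cis (- (real (N n) * (x / s n))))" for n x
  obtain n0 where n0: "\<And>n. n \<ge> n0 \<Longrightarrow> s n > 0"
     "\<And>n t. n \<ge> n0 \<Longrightarrow> \<bar>t\<bar> \<le> pi \<Longrightarrow>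
        exp (- (\<Sum>k=1..<b n. w n k * (1 - cos (real k * t)))) \<le> C / (1 + (s n * t)\<^sup>2)"
    using eventually_conj[OF dom filterlim_at_top_dense[THEN iffD1, OF s, rule_format, of 0]]
    unfolding eventually_sequentially by auto
  have norm_\<phi>: "norm (\<phi> n x) \<le> C / (1 + x\<^sup>2)" if "n \<ge> n0" for n x
  proof (cases "\<bar>x / s n\<bar> \<le> pi")
    case True
    have "norm (\<phi> n x) = exp (Re (\<Sum>k=1..<b n. of_real (w n k) * (cis (real k * (x / s n)) - 1)))"
      using True by (simp add: \<phi>_def norm_mult indicator_def abs_le_iff del: abs_divide)
    also have "Re (\<Sum>k=1..<b n. of_real (w n k) * (cis (real k * (x / s n)) - 1)) =
        - (\<Sum>k=1..<b n. w n k * (1 - cos (real k * (x / s n))))"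
      by (simp add: Re_sum algebra_simps flip: sum_negf)
    also have "exp \<dots> \<le> C / (1 + (s n * (x / s n))\<^sup>2)" using that n0(2) True by blast
    also have "s n * (x / s n) = x" using n0(1)[OF that] by simp
    finally show ?thesis .
  next
    case False
    \<comment> \<open>At t = 0 the hypothesis reads 1 \<le> C, so the bound is nonnegative where the
      indicator vanishes.\<close>
    have "0 \<le> exp (- (\<Sum>k=1..<b n. w n k * (1 - cos (real k * 0))))" by simp
    also have "\<dots> \<le> C" using n0(2)[OF that, of 0] by simp
    finally show ?thesis using False by (auto simp: \<phi>_def indicator_def abs_le_iff simp del: abs_divide)
  qed
  have lim_\<phi>: "(\<lambda>n. \<phi> n x) \<longlonglongrightarrow> of_real (exp (- (x\<^sup>2) / 2))" for x
  proof -
    define y where "y n k = real k * (x / s n)" for n k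
    \<comment> \<open>The exponent is R + i x A - x^2 B / 2: R is the third-order remainder, A the
      centred and rescaled mean, B the rescaled second moment.\<close>
    define R where "R n = (\<Sum>k=1..<b n. of_real (w n k) * (cis (y n k) - (1 + \<i> * y n k - (y n k)\<^sup>2 / 2)))" for n
    define A where "A n = ((\<Sum>k=1..<b n. real k * w n k) - real (N n)) / s n" for n
    define B where "B n = (\<Sum>k=1..<b n. real k ^ 2 * w n k) / s n ^ 2" for n
    have bnd: "norm (cis t - (1 + \<i> * t - t\<^sup>2 / 2)) \<le> \<bar>t\<bar> ^ 3" for t :: real
    proof -
      have "norm (cis t - (1 + \<i> * t - t\<^sup>2 / 2)) \<le> \<bar>t\<bar> ^ 3 / fact 3"
        using iexp_approx1[of t 2]
        by (simp add: cis_conv_exp numeral_2_eq_2 numeral_3_eq_3 power_mult_distrib algebra_simps)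
      also have "\<dots> \<le> \<bar>t\<bar> ^ 3" by (simp add: divide_le_eq fact_numeral mult_le_cancel_left1)
      finally show ?thesis .
    qed
    have "R \<longlonglongrightarrow> 0"
    proof (rule Lim_null_comparison)
      show "\<forall>\<^sub>F n in sequentially. norm (R n) \<le> \<bar>x\<bar> ^ 3 * ((\<Sum>k=1..<b n. real k ^ 3 * w n k) / s n ^ 3)"
      proof (rule eventually_sequentiallyI[of n0])
        fix n assume n: "n \<ge> n0"
        have "norm (R n) \<le> (\<Sum>k=1..<b n. w n k * \<bar>y n k\<bar> ^ 3)"
          unfolding R_def
          by (rule order_trans[OF norm_sum sum_mono])
             (use bnd w in \<open>auto simp: norm_mult intro!: mult_left_mono\<close>)
        also have "\<dots> = \<bar>x\<bar> ^ 3 * ((\<Sum>k=1..<b n. real k ^ 3 * w n k) / s n ^ 3)"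
          using n0(1)[OF n] by (simp add: y_def sum_divide_distrib sum_distrib_left abs_mult
              power_mult_distrib power_divide mult_ac)
        finally show "norm (R n) \<le> \<dots>" .
      qed
      show "(\<lambda>n. \<bar>x\<bar> ^ 3 * ((\<Sum>k=1..<b n. real k ^ 3 * w n k) / s n ^ 3)) \<longlonglongrightarrow> 0"
        using tendsto_mult_right_zero[OF third] by simp
    qed
    moreover have "A \<longlonglongrightarrow> 0" "B \<longlonglongrightarrow> 1" using mean var by (simp_all add: A_def[abs_def] B_def[abs_def])
    ultimately have lim: "(\<lambda>n. exp (R n + \<i> * of_real x * of_real (A n) - of_real (x\<^sup>2 / 2) * of_real (B n)))
        \<longlonglongrightarrow> exp (0 + \<i> * of_real x * of_real 0 - of_real (x\<^sup>2 / 2) * of_real 1)"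
      by (intro tendsto_intros)
    have "\<forall>\<^sub>F n in sequentially. s n > \<bar>x\<bar> / pi"
      using filterlim_at_top_dense[THEN iffD1, OF s] by blast
    hence "\<forall>\<^sub>F n in sequentially. exp (R n + \<i> * of_real x * of_real (A n) - of_real (x\<^sup>2 / 2) * of_real (B n)) = \<phi> n x"
      using eventually_ge_at_top[of n0]
    proof eventually_elim
      case (elim n)
      have sn: "s n > 0" using n0 elim by auto
      have "\<bar>x / s n\<bar> \<le> pi" using elim sn by (simp add: field_simps)
      hence ind: "indicator {-pi..pi} (x / s n) = (1::real)" by (simp add: indicator_def abs_le_iff del: abs_divide)
      have "(\<Sum>k=1..<b n. of_real (w n k) * (cis (y n k) - 1)) =
         R n + \<i> * (\<Sum>k=1..<b n. complex_of_real (w n k) * complex_of_real (y n k)) -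
           (\<Sum>k=1..<b n. complex_of_real (w n k) * (complex_of_real (y n k))\<^sup>2) / 2"
        unfolding R_def by (simp add: sum_distrib_left sum_divide_distrib algebra_simps flip: sum.distrib sum_subtractf)
      also have "(\<Sum>k=1..<b n. complex_of_real (w n k) * y n k) = of_real (x * ((\<Sum>k=1..<b n. real k * w n k) / s n))"
        by (simp add: y_def sum_divide_distrib sum_distrib_left mult_ac)
      also have "(\<Sum>k=1..<b n. complex_of_real (w n k) * (complex_of_real (y n k))\<^sup>2) = of_real (x\<^sup>2 * B n)"
        by (simp add: y_def B_def sum_divide_distrib sum_distrib_left power_mult_distrib power_divide mult_ac)
      finally have eq: "(\<Sum>k=1..<b n. of_real (w n k) * (cis (real k * (x / s n)) - 1)) =
         R n + \<i> * of_real (x * ((\<Sum>k=1..<b n. real k * w n k) / s n)) - of_real (x\<^sup>2 * B n) / 2"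
        by (simp add: y_def)
      show ?case unfolding \<phi>_def ind eq
        by (simp add: A_def cis_conv_exp diff_divide_distrib algebra_simps flip: exp_add)
    qed
    thus ?thesis using tendsto_cong[of _ "\<lambda>n. \<phi> n x", THEN iffD1, OF _ lim]
      by (simp add: exp_of_real[symmetric])
  qed
  have meas: "\<phi> n \<in> borel_measurable lborel" for n
  proof -
    have [measurable]: "cis \<in> borel_measurable borel"
      by (intro borel_measurable_continuous_onI continuous_intros)
    show ?thesis unfolding \<phi>_def by measurable
  qed
  \<comment> \<open>The bound is available from n0 on, hence the shifted sequence; the shift is
    undone right after.\<close>
  have "(\<lambda>n. LINT x|lborel. \<phi> (n + n0) x) \<longlonglongrightarrow> (LINT x|lborel. complex_of_real (exp (- (x\<^sup>2) / 2)))"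
  proof (rule integral_dominated_convergence)
    show "integrable lborel (\<lambda>x. C / (1 + x\<^sup>2))" by (rule integrable_cauchy_density)
    show "AE x in lborel. (\<lambda>n. \<phi> (n + n0) x) \<longlonglongrightarrow> of_real (exp (- (x\<^sup>2) / 2))"
      by (intro AE_I2 LIMSEQ_ignore_initial_segment lim_\<phi>)
  qed (use meas norm_\<phi> in auto)
  hence lim: "(\<lambda>n. LINT x|lborel. \<phi> n x) \<longlonglongrightarrow> of_real (LINT x|lborel. exp (- (x\<^sup>2) / 2))"
    by (subst (asm) integral_complex_of_real) (rule LIMSEQ_offset)
  have eq: "of_real (s n * exp (- (\<Sum>k=1..<b n. w n k)) * exp_coeff (\<lambda>k. if k < b n then w n k else 0) (N n))
     = (LINT x|lborel. \<phi> n x) / (2 * pi)" if n: "n \<ge> n0" for n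
  proof -
    let ?W = "\<Sum>k=1..<b n. w n k"
    have sn: "s n > 0" using n0 n by auto
    define g where "g t = indicator {-pi..pi} t *\<^sub>R (exp (\<Sum>k=1..<b n. of_real (w n k) * (cis (real k * t) - 1))
        * cis (- (real (N n) * t)))" for t
    have "complex_of_real (exp_coeff (\<lambda>k. if k < b n then w n k else 0) (N n)) = 1 / (2 * pi) *
      (LINT t|lborel. indicator {-pi..pi} t *\<^sub>R (exp (\<Sum>k=1..<b n. of_real (if k < b n then w n k else 0) * cis (real k * t)) * cis (- (real (N n) * t))))"
      by (rule exp_coeff_fourier) auto
    also have "(\<lambda>t. indicator {-pi..pi} t *\<^sub>R (exp (\<Sum>k=1..<b n. of_real (if k < b n then w n k else 0) * cis (real k * t)) * cis (- (real (N n) * t))))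
       = (\<lambda>t. of_real (exp ?W) * g t)"
    proof
      fix t
      have "(\<Sum>k=1..<b n. of_real (if k < b n then w n k else 0) * cis (real k * t)) =
         of_real ?W + (\<Sum>k=1..<b n. of_real (w n k) * (cis (real k * t) - 1))"
        by (simp add: algebra_simps flip: sum.distrib)
      thus "indicator {-pi..pi} t *\<^sub>R (exp (\<Sum>k=1..<b n. of_real (if k < b n then w n k else 0) * cis (real k * t)) * cis (- (real (N n) * t)))
         = of_real (exp ?W) * g t"
        by (simp add: g_def exp_add scaleR_conv_of_real mult_ac flip: exp_of_real)
    qed
    also have "(LINT t|lborel. of_real (exp ?W) * g t) = of_real (exp ?W) * (LINT t|lborel. g t)" by simp
    \<comment> \<open>Substitution t = x / s n. Its Jacobian is what the factor s n in the claim
      compensates.\<close>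
    also have "(LINT t|lborel. g t) = \<bar>1 / s n\<bar> *\<^sub>R (LINT x|lborel. g (0 + (1 / s n) * x))"
      by (rule lborel_integral_real_affine) (use sn in auto)
    also have "(\<lambda>x. g (0 + (1 / s n) * x)) = \<phi> n" by (simp add: g_def \<phi>_def fun_eq_iff)
    finally have e: "complex_of_real (exp_coeff (\<lambda>k. if k < b n then w n k else 0) (N n)) =
       1 / (2 * pi) * (of_real (exp ?W) * (\<bar>1 / s n\<bar> *\<^sub>R (LINT x|lborel. \<phi> n x)))" .
    have "complex_of_real (exp (- ?W)) * of_real (exp ?W) = 1"
      by (simp flip: of_real_mult exp_add)
    thus ?thesis unfolding of_real_mult e using sn
      by (simp add: scaleR_conv_of_real field_simps)
  qed
  have ev: "\<forall>\<^sub>F n in sequentially.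
      of_real (s n * exp (- (\<Sum>k=1..<b n. w n k)) * exp_coeff (\<lambda>k. if k < b n then w n k else 0) (N n))
     = (LINT x|lborel. \<phi> n x) / (2 * pi)"
    by (rule eventually_sequentiallyI[of n0]) (rule eq)
  have "(\<lambda>n. (LINT x|lborel. \<phi> n x) / of_real (2 * pi)) \<longlonglongrightarrow>
      of_real (LINT x|lborel. exp (- (x\<^sup>2) / 2)) / of_real (2 * pi)"
    by (intro tendsto_intros lim) auto
  hence "(\<lambda>n. complex_of_real (s n * exp (- (\<Sum>k=1..<b n. w n k)) * exp_coeff (\<lambda>k. if k < b n then w n k else 0) (N n)))
     \<longlonglongrightarrow> of_real (LINT x|lborel. exp (- (x\<^sup>2) / 2)) / of_real (2 * pi)"
    by (subst tendsto_cong[OF ev])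
  hence "(\<lambda>n. complex_of_real (s n * exp (- (\<Sum>k=1..<b n. w n k)) * exp_coeff (\<lambda>k. if k < b n then w n k else 0) (N n)))
     \<longlonglongrightarrow> of_real ((LINT x|lborel. exp (- (x\<^sup>2) / 2)) / (2 * pi))"
    unfolding of_real_divide .
  thus ?thesis by (simp only: tendsto_of_real_iff)
qed

section \<open>Polynomially growing weights\<close>

text \<open>For v \<le> 1, exp(-v) \<le> 1/(1+v) \<le> 1 - v/2, so the denominator of the geometric
  series is at least v/2.\<close>

lemma geometric_exp_bound:
  fixes v :: real
  assumes "0 < v" "v \<le> 1"
  shows "summable (\<lambda>k. exp (- v) ^ (k + b))" "(\<Sum>k. exp (- v) ^ (k + b)) \<le> 2 / v * exp (- (real b * v))"
proof -
  have lt: "exp (- v) < 1" using assms by simp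
  have "exp (- v) \<le> 1 / (1 + v)"
    using exp_ge_add_one_self[of v] assms by (simp add: exp_minus field_simps)
  moreover have "1 / (1 + v) \<le> 1 - v / 2"
  proof -
    have "v * v \<le> v * 1" using assms by (intro mult_left_mono) auto
    thus ?thesis using assms by (simp add: field_simps)
  qed
  ultimately have ge: "1 - exp (- v) \<ge> v / 2" by linarith
  have s: "(\<lambda>k. exp (- v) ^ (k + b)) sums (1 / (1 - exp (- v)) * exp (- v) ^ b)"
    unfolding power_add using geometric_sums[of "exp (- v)"] lt by (intro sums_mult2) auto
  thus "summable (\<lambda>k. exp (- v) ^ (k + b))" by (rule sums_summable)
  have "1 / (1 - exp (- v)) \<le> 2 / v" using ge assms lt by (simp add: field_simps)
  hence "1 / (1 - exp (- v)) * exp (- v) ^ b \<le> 2 / v * exp (- v) ^ b" by (intro mult_right_mono) auto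
  moreover have "exp (- v) ^ b = exp (- (real b * v))" by (simp add: exp_of_nat_mult[symmetric])
  ultimately show "(\<Sum>k. exp (- v) ^ (k + b)) \<le> 2 / v * exp (- (real b * v))"
    using sums_unique[OF s] by simp
qed

text \<open>The maximum is at x = 4 \<beta>, and ln y \<le> y for y = x / (4 \<beta>) bounds it up
  to a factor exp(\<beta>). A quarter of the exponential decay thus absorbs any power.\<close>

lemma powr_exp_le: "x \<ge> 0 \<Longrightarrow> \<beta> > 0 \<Longrightarrow> x powr \<beta> * exp (- (x / 4)) \<le> (4 * \<beta>) powr \<beta>" for x \<beta> :: real
proof (cases "x = 0")
  case False
  assume "x \<ge> 0" and \<beta>: "\<beta> > 0"
  with False have x: "x > 0" by simp
  have "ln (x / (4 * \<beta>)) \<le> x / (4 * \<beta>)" using x \<beta> by (intro ln_le_minus_one[THEN order_trans]) auto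
  hence "\<beta> * (ln x - ln (4 * \<beta>)) \<le> \<beta> * (x / (4 * \<beta>))" using x \<beta> by (intro mult_left_mono) (auto simp: ln_div)
  hence "\<beta> * ln x - x / 4 \<le> \<beta> * ln (4 * \<beta>)" using \<beta> by (simp add: algebra_simps)
  hence "exp (\<beta> * ln x + - (x / 4)) \<le> exp (\<beta> * ln (4 * \<beta>))" by simp
  thus ?thesis using x \<beta> unfolding exp_add by (simp add: powr_def)
qed simp

lemma powr_one_plus_bounds:
  fixes y a :: real
  assumes "y \<ge> 0"
  shows "exp (- (\<bar>a\<bar> * y)) \<le> (1 + y) powr a" "(1 + y) powr a \<le> exp (\<bar>a\<bar> * y)"
proof -
  have ln: "0 \<le> ln (1 + y)" "ln (1 + y) \<le> y" using assms by (auto intro: ln_add_one_self_le_self)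
  have "\<bar>a * ln (1 + y)\<bar> \<le> \<bar>a\<bar> * y" using ln by (simp add: abs_mult mult_left_mono)
  thus "exp (- (\<bar>a\<bar> * y)) \<le> (1 + y) powr a" "(1 + y) powr a \<le> exp (\<bar>a\<bar> * y)"
    using assms by (auto simp: powr_def)
qed

text \<open>For |x| \<le> 2 the Taylor bound gives at least x^2/2 - x^4/24 \<ge> x^2/3. Beyond, |x|
  exceeds pi/2, so the cosine is not positive, while x^2 \<le> 16 because pi < 4.\<close>

lemma one_minus_cos_ge:
  fixes x :: real
  assumes "\<bar>x\<bar> \<le> pi"
  shows "x\<^sup>2 / 16 \<le> 1 - cos x"
proof (cases "\<bar>x\<bar> \<le> 2")
  case True
  have "\<bar>Re (iexp x - (\<Sum>k \<le> 3. (\<i> * x)^k / fact k))\<bar> \<le> \<bar>x\<bar> ^ 4 / 24"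
    using order_trans[OF abs_Re_le_cmod iexp_approx1[of x 3]] by (simp add: fact_numeral eval_nat_numeral)
  moreover have "Re (iexp x - (\<Sum>k \<le> 3. (\<i> * x)^k / fact k)) = cos x - 1 + x\<^sup>2 / 2"
    by (simp add: eval_nat_numeral Re_exp)
  ultimately have "\<bar>cos x - 1 + x\<^sup>2 / 2\<bar> \<le> \<bar>x\<bar> ^ 4 / 24" by simp
  moreover have "\<bar>x\<bar> ^ 4 \<le> 4 * x\<^sup>2"
  proof -
    have "\<bar>x\<bar>\<^sup>2 \<le> 2\<^sup>2" using True by (intro power_mono) auto
    hence "x\<^sup>2 * x\<^sup>2 \<le> 4 * x\<^sup>2" by (intro mult_right_mono) auto
    thus ?thesis by (simp add: power4_eq_xxxx power2_eq_square abs_mult)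
  qed
  moreover have "x\<^sup>2 \<ge> 0" by simp
  ultimately show ?thesis by linarith
next
  case False
  have "cos \<bar>x\<bar> \<le> cos (pi / 2)"
    using False assms pi_less_4 by (intro cos_monotone_0_pi_le) auto
  moreover have "\<bar>x\<bar>\<^sup>2 \<le> 4\<^sup>2" using assms pi_less_4 by (intro power_mono) auto
  ultimately show ?thesis by simp
qed

text \<open>A geometric sum of powers of cis t: the numerator is at most 2, and |cis t - 1|^2 = 2 (1
  - cos t) \<ge> t^2/8 \<ge> (|t|/3)^2. The bound does not grow with M.\<close>

lemma sum_cos_le:
  fixes t :: real
  assumes "t \<noteq> 0" "\<bar>t\<bar> \<le> pi"
  shows "(\<Sum>k=a..<a+M. cos (real k * t)) \<le> 6 / \<bar>t\<bar>"
proof -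
  have "(norm (cis t - 1))\<^sup>2 = (cos t - 1)\<^sup>2 + (sin t)\<^sup>2" by (simp add: cmod_power2)
  also have "\<dots> = 2 * (1 - cos t)" using sin_cos_squared_add[of t] by (simp add: power2_eq_square algebra_simps)
  finally have "(\<bar>t\<bar> / 3)\<^sup>2 \<le> (norm (cis t - 1))\<^sup>2"
    using one_minus_cos_ge[OF assms(2)] by (simp add: power_divide) (smt (verit) zero_le_power2)
  hence ge: "\<bar>t\<bar> / 3 \<le> norm (cis t - 1)" by (rule power2_le_imp_le) auto
  hence ne: "cis t \<noteq> 1" using assms(1) by auto
  have "(\<Sum>k=a..<a+M. cos (real k * t)) = Re (\<Sum>k=a..<a+M. cis t ^ k)"
    by (simp add: Re_sum Complex.DeMoivre)
  also have "(\<Sum>k=a..<a+M. cis t ^ k) = cis t ^ a * (\<Sum>j<M. cis t ^ j)"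
    using sum.shift_bounds_nat_ivl[of "\<lambda>k. cis t ^ k" 0 a M]
    by (simp add: add.commute lessThan_atLeast0 power_add sum_distrib_left mult.commute)
  also have "(\<Sum>j<M. cis t ^ j) = (cis t ^ M - 1) / (cis t - 1)" by (rule geometric_sum[OF ne])
  also have "Re (cis t ^ a * ((cis t ^ M - 1) / (cis t - 1))) \<le> norm (cis t ^ a * ((cis t ^ M - 1) / (cis t - 1)))"
    by (rule complex_Re_le_cmod)
  also have "\<dots> = norm (cis t ^ M - 1) / norm (cis t - 1)" by (simp add: norm_mult norm_divide norm_power)
  also have "\<dots> \<le> 2 / (\<bar>t\<bar> / 3)"
    using norm_triangle_ineq4[of "cis t ^ M" 1] ge assms(1) by (intro frac_le) (auto simp: norm_power)
  finally show ?thesis by simp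
qed

lemma small_positive: "\<forall>\<^sub>F v in at_right (0::real). 0 < v \<and> v \<le> 1"
proof -
  have "\<forall>\<^sub>F v in at_right (0::real). v > 0" "\<forall>\<^sub>F v in at_right (0::real). v \<le> 1" by real_asymp+
  thus ?thesis by eventually_elim auto
qed

section \<open>Moments of the tilted weights and domination of the characteristic function\<close>

locale polynomial_weights =
  fixes \<alpha> :: real and \<theta> :: "nat \<Rightarrow> real"
  assumes \<alpha>: "\<alpha> > 0"
    and \<theta>_nonneg: "\<And>k. k \<ge> 1 \<Longrightarrow> \<theta> k \<ge> 0"
    and \<theta>_asymp: "\<theta> \<sim>[sequentially] (\<lambda>k. real k powr \<alpha>)"
begin

lemma \<theta>_ratio: "(\<lambda>k. \<theta> k / real k powr \<alpha>) \<longlonglongrightarrow> 1"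
proof -
  have "(\<lambda>k. if \<theta> k = 0 \<and> real k powr \<alpha> = 0 then 1 else \<theta> k / real k powr \<alpha>) \<longlonglongrightarrow> 1"
    using \<theta>_asymp by (simp add: asymp_equiv_def)
  moreover have "\<forall>\<^sub>F k in sequentially. (if \<theta> k = 0 \<and> real k powr \<alpha> = 0 then 1 else \<theta> k / real k powr \<alpha>)
      = \<theta> k / real k powr \<alpha>"
    by (rule eventually_sequentiallyI[of 1]) auto
  ultimately show ?thesis using tendsto_cong by fast
qed

lemma \<theta>_upper: obtains C where "C > 0" "\<And>k. k \<ge> 1 \<Longrightarrow> \<theta> k \<le> C * real k powr \<alpha>"
proof -
  have "Bseq (\<lambda>k. \<theta> k / real k powr \<alpha>)"
    using \<theta>_ratio by (intro convergent_imp_Bseq convergentI)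
  then obtain C where C: "C > 0" "\<And>k. norm (\<theta> k / real k powr \<alpha>) \<le> C"
    unfolding Bseq_def by blast
  show ?thesis
  proof (rule that[OF C(1)])
    fix k :: nat assume "k \<ge> 1"
    thus "\<theta> k \<le> C * real k powr \<alpha>" using C(2)[of k] by (simp add: field_simps abs_le_iff)
  qed
qed

lemma \<theta>_lower: obtains k0 where "\<And>k. k \<ge> k0 \<Longrightarrow> k \<ge> 1 \<Longrightarrow> real k powr \<alpha> / 2 \<le> \<theta> k"
proof -
  have "\<forall>\<^sub>F k in sequentially. \<theta> k / real k powr \<alpha> > 1/2"
    using order_tendstoD(1)[OF \<theta>_ratio, of "1/2"] by simp
  then obtain k0 where k0: "\<And>k. k \<ge> k0 \<Longrightarrow> \<theta> k / real k powr \<alpha> > 1/2"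
    unfolding eventually_sequentially by auto
  show ?thesis
    by (rule that[of k0]) (use k0 in \<open>force simp: field_simps\<close>)
qed

text \<open>The factor exp(-kv) is split: one quarter absorbs (kv)^(\<alpha>+p), three quarters are
  left for the geometric series. A share above one half is what the truncation of the mean requires
  later: at kv near \<alpha> log(1/v), the share 3/4 leaves v^(\<alpha>/4), up to logarithms, after
  division by the standard deviation.\<close>

lemma tail_bound:
  obtains D where "D > 0"
    "\<And>v b. 0 < v \<Longrightarrow> v \<le> 1 \<Longrightarrow> b \<ge> 1 \<Longrightarrow> summable (\<lambda>k. real (k + b) ^ p * \<theta> (k + b) * exp (- v) ^ (k + b))"
    "\<And>v b. 0 < v \<Longrightarrow> v \<le> 1 \<Longrightarrow> b \<ge> 1 \<Longrightarrow>
        (\<Sum>k. real (k + b) ^ p * \<theta> (k + b) * exp (- v) ^ (k + b)) \<le> D * v powr (- \<alpha> - real p - 1) * exp (- (3/4 * real b * v))"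
proof -
  obtain C where C: "C > 0" "\<And>k. k \<ge> 1 \<Longrightarrow> \<theta> k \<le> C * real k powr \<alpha>" using \<theta>_upper by blast
  define \<beta> where "\<beta> = \<alpha> + real p"
  have \<beta>: "\<beta> > 0" using \<alpha> by (simp add: \<beta>_def)
  define D where "D = C * (4 * \<beta>) powr \<beta>"
  have D: "D > 0" using C \<beta> by (simp add: D_def)
  have bnd: "real k ^ p * \<theta> k * exp (- v) ^ k \<le> D * v powr (- \<beta>) * exp (- (3/4 * v)) ^ k"
    if v: "0 < v" "v \<le> 1" and k: "k \<ge> 1" for v k
  proof -
    have "real k ^ p * \<theta> k \<le> real k ^ p * (C * real k powr \<alpha>)" using C(2)[OF k] by (intro mult_left_mono) auto
    also have "\<dots> = C * real k powr \<beta>" using k by (simp add: \<beta>_def powr_add powr_realpow)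
    also have "real k powr \<beta> = v powr (- \<beta>) * (real k * v) powr \<beta>"
      using v k by (simp add: powr_mult powr_minus field_simps)
    finally have "real k ^ p * \<theta> k * exp (- v) ^ k \<le> C * (v powr (- \<beta>) * (real k * v) powr \<beta>) * exp (- v) ^ k"
      by (intro mult_right_mono) auto
    also have "\<dots> = C * v powr (- \<beta>) * exp (- (3/4 * v)) ^ k * ((real k * v) powr \<beta> * exp (- ((real k * v) / 4)))"
    proof -
      have "exp (- v) ^ k = exp (- ((real k * v) / 4)) * exp (- (3/4 * v)) ^ k"
        by (simp add: exp_of_nat_mult[symmetric] field_simps flip: exp_add)
      thus ?thesis by (simp only: mult_ac)
    qed
    also have "\<dots> \<le> C * v powr (- \<beta>) * exp (- (3/4 * v)) ^ k * (4 * \<beta>) powr \<beta>"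
      using v C \<beta> by (intro mult_left_mono powr_exp_le) auto
    finally show ?thesis unfolding D_def by (simp only: mult_ac)
  qed
  show ?thesis
  \<comment> \<open>The geometric series of rate 3v/4 contributes 8/(3v), rounded up to 4/v.\<close>
  proof (rule that[of "4 * D"])
    show "4 * D > 0" using D by simp
    fix v :: real and b :: nat assume v: "0 < v" "v \<le> 1" and b: "b \<ge> 1"
    note g = geometric_exp_bound[of "3/4 * v" b]
    have s: "summable (\<lambda>k. D * v powr (- \<beta>) * exp (- (3/4 * v)) ^ (k + b))"
      using v by (intro summable_mult g(1)) auto
    show s': "summable (\<lambda>k. real (k + b) ^ p * \<theta> (k + b) * exp (- v) ^ (k + b))"
    proof (rule summable_comparison_test'[OF s])
      fix k
      show "norm (real (k + b) ^ p * \<theta> (k + b) * exp (- v) ^ (k + b)) \<le> D * v powr (- \<beta>) * exp (- (3/4 * v)) ^ (k + b)"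
        using bnd[OF v, of "k + b"] \<theta>_nonneg[of "k + b"] b by (simp add: abs_mult)
    qed
    have "(\<Sum>k. real (k + b) ^ p * \<theta> (k + b) * exp (- v) ^ (k + b)) \<le> (\<Sum>k. D * v powr (- \<beta>) * exp (- (3/4 * v)) ^ (k + b))"
      using b by (intro suminf_le s s' bnd v) auto
    also have "\<dots> = D * v powr (- \<beta>) * (\<Sum>k. exp (- (3/4 * v)) ^ (k + b))"
      using v by (intro suminf_mult g(1)) auto
    also have "\<dots> \<le> D * v powr (- \<beta>) * (2 / (3/4 * v) * exp (- (real b * (3/4 * v))))"
      using v D by (intro mult_left_mono g(2)) auto
    also have "\<dots> = 8/3 * (D * (v powr (- \<beta>) * v powr (-1)) * exp (- (3/4 * real b * v)))"
      using v by (simp add: powr_minus field_simps)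
    also have "v powr (- \<beta>) * v powr (-1) = v powr (- \<alpha> - real p - 1)"
      unfolding \<beta>_def powr_add[symmetric] by (rule arg_cong[of _ _ "(powr) v"]) simp
    also have "8/3 * (D * v powr (- \<alpha> - real p - 1) * exp (- (3/4 * real b * v)))
       \<le> 4 * (D * v powr (- \<alpha> - real p - 1) * exp (- (3/4 * real b * v)))"
      using D by (intro mult_right_mono) auto
    finally show "(\<Sum>k. real (k + b) ^ p * \<theta> (k + b) * exp (- v) ^ (k + b)) \<le>
       4 * D * v powr (- \<alpha> - real p - 1) * exp (- (3/4 * real b * v))" by (simp add: mult_ac)
  qed
qed

definition wt :: "real \<Rightarrow> nat \<Rightarrow> real" where
  "wt v k = \<theta> k / real k * exp (- v) ^ k"

text \<open>In terms of \<open>wt\<close> this is the sum of k^(p+1) wt v k. Hence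
  \<open>moment 0\<close> is the mean and \<open>moment 1\<close> the variance of the sum of k C_k
  in the Poisson model.\<close>

definition moment :: "nat \<Rightarrow> real \<Rightarrow> real" where
  "moment p v = (\<Sum>k. real (Suc k) ^ p * \<theta> (Suc k) * exp (- v) ^ Suc k)"

definition scale :: "real \<Rightarrow> real" where
  "scale v = sqrt (moment 1 v)"

lemma moment_summable: "0 < v \<Longrightarrow> v \<le> 1 \<Longrightarrow> b \<ge> 1 \<Longrightarrow> summable (\<lambda>k. real (k + b) ^ p * \<theta> (k + b) * exp (- v) ^ (k + b))"
  by (rule tail_bound[of p]) blast

lemma moment_split:
  assumes "0 < v" "v \<le> 1" "b \<ge> 1"
  shows "moment p v = (\<Sum>k=1..<b. real k ^ p * \<theta> k * exp (- v) ^ k) + (\<Sum>k. real (k + b) ^ p * \<theta> (k + b) * exp (- v) ^ (k + b))"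
proof -
  let ?f = "\<lambda>k. real (k + 1) ^ p * \<theta> (k + 1) * exp (- v) ^ (k + 1)"
  have "moment p v = (\<Sum>k. ?f (k + (b - 1))) + (\<Sum>k<b - 1. ?f k)"
    unfolding moment_def using suminf_split_initial_segment[OF moment_summable[of v 1 p], of "b - 1"] assms by simp
  also have "(\<Sum>k<b - 1. ?f k) = (\<Sum>k=1..<b. real k ^ p * \<theta> k * exp (- v) ^ k)"
    by (rule sum.reindex_bij_witness[of _ "\<lambda>k. k - 1" Suc]) auto
  finally show ?thesis using assms by (simp add: add.commute)
qed

lemma tail_nonneg: "0 < v \<Longrightarrow> v \<le> 1 \<Longrightarrow> b \<ge> 1 \<Longrightarrow> 0 \<le> (\<Sum>k. real (k + b) ^ p * \<theta> (k + b) * exp (- v) ^ (k + b))"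
  by (intro suminf_nonneg moment_summable mult_nonneg_nonneg \<theta>_nonneg) auto

lemma moment_ge_sum:
  assumes "0 < v" "v \<le> 1" "finite A" "0 \<notin> A"
  shows "(\<Sum>k\<in>A. real k ^ p * \<theta> k * exp (- v) ^ k) \<le> moment p v"
proof -
  define b where "b = Suc (Max (insert 0 A))"
  have "A \<subseteq> {1..<b}"
  proof
    fix k assume "k \<in> A"
    moreover have "k \<noteq> 0" using calculation assms(4) by metis
    ultimately show "k \<in> {1..<b}" using assms(3) by (auto simp: b_def less_Suc_eq_le Suc_le_eq)
  qed
  hence "(\<Sum>k\<in>A. real k ^ p * \<theta> k * exp (- v) ^ k) \<le> (\<Sum>k=1..<b. real k ^ p * \<theta> k * exp (- v) ^ k)"
    by (intro sum_mono2 mult_nonneg_nonneg \<theta>_nonneg) auto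
  also have "\<dots> \<le> moment p v"
    using moment_split[of v b p] tail_nonneg[of v b p] assms by (simp add: b_def)
  finally show ?thesis .
qed

lemma moment_upper: obtains D where "D > 0" "\<And>v. 0 < v \<Longrightarrow> v \<le> 1 \<Longrightarrow> moment p v \<le> D * v powr (- \<alpha> - real p - 1)"
proof -
  obtain D where D: "D > 0" "\<And>v b. 0 < v \<Longrightarrow> v \<le> 1 \<Longrightarrow> b \<ge> 1 \<Longrightarrow>
        (\<Sum>k. real (k + b) ^ p * \<theta> (k + b) * exp (- v) ^ (k + b)) \<le> D * v powr (- \<alpha> - real p - 1) * exp (- (3/4 * real b * v))"
    by (rule tail_bound[of p]) blast
  show ?thesis
  proof (rule that[OF D(1)])
    fix v :: real assume v: "0 < v" "v \<le> 1"
    have "moment p v \<le> D * v powr (- \<alpha> - real p - 1) * exp (- (3/4 * real 1 * v))"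
      using D(2)[OF v, of 1] by (simp add: moment_def)
    also have "\<dots> \<le> D * v powr (- \<alpha> - real p - 1) * 1" using v D by (intro mult_left_mono) auto
    finally show "moment p v \<le> D * v powr (- \<alpha> - real p - 1)" by simp
  qed
qed

text \<open>With \<open>m = \<lceil>1/v\<rceil>\<close>, the block \<open>[m, 2m)\<close> makes the characteristic function small for
  \<open>\<bar>t\<bar> \<le> v\<close>, and the block \<open>[8m, 16m)\<close> for \<open>v < \<bar>t\<bar> \<le> \<pi>\<close>.\<close>

lemma block_lower:
  obtains c where "c > 0" "\<forall>\<^sub>F v in at_right 0. \<forall>k. nat \<lceil>1 / v\<rceil> \<le> k \<and> k < 16 * nat \<lceil>1 / v\<rceil> \<longrightarrow>
      c * v powr (- \<alpha>) \<le> \<theta> k * exp (- v) ^ k"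
proof -
  obtain k0 where k0: "\<And>k. k \<ge> k0 \<Longrightarrow> k \<ge> 1 \<Longrightarrow> real k powr \<alpha> / 2 \<le> \<theta> k" using \<theta>_lower by blast
  have "\<forall>\<^sub>F v in at_right (0::real). v < 1/2" "\<forall>\<^sub>F v in at_right (0::real). v > 0"
     "\<forall>\<^sub>F v in at_right (0::real). 1 / v > real k0"
    by real_asymp+
  hence "\<forall>\<^sub>F v in at_right 0. \<forall>k. nat \<lceil>1 / v\<rceil> \<le> k \<and> k < 16 * nat \<lceil>1 / v\<rceil> \<longrightarrow>
      exp (- 24) / 2 * v powr (- \<alpha>) \<le> \<theta> k * exp (- v) ^ k"
  proof eventually_elim
    case (elim v)
    show ?case
    proof (intro allI impI)
      fix k assume k: "nat \<lceil>1 / v\<rceil> \<le> k \<and> k < 16 * nat \<lceil>1 / v\<rceil>"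
      hence 1: "1 / v \<le> real k" by linarith
      have "real (nat \<lceil>1 / v\<rceil>) \<le> 1 / v + 1" using elim by (simp add: of_nat_nat)
      moreover have "real k < real (16 * nat \<lceil>1 / v\<rceil>)" using k by (simp only: of_nat_less_iff)
      ultimately have "real k \<le> 16 * (1 / v + 1)" by simp
      also have "\<dots> \<le> 24 / v" using elim by (simp add: field_simps)
      \<comment> \<open>From k < 16 (1/v + 1) and v < 1/2; hence the constant exp(-24) in the
        witness.\<close>
      finally have 2: "real k * v \<le> 24" using elim by (simp add: field_simps)
      have "k \<ge> k0" using 1 elim by linarith
      moreover have "k \<ge> 1" using 1 elim by (cases k) (auto simp: field_simps)
      ultimately have "real k powr \<alpha> / 2 \<le> \<theta> k" using k0 by blast
      moreover have "(1 / v) powr \<alpha> \<le> real k powr \<alpha>" using 1 elim \<alpha> by (intro powr_mono2) auto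
      moreover have "(1 / v) powr \<alpha> = v powr (- \<alpha>)"
        using elim by (simp add: powr_minus powr_divide field_simps)
      ultimately have "v powr (- \<alpha>) / 2 \<le> \<theta> k" by linarith
      moreover have "exp (- v) ^ k \<ge> exp (- 24)" using 2 by (simp add: exp_of_nat_mult[symmetric])
      ultimately have "v powr (- \<alpha>) / 2 * exp (- 24) \<le> \<theta> k * exp (- v) ^ k"
        using \<theta>_nonneg[OF \<open>k \<ge> 1\<close>] by (intro mult_mono) auto
      thus "exp (- 24) / 2 * v powr (- \<alpha>) \<le> \<theta> k * exp (- v) ^ k" by (simp add: mult_ac)
    qed
  qed
  thus ?thesis by (intro that[of "exp (- 24) / 2"]) auto
qed

text \<open>The block [m, 2m) with m \<ge> 1/v alone gives this order: each of its m terms is at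
  least c v^(-\<alpha>) v^(-p).\<close>

lemma moment_lower: 
  obtains c where "c > 0" "\<forall>\<^sub>F v in at_right 0. c * v powr (- \<alpha> - real p - 1) \<le> moment p v"
proof -
  obtain c where c: "c > 0" "\<forall>\<^sub>F v in at_right 0. \<forall>k. nat \<lceil>1 / v\<rceil> \<le> k \<and> k < 16 * nat \<lceil>1 / v\<rceil> \<longrightarrow>
      c * v powr (- \<alpha>) \<le> \<theta> k * exp (- v) ^ k" using block_lower by blast
  have "\<forall>\<^sub>F v in at_right (0::real). v < 1/2" "\<forall>\<^sub>F v in at_right (0::real). v > 0" by real_asymp+
  with c(2) have "\<forall>\<^sub>F v in at_right 0. c * v powr (- \<alpha> - real p - 1) \<le> moment p v"
  proof eventually_elim
    case (elim v)
    define m where "m = nat \<lceil>1 / v\<rceil>"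
    have m: "1 / v \<le> real m" unfolding m_def by linarith
    hence m0: "m > 0" using elim by (cases m) (auto simp: field_simps)
    have "c * v powr (- \<alpha> - real p - 1) = (1 / v) * ((1 / v) ^ p * (c * v powr (- \<alpha>)))"
      using elim by (simp add: powr_diff powr_add powr_realpow power_divide field_simps)
    also have "\<dots> \<le> real m * ((1 / v) ^ p * (c * v powr (- \<alpha>)))"
      using elim c m by (intro mult_right_mono) auto
    also have "\<dots> = (\<Sum>k\<in>{m..<2*m}. (1 / v) ^ p * (c * v powr (- \<alpha>)))" by simp
    also have "\<dots> \<le> (\<Sum>k\<in>{m..<2*m}. real k ^ p * (\<theta> k * exp (- v) ^ k))"
    proof (rule sum_mono)
      fix k assume k: "k \<in> {m..<2*m}"
      have "1 / v \<le> real k" using m k by auto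
      hence "(1 / v) ^ p \<le> real k ^ p" using elim by (intro power_mono) auto
      moreover have "c * v powr (- \<alpha>) \<le> \<theta> k * exp (- v) ^ k" using elim k by (auto simp: m_def)
      ultimately show "(1 / v) ^ p * (c * v powr (- \<alpha>)) \<le> real k ^ p * (\<theta> k * exp (- v) ^ k)"
        using c by (intro mult_mono[where b = "real k ^ p" and d = "\<theta> k * exp (- v) ^ k"]) auto
    qed
    also have "\<dots> \<le> moment p v"
      using moment_ge_sum[of v "{m..<2*m}" p] elim m0 by (simp add: mult_ac)
    finally show ?case .
  qed
  thus ?thesis using c that by blast
qed

lemma wt_nonneg: "k \<ge> 1 \<Longrightarrow> wt v k \<ge> 0"
  unfolding wt_def using \<theta>_nonneg by auto

lemma power_mult_wt: "k \<ge> 1 \<Longrightarrow> real k ^ Suc p * wt v k = real k ^ p * \<theta> k * exp (- v) ^ k"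
  by (simp add: wt_def)

text \<open>Near zero the quadratic bound on 1 - cos gives a Gaussian-type estimate in scale v * t.
  Away from zero the cosines cancel and leave exp(-const v^(-\<alpha>)), which is smaller than every
  power of v and hence than 1 / (1 + (scale v * t)^2).\<close>

lemma char_fun_domination:
  obtains C where "\<forall>\<^sub>F v in at_right 0. \<forall>b t. 16 * nat \<lceil>1 / v\<rceil> \<le> b \<longrightarrow> \<bar>t\<bar> \<le> pi \<longrightarrow>
     exp (- (\<Sum>k=1..<b. wt v k * (1 - cos (real k * t)))) \<le> C / (1 + (scale v * t)\<^sup>2)"
proof -
  obtain c where c: "c > 0" "\<forall>\<^sub>F v in at_right 0. \<forall>k. nat \<lceil>1 / v\<rceil> \<le> k \<and> k < 16 * nat \<lceil>1 / v\<rceil> \<longrightarrow>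
      c * v powr (- \<alpha>) \<le> \<theta> k * exp (- v) ^ k" using block_lower by blast
  obtain D where D: "D > 0" "\<And>v. 0 < v \<Longrightarrow> v \<le> 1 \<Longrightarrow> moment 1 v \<le> D * v powr (- \<alpha> - real 1 - 1)"
    by (rule moment_upper[of 1]) blast
  \<comment> \<open>Chosen so that S \<ge> c1 (scale v * t)^2 for |t| \<le> v: 1/16 comes from the
    bound on the cosine, c/D from comparing the block with the full variance.\<close>
  define c1 where "c1 = c / (16 * D)"
  have c1: "c1 > 0" using c D by (simp add: c1_def)
  have "\<forall>\<^sub>F v in at_right (0::real). v < 1/2" "\<forall>\<^sub>F v in at_right (0::real). v > 0" by real_asymp+
  moreover have "\<forall>\<^sub>F v in at_right (0::real). 1 + pi\<^sup>2 * (D * v powr (- \<alpha> - 2)) \<le> exp (c / 12 * v powr (- \<alpha>))"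
    using c D \<alpha> by real_asymp
  ultimately have "\<forall>\<^sub>F v in at_right 0. \<forall>b t. 16 * nat \<lceil>1 / v\<rceil> \<le> b \<longrightarrow> \<bar>t\<bar> \<le> pi \<longrightarrow>
     exp (- (\<Sum>k=1..<b. wt v k * (1 - cos (real k * t)))) \<le> (1 + 1 / c1) / (1 + (scale v * t)\<^sup>2)"
    using c(2)
  proof eventually_elim
    case (elim v)
    define m where "m = nat \<lceil>1 / v\<rceil>"
    have m: "1 / v \<le> real m" unfolding m_def by linarith
    hence m0: "m > 0" using elim by (cases m) (auto simp: field_simps)
    have "real m \<le> 1 / v + 1" unfolding m_def using elim by (simp add: of_nat_nat)
    also have "\<dots> \<le> (3/2) / v" using elim by (simp add: field_simps)
    finally have m': "real m * v \<le> 3/2" using elim by (simp add: field_simps)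
    have sc: "(scale v)\<^sup>2 = moment 1 v" 
      unfolding scale_def using moment_ge_sum[of v "{}" 1] elim by simp
    have sc_le: "moment 1 v \<le> D * v powr (- \<alpha> - 2)" using D(2)[of v] elim by (simp add: algebra_simps)
    show ?case
    proof (intro allI impI)
      fix b :: nat and t :: real assume b: "16 * nat \<lceil>1 / v\<rceil> \<le> b" and t: "\<bar>t\<bar> \<le> pi"
      define S where "S = (\<Sum>k=1..<b. wt v k * (1 - cos (real k * t)))"
      have S_ge: "(\<Sum>k\<in>A. wt v k * (1 - cos (real k * t))) \<le> S" if "A \<subseteq> {m..<16*m}" for A
      proof -
        have "{m..<16*m} \<subseteq> {1..<b}" using m0 b[folded m_def] by auto
        with that have "A \<subseteq> {1..<b}" by blast
        thus ?thesis unfolding S_def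
          by (intro sum_mono2 mult_nonneg_nonneg wt_nonneg) auto
      qed
      show "exp (- S) \<le> (1 + 1 / c1) / (1 + (scale v * t)\<^sup>2)"
      proof (cases "\<bar>t\<bar> \<le> v")
        case True
        have "c1 * (scale v * t)\<^sup>2 \<le> c1 * (D * v powr (- \<alpha> - 2)) * t\<^sup>2"
          unfolding power_mult_distrib sc mult.assoc[symmetric]
          using sc_le c1 by (intro mult_right_mono) (auto simp: mult.assoc)
        also have "\<dots> = (1 / v) * ((1 / v) * (c * v powr (- \<alpha>)) * (t\<^sup>2 / 16))"
          using D elim by (simp add: c1_def powr_diff power2_eq_square field_simps)
        also have "\<dots> \<le> real m * ((1 / v) * (c * v powr (- \<alpha>)) * (t\<^sup>2 / 16))"
          using m c elim by (intro mult_right_mono) auto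
        also have "\<dots> = (\<Sum>k\<in>{m..<2*m}. (1 / v) * (c * v powr (- \<alpha>)) * (t\<^sup>2 / 16))" by simp
        also have "\<dots> \<le> (\<Sum>k\<in>{m..<2*m}. wt v k * (1 - cos (real k * t)))"
        proof (rule sum_mono)
          fix k assume k: "k \<in> {m..<2*m}"
          have k1: "k \<ge> 1" using k m0 by auto
          have "1 / v \<le> real k" using m k by auto
          moreover have "c * v powr (- \<alpha>) \<le> \<theta> k * exp (- v) ^ k" using elim k by (auto simp: m_def)
          ultimately have "(1 / v) * (c * v powr (- \<alpha>)) \<le> real k * (\<theta> k * exp (- v) ^ k)"
            using c by (intro mult_mono[where b = "real k" and d = "\<theta> k * exp (- v) ^ k"]) auto
          also have "\<dots> = wt v k * (real k)\<^sup>2" using k1 by (simp add: wt_def power2_eq_square)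
          finally have "(1 / v) * (c * v powr (- \<alpha>)) * (t\<^sup>2 / 16) \<le> wt v k * (real k)\<^sup>2 * (t\<^sup>2 / 16)"
            by (intro mult_right_mono) auto
          also have "\<dots> = wt v k * ((real k * t)\<^sup>2 / 16)" by (simp add: power_mult_distrib)
          also have "\<dots> \<le> wt v k * (1 - cos (real k * t))"
          \<comment> \<open>On this block |k t| \<le> 2 m v \<le> 3 < pi, within the range of the
            quadratic bound.\<close>
          proof (intro mult_left_mono wt_nonneg k1 one_minus_cos_ge)
            have "real k * \<bar>t\<bar> \<le> (2 * real m) * v" using k True by (intro mult_mono) auto
            also have "\<dots> \<le> pi" using m' pi_gt3 by simp
            finally show "\<bar>real k * t\<bar> \<le> pi" by (simp add: abs_mult)
          qed
          finally show "(1 / v) * (c * v powr (- \<alpha>)) * (t\<^sup>2 / 16) \<le> wt v k * (1 - cos (real k * t))" .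
        qed
        also have "\<dots> \<le> S" using m0 by (intro S_ge) auto
        finally have S: "c1 * (scale v * t)\<^sup>2 \<le> S" .
        define y where "y = (scale v * t)\<^sup>2"
        have y: "y \<ge> 0" "c1 * y \<le> S" using S by (auto simp: y_def)
        have "exp (- S) \<le> exp (- (c1 * y))" using y by simp
        also have "\<dots> \<le> 1 / (1 + c1 * y)"
          using exp_ge_add_one_self[of "c1 * y"] y c1 by (simp add: exp_minus field_simps add_pos_nonneg)
        \<comment> \<open>Expanding, 1 + y \<le> (1 + 1/c1) (1 + c1 y), whatever the size of
          c1.\<close>
        also have "\<dots> \<le> (1 + 1 / c1) / (1 + y)"
        proof -
          have "0 \<le> c1 * y" using y c1 by simp
          thus ?thesis using y c1 by (simp add: divide_simps add_pos_nonneg) (simp add: algebra_simps add_nonneg_nonneg)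
        qed
        finally show ?thesis by (simp add: y_def)
      next
        case False
        have "(\<Sum>k=8*m..<8*m+8*m. cos (real k * t)) \<le> 6 / \<bar>t\<bar>"
          using False t elim by (intro sum_cos_le) auto
        also have "\<dots> \<le> 6 / v" using False elim by (intro divide_left_mono) auto
        finally have cs: "(\<Sum>k\<in>{8*m..<16*m}. cos (real k * t)) \<le> 6 / v" by simp
        \<comment> \<open>The block has 8m \<ge> 8/v terms and the cosines take away at most 6/v, so
          at least 2/v remains; each weight is at least c v^(-\<alpha>) v/24 because kv \<le>
          24.\<close>
        have "c / 12 * v powr (- \<alpha>) = c * v powr (- \<alpha>) * (v / 24) * (8 * (1 / v) - 6 / v)"
          using elim by (simp add: field_simps)
        also have "\<dots> \<le> c * v powr (- \<alpha>) * (v / 24) * (\<Sum>k\<in>{8*m..<16*m}. 1 - cos (real k * t))"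
          using m cs c elim by (intro mult_left_mono) (auto simp: sum_subtractf)
        also have "\<dots> \<le> (\<Sum>k\<in>{8*m..<16*m}. wt v k * (1 - cos (real k * t)))"
          unfolding sum_distrib_left
        proof (intro sum_mono mult_right_mono)
          fix k assume k: "k \<in> {8*m..<16*m}"
          have k1: "k \<ge> 1" using k m0 by auto
          have "real k \<le> 16 * real m" using k by auto
          hence "real k * v \<le> 16 * real m * v" using elim by (intro mult_right_mono) auto
          hence "real k * v \<le> 24" using m' by simp
          hence "v / 24 \<le> 1 / real k" using k1 by (simp add: field_simps)
          moreover have "c * v powr (- \<alpha>) \<le> \<theta> k * exp (- v) ^ k" using elim k m0 unfolding m_def[symmetric] by auto
          ultimately have "c * v powr (- \<alpha>) * (v / 24) \<le> \<theta> k * exp (- v) ^ k * (1 / real k)"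
            using c elim \<theta>_nonneg[OF k1] by (intro mult_mono[where b = "\<theta> k * exp (- v) ^ k" and d = "1 / real k"]) auto
          thus "c * v powr (- \<alpha>) * (v / 24) \<le> wt v k" by (simp add: wt_def)
        qed auto
        also have "\<dots> \<le> S" by (intro S_ge) auto
        finally have S: "c / 12 * v powr (- \<alpha>) \<le> S" .
        have "t\<^sup>2 \<le> pi\<^sup>2" using t power_mono[of "\<bar>t\<bar>" pi 2] by simp
        hence "(scale v * t)\<^sup>2 \<le> D * v powr (- \<alpha> - 2) * pi\<^sup>2"
          unfolding power_mult_distrib sc using sc_le D by (intro mult_mono) auto
        hence "1 + (scale v * t)\<^sup>2 \<le> exp (c / 12 * v powr (- \<alpha>))" using elim by (simp add: mult.commute)
        also have "\<dots> \<le> exp S" using S by simp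
        finally have "exp (- S) \<le> 1 / (1 + (scale v * t)\<^sup>2)"
          by (simp add: exp_minus field_simps add_pos_nonneg)
        also have "\<dots> \<le> (1 + 1 / c1) / (1 + (scale v * t)\<^sup>2)"
          using c1 by (intro divide_right_mono) auto
        finally show ?thesis .
      qed
    qed
  qed
  thus ?thesis using that by blast
qed

end

section \<open>Tail sums of the tilted weights\<close>

context polynomial_weights
begin

text \<open>The expected number of cycles of length at least b in the Poisson model.\<close>

definition tail :: "real \<Rightarrow> nat \<Rightarrow> real" where
  "tail v b = (\<Sum>k. wt v (k + b))"

text \<open>The quantity \<open>ell\<close> as a function of v = 1/nstar. The second summand
  compensates the factor k^(\<alpha>-1) of the weights.\<close>

definition level :: "real \<Rightarrow> real" where
  "level v = \<alpha> * ln (inverse v) + (\<alpha> - 1) * ln (\<alpha> * ln (inverse v))"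

lemma level_at_top: "filterlim level at_top (at_right 0)"
  unfolding level_def using \<alpha> by real_asymp

lemma level_over_log: "((\<lambda>v. (level v + x) / (\<alpha> * ln (inverse v))) \<longlongrightarrow> 1) (at_right 0)"
  unfolding level_def using \<alpha> by real_asymp

lemma wt_summable:
  assumes "0 < v" "v \<le> 1" "b \<ge> 1"
  shows "summable (\<lambda>k. wt v (k + b))"
proof (rule summable_comparison_test')
  show "summable (\<lambda>k. real (k + b) ^ 0 * \<theta> (k + b) * exp (- v) ^ (k + b))"
    by (rule moment_summable[OF assms])
  fix k
  have "wt v (k + b) \<le> \<theta> (k + b) * exp (- v) ^ (k + b)"
  proof -
    have "\<theta> (k + b) / real (k + b) \<le> \<theta> (k + b) / 1"
      using \<theta>_nonneg[of "k + b"] assms(3) by (intro divide_left_mono) auto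
    thus ?thesis unfolding wt_def by (intro mult_right_mono) auto
  qed
  thus "norm (wt v (k + b)) \<le> real (k + b) ^ 0 * \<theta> (k + b) * exp (- v) ^ (k + b)"
    using wt_nonneg[of "k + b" v] assms(3) by simp
qed

lemma tail_split:
  assumes "0 < v" "v \<le> 1" "1 \<le> b" "b \<le> b'"
  shows "tail v b = (\<Sum>k=b..<b'. wt v k) + tail v b'"
proof -
  have "tail v b = (\<Sum>k. wt v (k + (b' - b) + b)) + (\<Sum>k<b' - b. wt v (k + b))"
    unfolding tail_def by (rule suminf_split_initial_segment[OF wt_summable[OF assms(1-3)]])
  also have "(\<Sum>k<b' - b. wt v (k + b)) = (\<Sum>k=b..<b'. wt v k)"
    by (rule sum.reindex_bij_witness[of _ "\<lambda>k. k - b" "\<lambda>k. k + b"]) auto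
  finally show ?thesis using assms by (simp add: tail_def add.commute)
qed

lemma tail_sum_nonneg: "0 < v \<Longrightarrow> v \<le> 1 \<Longrightarrow> 1 \<le> b \<Longrightarrow> tail v b \<ge> 0"
  unfolding tail_def by (intro suminf_nonneg wt_summable wt_nonneg) auto

lemma tail_antimono: "0 < v \<Longrightarrow> v \<le> 1 \<Longrightarrow> 1 \<le> b \<Longrightarrow> b \<le> b' \<Longrightarrow> tail v b' \<le> tail v b"
  using tail_split[of v b b'] by (auto intro!: sum_nonneg wt_nonneg)

lemma tail_tendsto_0: "0 < v \<Longrightarrow> v \<le> 1 \<Longrightarrow> tail v \<longlonglongrightarrow> 0"
proof -
  assume v: "0 < v" "v \<le> 1"
  have "(\<lambda>j. \<Sum>k. wt v (k + j + 1)) \<longlonglongrightarrow> 0"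
    using suminf_exist_split2[OF wt_summable[OF v, of 1]] by simp
  hence "(\<lambda>j. tail v (Suc j)) \<longlonglongrightarrow> 0" by (simp add: tail_def)
  thus ?thesis by (rule filterlim_sequentially_Suc[THEN iffD1])
qed

text \<open>The integer length at rescaled position x, that is with kv - level v tending to x;
  rounding changes the position by at most v.\<close>

definition cut :: "real \<Rightarrow> real \<Rightarrow> nat" where
  "cut x v = nat \<lceil>(level v + x) / v\<rceil>"

lemma cut_bounds:
  "\<forall>\<^sub>F v in at_right 0. level v + x \<le> real (cut x v) * v \<and> real (cut x v) * v \<le> level v + x + v"
proof -
  have "\<forall>\<^sub>F v in at_right 0. level v > - x"
    using level_at_top filterlim_at_top_dense by blast
  moreover have "\<forall>\<^sub>F v in at_right (0::real). v > 0" by real_asymp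
  ultimately show ?thesis
  proof eventually_elim
    case (elim v)
    have "(level v + x) / v \<le> real (cut x v)" unfolding cut_def by linarith
    moreover have "real (cut x v) \<le> (level v + x) / v + 1"
      unfolding cut_def using elim by (simp add: of_nat_nat)
    ultimately show ?case using elim by (simp add: field_simps)
  qed
qed

lemma cut_lim: "((\<lambda>v. real (cut x v) * v - level v) \<longlongrightarrow> x) (at_right 0)"
proof (rule tendsto_sandwich)
  show "\<forall>\<^sub>F v in at_right 0. x \<le> real (cut x v) * v - level v"
    using cut_bounds[of x] by eventually_elim auto
  show "\<forall>\<^sub>F v in at_right 0. real (cut x v) * v - level v \<le> x + v"
    using cut_bounds[of x] by eventually_elim auto
  show "((\<lambda>v. x + v) \<longlongrightarrow> x) (at_right 0)" by real_asymp
qed auto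

lemma cut_at_top: "filterlim (\<lambda>v. real (cut x v) * v) at_top (at_right 0)"
proof -
  have "filterlim (\<lambda>v. (real (cut x v) * v - level v) + level v) at_top (at_right 0)"
    by (rule filterlim_tendsto_add_at_top[OF cut_lim level_at_top])
  thus ?thesis by simp
qed

lemma cut_nat_at_top: "filterlim (cut x) at_top (at_right 0)"
proof -
  have "filterlim (\<lambda>v. real (cut x v) * v * inverse v) at_top (at_right 0)"
    by (rule filterlim_at_top_mult_at_top[OF cut_at_top filterlim_inverse_at_top_right])
  moreover have "\<forall>\<^sub>F v in at_right (0::real). v > 0" by real_asymp
  hence "\<forall>\<^sub>F v in at_right 0. real (cut x v) * v * inverse v = real (cut x v)"
    by eventually_elim auto
  ultimately have "filterlim (\<lambda>v. real (cut x v)) at_top (at_right 0)"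
    by (simp add: filterlim_cong)
  thus ?thesis by (simp add: filterlim_sequentially_iff_filterlim_real)
qed

lemma cut_over_log: "((\<lambda>v. real (cut x v) * v / (\<alpha> * ln (inverse v))) \<longlongrightarrow> 1) (at_right 0)"
proof -
  have "((\<lambda>v::real. inverse (\<alpha> * ln (inverse v))) \<longlongrightarrow> 0) (at_right 0)" using \<alpha> by real_asymp
  from tendsto_mult[OF cut_lim this]
  have "((\<lambda>v. (real (cut x v) * v - level v) * inverse (\<alpha> * ln (inverse v)) + (level v + 0) / (\<alpha> * ln (inverse v)))
      \<longlongrightarrow> x * 0 + 1) (at_right 0)"
    by (intro tendsto_add level_over_log)
  thus ?thesis by (simp add: field_simps flip: add_divide_distrib)
qed

text \<open>This computation dictates \<open>level\<close>. At kv = level v + x + o(1), exp(-kv)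
  behaves like v^\<alpha> (\<alpha> log(1/v))^(1-\<alpha>) exp(-x) and k^(\<alpha>-1) like
  v^(1-\<alpha>) (\<alpha> log(1/v))^(\<alpha>-1); the product is v exp(-x).\<close>

lemma cut_weight_lim:
  "((\<lambda>v. real (cut x v) powr (\<alpha> - 1) * exp (- v) ^ cut x v / v) \<longlongrightarrow> exp (- x)) (at_right 0)"
proof -
  have "((\<lambda>v. exp ((\<alpha> - 1) * ln (real (cut x v) * v / (\<alpha> * ln (inverse v))) - (real (cut x v) * v - level v)))
     \<longlongrightarrow> exp ((\<alpha> - 1) * ln 1 - x)) (at_right 0)"
    by (intro tendsto_intros cut_over_log cut_lim) auto
  moreover have "\<forall>\<^sub>F v in at_right 0. exp ((\<alpha> - 1) * ln (real (cut x v) * v / (\<alpha> * ln (inverse v))) - (real (cut x v) * v - level v))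
     = real (cut x v) powr (\<alpha> - 1) * exp (- v) ^ cut x v / v"
  proof -
    have "\<forall>\<^sub>F v in at_right (0::real). v > 0" "\<forall>\<^sub>F v in at_right (0::real). ln (inverse v) > 0" by real_asymp+
    moreover have "\<forall>\<^sub>F v in at_right 0. real (cut x v) * v > 0"
      using cut_at_top[of x] by (simp add: filterlim_at_top_dense)
    ultimately show ?thesis
    proof eventually_elim
      case (elim v)
      define B where "B = real (cut x v)"
      have B: "B > 0" using elim by (simp add: B_def zero_less_mult_iff)
      have E: "(\<alpha> - 1) * ln (B * v / (\<alpha> * ln (inverse v))) - (B * v - level v) = (\<alpha> - 1) * ln B + (- (B * v)) + (- ln v)"
      proof -
        define l where "l = ln (inverse v)"
        have l: "l > 0" "ln v = - l" using elim by (simp_all add: l_def ln_inverse)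
        have lnq: "ln (B * v / (\<alpha> * l)) = ln B + ln v - ln (\<alpha> * l)"
          using elim B \<alpha> l(1) by (subst ln_div) (auto simp: ln_mult)
        show ?thesis unfolding level_def l_def[symmetric] lnq l(2) by (simp add: algebra_simps)
      qed
      have "exp ((\<alpha> - 1) * ln B) = B powr (\<alpha> - 1)" "exp (- ln v) = inverse v"
        using B elim by (simp_all add: powr_def exp_minus)
      moreover have "exp (- (B * v)) = exp (- v) ^ cut x v"
        using exp_of_nat_mult[of "cut x v" "- v"] by (simp add: B_def)
      ultimately show ?case unfolding B_def[symmetric] E exp_add by (simp add: field_simps)
    qed
  qed
  ultimately show ?thesis by (simp add: tendsto_cong)
qed

text \<open>A geometric series whose rate v is perturbed by s/B with B = cut x v. As Bv tends to
  infinity the perturbation is o(v) and does not affect the limit. The perturbed series will enclose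
  the tail sums.\<close>

lemma cut_geometric_lim:
  "((\<lambda>v. real (cut x v) powr (\<alpha> - 1) * exp (- v) ^ cut x v / (1 - exp (- (v - s / real (cut x v))))) \<longlongrightarrow> exp (- x)) (at_right 0)"
  "\<forall>\<^sub>F v in at_right 0. v - s / real (cut x v) > 0"
proof -
  define z where "z v = v - s / real (cut x v)" for v
  have v0: "\<forall>\<^sub>F v in at_right (0::real). v > 0" by real_asymp
  have "((\<lambda>v. s * inverse (real (cut x v) * v)) \<longlongrightarrow> s * 0) (at_right 0)"
    by (intro tendsto_intros tendsto_inverse_0_at_top cut_at_top)
  hence "((\<lambda>v. 1 - s * inverse (real (cut x v) * v)) \<longlongrightarrow> 1 - s * 0) (at_right 0)"
    by (intro tendsto_diff tendsto_const)
  moreover have "\<forall>\<^sub>F v in at_right 0. 1 - s * inverse (real (cut x v) * v) = z v / v"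
    using v0 by eventually_elim (auto simp: z_def field_simps)
  ultimately have zv: "((\<lambda>v. z v / v) \<longlongrightarrow> 1) (at_right 0)" by (simp add: tendsto_cong)
  have "\<forall>\<^sub>F v in at_right 0. z v / v > 0" using order_tendstoD(1)[OF zv, of 0] by simp
  with v0 have zpos: "\<forall>\<^sub>F v in at_right 0. z v > 0"
    by eventually_elim (auto simp: zero_less_divide_iff)
  thus "\<forall>\<^sub>F v in at_right 0. v - s / real (cut x v) > 0" by (simp add: z_def)
  have "((\<lambda>v. z v / v * v) \<longlongrightarrow> 1 * 0) (at_right 0)" by (intro tendsto_mult zv) real_asymp
  moreover have "\<forall>\<^sub>F v in at_right 0. z v / v * v = z v" using v0 by eventually_elim auto
  ultimately have "(z \<longlongrightarrow> 0) (at_right 0)" by (simp add: tendsto_cong)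
  hence "filterlim z (at_right 0) (at_right 0)" using zpos by (rule tendsto_imp_filterlim_at_right)
  moreover have "((\<lambda>z::real. z / (1 - exp (- z))) \<longlongrightarrow> 1) (at_right 0)" by real_asymp
  ultimately have z1: "((\<lambda>v. z v / (1 - exp (- z v))) \<longlongrightarrow> 1) (at_right 0)" by (rule filterlim_compose[rotated])
  have "((\<lambda>v. real (cut x v) powr (\<alpha> - 1) * exp (- v) ^ cut x v / v * (z v / (1 - exp (- z v))) / (z v / v))
     \<longlongrightarrow> exp (- x) * 1 / 1) (at_right 0)"
    by (intro tendsto_intros cut_weight_lim z1 zv) auto
  moreover have "\<forall>\<^sub>F v in at_right 0. real (cut x v) powr (\<alpha> - 1) * exp (- v) ^ cut x v / v * (z v / (1 - exp (- z v))) / (z v / v)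
     = real (cut x v) powr (\<alpha> - 1) * exp (- v) ^ cut x v / (1 - exp (- z v))"
    using v0 zpos by eventually_elim auto
  ultimately show "((\<lambda>v. real (cut x v) powr (\<alpha> - 1) * exp (- v) ^ cut x v / (1 - exp (- (v - s / real (cut x v))))) \<longlongrightarrow> exp (- x)) (at_right 0)"
    by (simp add: tendsto_cong flip: z_def)
qed

text \<open>With B = cut x v, the weight at k + B is close to B^(\<alpha>-1) exp(-Bv) times (1 +
  k/B)^(\<alpha>-1) exp(-kv). The factor (1 + k/B)^(\<alpha>-1) lies between exp(-a k/B) and exp(a
  k/B), so the tail is enclosed by two geometric series that differ in their limits only by the
  ratio error e.\<close>

lemma tail_lim: "((\<lambda>v. tail v (cut x v)) \<longlongrightarrow> exp (- x)) (at_right 0)"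
proof -
  define U where "U v = real (cut x v) powr (\<alpha> - 1) * exp (- v) ^ cut x v" for v
  define G where "G s v = U v / (1 - exp (- (v - s / real (cut x v))))" for s v
  define a where "a = \<bar>\<alpha> - 1\<bar>"
  have G_lim: "((\<lambda>v. c * G s v) \<longlongrightarrow> c * exp (- x)) (at_right 0)" for c s
    unfolding G_def U_def by (intro tendsto_mult cut_geometric_lim tendsto_const)
  have bounds: "\<forall>\<^sub>F v in at_right 0. (1 - e) * G (- a) v \<le> tail v (cut x v) \<and> tail v (cut x v) \<le> (1 + e) * G a v"
    if e: "0 < e" "e < 1" for e
  proof -
    have "\<forall>\<^sub>F k in sequentially. \<bar>\<theta> k / real k powr \<alpha> - 1\<bar> < e"
      using tendstoD[OF \<theta>_ratio e(1)] by (simp add: dist_real_def)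
    then obtain k1 where k1: "\<And>k. k \<ge> k1 \<Longrightarrow> \<bar>\<theta> k / real k powr \<alpha> - 1\<bar> < e"
      unfolding eventually_sequentially by blast
    have "\<forall>\<^sub>F v in at_right 0. cut x v \<ge> max k1 1"
      using filterlim_at_top[THEN iffD1, OF cut_nat_at_top[of x]] by blast
    moreover have "\<forall>\<^sub>F v in at_right (0::real). v > 0" "\<forall>\<^sub>F v in at_right (0::real). v < 1" by real_asymp+
    ultimately show ?thesis
      using cut_geometric_lim(2)[of a x] cut_geometric_lim(2)[of "- a" x]
    proof eventually_elim
      case (elim v)
      define B where "B = cut x v"
      have B: "B \<ge> 1" "B \<ge> k1" using elim by (auto simp: B_def)
      have v: "0 < v" "v \<le> 1" using elim by auto
      have sums: "(\<lambda>k. c * U v * exp (- (v - s / real B)) ^ k) sums (c * G s v)" if "v - s / real B > 0" for c s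
        using sums_mult[OF geometric_sums[of "exp (- (v - s / real B))"], of "c * U v"] that
        by (simp add: G_def B_def)
      have wt: "wt v (k + B) = \<theta> (k + B) / real (k + B) powr \<alpha> * (U v * ((1 + real k / real B) powr (\<alpha> - 1) * exp (- v) ^ k))" for k
      proof -
        have "real (k + B) = real B * (1 + real k / real B)" using B by (simp add: field_simps)
        hence "real (k + B) powr (\<alpha> - 1) = real B powr (\<alpha> - 1) * (1 + real k / real B) powr (\<alpha> - 1)"
          by (simp only: powr_mult)
        moreover have "real (k + B) powr (\<alpha> - 1) = real (k + B) powr \<alpha> / real (k + B)"
          using B by (simp add: powr_diff)
        ultimately have "1 / real (k + B) = real B powr (\<alpha> - 1) * (1 + real k / real B) powr (\<alpha> - 1) / real (k + B) powr \<alpha>"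
          using B by (simp add: field_simps)
        hence "wt v (k + B) = \<theta> (k + B) * (real B powr (\<alpha> - 1) * (1 + real k / real B) powr (\<alpha> - 1) / real (k + B) powr \<alpha>) * exp (- v) ^ (k + B)"
          unfolding wt_def by (metis times_divide_eq_right mult.right_neutral)
        thus ?thesis by (simp add: U_def B_def power_add mult_ac)
      qed
      have ratio: "1 - e \<le> \<theta> (k + B) / real (k + B) powr \<alpha>" "\<theta> (k + B) / real (k + B) powr \<alpha> \<le> 1 + e" for k
        using k1[of "k + B"] B by auto
      have U: "U v \<ge> 0" by (simp add: U_def)
      have pow: "exp (- (v - s / real B)) ^ k = exp (s * (real k / real B)) * exp (- v) ^ k" for s k
        by (simp add: exp_of_nat_mult[symmetric] field_simps flip: exp_add)
      have lo: "(1 - e) * U v * exp (- (v - (- a) / real B)) ^ k \<le> wt v (k + B)" for k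
        unfolding wt pow mult.assoc using powr_one_plus_bounds(1)[of "real k / real B" "\<alpha> - 1"] ratio[of k] U e
        by (intro mult_mono[where b = "\<theta> (k + B) / real (k + B) powr \<alpha>"] mult_left_mono mult_right_mono)
           (auto simp: a_def intro!: mult_nonneg_nonneg)
      have hi: "wt v (k + B) \<le> (1 + e) * U v * exp (- (v - a / real B)) ^ k" for k
        unfolding wt pow mult.assoc using powr_one_plus_bounds(2)[of "real k / real B" "\<alpha> - 1"] ratio[of k] U e
        by (intro mult_mono[where b = "1 + e"] mult_left_mono mult_right_mono)
           (auto simp: a_def intro!: mult_nonneg_nonneg)
      have tl: "(\<lambda>k. wt v (k + B)) sums tail v B"
        unfolding tail_def by (rule summable_sums[OF wt_summable[OF v B(1)]])
      have "(1 - e) * G (- a) v \<le> tail v B"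
        using elim by (intro sums_le[OF lo sums tl]) (simp add: B_def)
      moreover have "tail v B \<le> (1 + e) * G a v"
        using elim by (intro sums_le[OF hi tl sums]) (simp add: B_def)
      ultimately show ?case by (simp add: B_def)
    qed
  qed
  show ?thesis
  proof (rule order_tendstoI)
    fix l assume l: "l < exp (- x)"
    have "((\<lambda>e. (1 - e) * exp (- x)) \<longlongrightarrow> (1 - 0) * exp (- x)) (at_right 0)" by (intro tendsto_intros)
    hence "\<forall>\<^sub>F e in at_right 0. (1 - e) * exp (- x) > l" using l by (intro order_tendstoD) auto
    moreover have "\<forall>\<^sub>F e in at_right (0::real). 0 < e" "\<forall>\<^sub>F e in at_right (0::real). e < 1" by real_asymp+
    ultimately have "\<forall>\<^sub>F e in at_right 0. l < (1 - e) * exp (- x) \<and> 0 < e \<and> e < 1" by eventually_elim auto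
    then obtain e where e: "l < (1 - e) * exp (- x)" "0 < e" "e < 1"
      using eventually_happens[of _ "at_right (0::real)"] trivial_limit_at_right_real by blast
    show "\<forall>\<^sub>F v in at_right 0. l < tail v (cut x v)"
      using order_tendstoD(1)[OF G_lim[of _ "- a"] e(1)] bounds[OF e(2,3)] by eventually_elim auto
  next
    fix l assume l: "l > exp (- x)"
    have "((\<lambda>e. (1 + e) * exp (- x)) \<longlongrightarrow> (1 + 0) * exp (- x)) (at_right 0)" by (intro tendsto_intros)
    hence "\<forall>\<^sub>F e in at_right 0. (1 + e) * exp (- x) < l" using l by (intro order_tendstoD) auto
    moreover have "\<forall>\<^sub>F e in at_right (0::real). 0 < e" "\<forall>\<^sub>F e in at_right (0::real). e < 1" by real_asymp+
    ultimately have "\<forall>\<^sub>F e in at_right 0. l > (1 + e) * exp (- x) \<and> 0 < e \<and> e < 1" by eventually_elim auto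
    then obtain e where e: "l > (1 + e) * exp (- x)" "0 < e" "e < 1"
      using eventually_happens[of _ "at_right (0::real)"] trivial_limit_at_right_real by blast
    show "\<forall>\<^sub>F v in at_right 0. tail v (cut x v) < l"
      using order_tendstoD(2)[OF G_lim[of _ a] e(1)] bounds[OF e(2,3)] by eventually_elim auto
  qed
qed

section \<open>Standard deviation, truncated moments and the local limit theorem for tilted
  weights\<close>

lemma scale_sq: "0 < v \<Longrightarrow> v \<le> 1 \<Longrightarrow> (scale v)\<^sup>2 = moment 1 v"
  unfolding scale_def using moment_ge_sum[of v "{}" 1] by simp

lemma scale_lower: obtains c where "c > 0" "\<forall>\<^sub>F v in at_right 0. sqrt c * v powr (- (\<alpha> + 2) / 2) \<le> scale v"
proof -
  obtain c where c: "c > 0" "\<forall>\<^sub>F v in at_right 0. c * v powr (- \<alpha> - real 1 - 1) \<le> moment 1 v"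
    by (rule moment_lower[of 1]) blast
  have "\<forall>\<^sub>F v in at_right (0::real). v > 0" by real_asymp
  with c(2) have "\<forall>\<^sub>F v in at_right 0. sqrt c * v powr (- (\<alpha> + 2) / 2) \<le> scale v"
  proof eventually_elim
    case (elim v)
    have "sqrt (v powr (- \<alpha> - real 1 - 1)) = v powr (- (\<alpha> + 2) / 2)"
      using elim by (simp add: powr_half_sqrt[symmetric] powr_powr field_simps)
    hence "sqrt c * v powr (- (\<alpha> + 2) / 2) = sqrt (c * v powr (- \<alpha> - real 1 - 1))"
      by (simp add: real_sqrt_mult)
    thus ?case unfolding scale_def using elim by simp
  qed
  thus ?thesis using c that by blast
qed

lemma scale_at_top: "filterlim scale at_top (at_right 0)"
proof -
  obtain c where c: "c > 0" "\<forall>\<^sub>F v in at_right 0. sqrt c * v powr (- (\<alpha> + 2) / 2) \<le> scale v"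
    using scale_lower by blast
  have "filterlim (\<lambda>v::real. sqrt c * v powr (- (\<alpha> + 2) / 2)) at_top (at_right 0)"
    using c \<alpha> by real_asymp
  thus ?thesis using c(2) by (rule filterlim_at_top_mono)
qed

text \<open>The leading lengths add up to at most (C level v + C') / v, negligible against a
  standard deviation of order at least v^(-(\<alpha>+2)/2). Removing them therefore does not move
  the local limit.\<close>

lemma log_over_scale: "((\<lambda>v. (C * level v + C') / v / scale v) \<longlongrightarrow> 0) (at_right 0)"
proof -
  obtain c where c: "c > 0" "\<forall>\<^sub>F v in at_right 0. sqrt c * v powr (- (\<alpha> + 2) / 2) \<le> scale v"
    using scale_lower by blast
  have v0: "\<forall>\<^sub>F v in at_right (0::real). v > 0" by real_asymp
  show ?thesis
  proof (rule Lim_null_comparison)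
    show "\<forall>\<^sub>F v in at_right 0. norm ((C * level v + C') / v / scale v) \<le> 
        \<bar>C * level v + C'\<bar> / v / (sqrt c * v powr (- (\<alpha> + 2) / 2))"
      using c(2) v0
    proof eventually_elim
      case (elim v)
      have "sqrt c * v powr (- (\<alpha> + 2) / 2) > 0" using elim c by simp
      thus ?case using elim by (auto simp: abs_mult abs_divide intro!: divide_left_mono)
    qed
    have "((\<lambda>v. (C * level v + C') / v / (sqrt c * v powr (- (\<alpha> + 2) / 2))) \<longlongrightarrow> 0) (at_right 0)"
      unfolding level_def using c \<alpha> by real_asymp
    hence "((\<lambda>v. \<bar>(C * level v + C') / v / (sqrt c * v powr (- (\<alpha> + 2) / 2))\<bar>) \<longlongrightarrow> 0) (at_right 0)"
      by (rule tendsto_rabs_zero)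
    moreover have "\<forall>\<^sub>F v in at_right 0. \<bar>(C * level v + C') / v / (sqrt c * v powr (- (\<alpha> + 2) / 2))\<bar> =
        \<bar>C * level v + C'\<bar> / v / (sqrt c * v powr (- (\<alpha> + 2) / 2))"
      using v0 by eventually_elim (use c in \<open>auto simp: abs_mult\<close>)
    ultimately show "((\<lambda>v. \<bar>C * level v + C'\<bar> / v / (sqrt c * v powr (- (\<alpha> + 2) / 2))) \<longlongrightarrow> 0) (at_right 0)"
      by (rule Lim_transform_eventually)
  qed
qed

text \<open>Truncation at b costs the tails of \<open>moment 0\<close> and \<open>moment 1\<close>.
  By \<open>tail_bound\<close> these carry a factor v^(3\<alpha>/4) up to logarithms, so relative to
  scale and to its square they are of order v^(\<alpha>/4) and v^(3\<alpha>/4). The third moment is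
  at most of order v^(-\<alpha>-3), against a cube of the scale of order at least
  v^(-3\<alpha>/2-3).\<close>

lemma truncated_moment_lims:
  assumes V: "filterlim V (at_right 0) F" and b: "\<forall>\<^sub>F n in F. level (V n) - a \<le> real (b n) * V n"
  shows "((\<lambda>n. ((\<Sum>k=1..<b n. real k * wt (V n) k) - moment 0 (V n)) / scale (V n)) \<longlongrightarrow> 0) F"
    and "((\<lambda>n. (\<Sum>k=1..<b n. real k ^ 2 * wt (V n) k) / scale (V n) ^ 2) \<longlongrightarrow> 1) F"
    and "((\<lambda>n. (\<Sum>k=1..<b n. real k ^ 3 * wt (V n) k) / scale (V n) ^ 3) \<longlongrightarrow> 0) F"
proof -
  obtain c where c: "c > 0" "\<forall>\<^sub>F v in at_right 0. sqrt c * v powr (- (\<alpha> + 2) / 2) \<le> scale v"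
    using scale_lower by blast
  obtain D0 where D0: "D0 > 0" "\<And>v b. 0 < v \<Longrightarrow> v \<le> 1 \<Longrightarrow> b \<ge> 1 \<Longrightarrow>
        (\<Sum>k. real (k + b) ^ 0 * \<theta> (k + b) * exp (- v) ^ (k + b)) \<le> D0 * v powr (- \<alpha> - real 0 - 1) * exp (- (3/4 * real b * v))"
    by (rule tail_bound[of 0]) blast
  obtain D1 where D1: "D1 > 0" "\<And>v b. 0 < v \<Longrightarrow> v \<le> 1 \<Longrightarrow> b \<ge> 1 \<Longrightarrow>
        (\<Sum>k. real (k + b) ^ 1 * \<theta> (k + b) * exp (- v) ^ (k + b)) \<le> D1 * v powr (- \<alpha> - real 1 - 1) * exp (- (3/4 * real b * v))"
    by (rule tail_bound[of 1]) blast
  obtain D2 where D2: "D2 > 0" "\<And>v. 0 < v \<Longrightarrow> v \<le> 1 \<Longrightarrow> moment 2 v \<le> D2 * v powr (- \<alpha> - real 2 - 1)"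
    by (rule moment_upper[of 2]) blast
  have "\<forall>\<^sub>F v in at_right (0::real). v > 0" "\<forall>\<^sub>F v in at_right (0::real). v \<le> 1" by real_asymp+
  moreover have "\<forall>\<^sub>F v in at_right 0. level v > a" using level_at_top by (simp add: filterlim_at_top_dense)
  ultimately have "\<forall>\<^sub>F v in at_right 0. 0 < v \<and> v \<le> 1 \<and> level v > a \<and> sqrt c * v powr (- (\<alpha> + 2) / 2) \<le> scale v"
    using c(2) by eventually_elim auto
  hence "\<forall>\<^sub>F n in F. 0 < V n \<and> V n \<le> 1 \<and> level (V n) > a \<and> sqrt c * V n powr (- (\<alpha> + 2) / 2) \<le> scale (V n)"
    using V unfolding filterlim_iff by blast
  with b have good: "\<forall>\<^sub>F n in F. 0 < V n \<and> V n \<le> 1 \<and> b n \<ge> 1 \<and> 0 < sqrt c * V n powr (- (\<alpha> + 2) / 2) \<and>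
      sqrt c * V n powr (- (\<alpha> + 2) / 2) \<le> scale (V n) \<and>
      exp (- (3/4 * real (b n) * V n)) \<le> exp (- (3/4 * (level (V n) - a)))"
  proof eventually_elim
    case (elim n)
    hence "real (b n) * V n > 0" by linarith
    hence "b n \<ge> 1" by (cases "b n") auto
    thus ?case using elim c by auto
  qed
  have sum_eq: "(\<Sum>k=1..<b. real k ^ Suc p * wt v k) = (\<Sum>k=1..<b. real k ^ p * \<theta> k * exp (- v) ^ k)" for b p v
    by (rule sum.cong) (auto simp: power_mult_wt simp del: power_Suc)
  note lim = filterlim_compose[OF _ V]
  show "((\<lambda>n. ((\<Sum>k=1..<b n. real k * wt (V n) k) - moment 0 (V n)) / scale (V n)) \<longlongrightarrow> 0) F"
  proof (rule Lim_null_comparison)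
    show "\<forall>\<^sub>F n in F. norm (((\<Sum>k=1..<b n. real k * wt (V n) k) - moment 0 (V n)) / scale (V n)) \<le>
       (\<lambda>v. D0 * v powr (- \<alpha> - 1) * exp (- (3/4 * (level v - a))) / (sqrt c * v powr (- (\<alpha> + 2) / 2))) (V n)"
      using good
    proof eventually_elim
      case (elim n)
      let ?T = "\<Sum>k. real (k + b n) ^ 0 * \<theta> (k + b n) * exp (- V n) ^ (k + b n)"
      have "(\<Sum>k=1..<b n. real k * wt (V n) k) - moment 0 (V n) = - ?T"
        using moment_split[of "V n" "b n" 0] sum_eq[where p = 0] elim by simp
      moreover have "?T \<ge> 0" using tail_nonneg[of "V n" "b n" 0] elim by blast
      moreover have "?T \<le> D0 * V n powr (- \<alpha> - 1) * exp (- (3/4 * (level (V n) - a)))"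
        using D0(2)[of "V n" "b n"] elim D0(1)
        by (auto intro: order_trans mult_left_mono)
      ultimately show ?case using elim by (auto simp: abs_divide intro!: frac_le)
    qed
    show "((\<lambda>n. (\<lambda>v. D0 * v powr (- \<alpha> - 1) * exp (- (3/4 * (level v - a))) / (sqrt c * v powr (- (\<alpha> + 2) / 2))) (V n)) \<longlongrightarrow> 0) F"
      by (rule lim) (unfold level_def, use c D0 \<alpha> in real_asymp)
  qed
  have "((\<lambda>n. 1 - (\<Sum>k=1..<b n. real k ^ 2 * wt (V n) k) / scale (V n) ^ 2) \<longlongrightarrow> 0) F"
  proof (rule Lim_null_comparison)
    show "\<forall>\<^sub>F n in F. norm (1 - (\<Sum>k=1..<b n. real k ^ 2 * wt (V n) k) / scale (V n) ^ 2) \<le>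
       (\<lambda>v. D1 * v powr (- \<alpha> - 2) * exp (- (3/4 * (level v - a))) / (sqrt c * v powr (- (\<alpha> + 2) / 2))\<^sup>2) (V n)"
      using good
    proof eventually_elim
      case (elim n)
      let ?T = "\<Sum>k. real (k + b n) ^ 1 * \<theta> (k + b n) * exp (- V n) ^ (k + b n)"
      have sp: "scale (V n) > 0" using elim by linarith
      have "(\<Sum>k=1..<b n. real k ^ 2 * wt (V n) k) = (scale (V n))\<^sup>2 - ?T"
        using moment_split[of "V n" "b n" 1] sum_eq[where p = 1] scale_sq[of "V n"] elim
        by (simp add: numeral_2_eq_2)
      hence "1 - (\<Sum>k=1..<b n. real k ^ 2 * wt (V n) k) / scale (V n) ^ 2 = ?T / (scale (V n))\<^sup>2"
        using sp by (simp add: field_simps)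
      moreover have "?T \<ge> 0" using tail_nonneg[of "V n" "b n" 1] elim by blast
      moreover have "?T \<le> D1 * V n powr (- \<alpha> - 2) * exp (- (3/4 * (level (V n) - a)))"
      proof -
        have "- \<alpha> - real 1 - 1 = - \<alpha> - 2" by simp
        hence "?T \<le> D1 * V n powr (- \<alpha> - 2) * exp (- (3/4 * real (b n) * V n))"
          using D1(2)[of "V n" "b n"] elim by metis
        also have "\<dots> \<le> D1 * V n powr (- \<alpha> - 2) * exp (- (3/4 * (level (V n) - a)))"
          using elim D1(1) by (intro mult_left_mono) auto
        finally show ?thesis .
      qed
      moreover have "(sqrt c * V n powr (- (\<alpha> + 2) / 2))\<^sup>2 \<le> (scale (V n))\<^sup>2"
        using elim by (intro power_mono) auto
      moreover have "(sqrt c * V n powr (- (\<alpha> + 2) / 2))\<^sup>2 > 0" using elim by (intro zero_less_power) auto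
      ultimately show ?case by (auto simp: abs_divide intro!: frac_le)
    qed
    show "((\<lambda>n. (\<lambda>v. D1 * v powr (- \<alpha> - 2) * exp (- (3/4 * (level v - a))) / (sqrt c * v powr (- (\<alpha> + 2) / 2))\<^sup>2) (V n)) \<longlongrightarrow> 0) F"
      by (rule lim) (unfold level_def, use c D1 \<alpha> in real_asymp)
  qed
  from tendsto_diff[OF tendsto_const[of 1] this]
  show "((\<lambda>n. (\<Sum>k=1..<b n. real k ^ 2 * wt (V n) k) / scale (V n) ^ 2) \<longlongrightarrow> 1) F" by simp
  show "((\<lambda>n. (\<Sum>k=1..<b n. real k ^ 3 * wt (V n) k) / scale (V n) ^ 3) \<longlongrightarrow> 0) F"
  proof (rule Lim_null_comparison)
    show "\<forall>\<^sub>F n in F. norm ((\<Sum>k=1..<b n. real k ^ 3 * wt (V n) k) / scale (V n) ^ 3) \<le>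
       (\<lambda>v. D2 * v powr (- \<alpha> - 3) / (sqrt c * v powr (- (\<alpha> + 2) / 2)) ^ 3) (V n)"
      using good
    proof eventually_elim
      case (elim n)
      have "(\<Sum>k=1..<b n. real k ^ 3 * wt (V n) k) \<le> moment 2 (V n)"
        using moment_ge_sum[of "V n" "{1..<b n}" 2] sum_eq[where p = 2] elim
        by (simp add: numeral_3_eq_3 numeral_2_eq_2)
      also have "\<dots> \<le> D2 * V n powr (- \<alpha> - 3)" using D2(2)[of "V n"] elim by (simp add: algebra_simps)
      finally have "(\<Sum>k=1..<b n. real k ^ 3 * wt (V n) k) \<le> D2 * V n powr (- \<alpha> - 3)" .
      moreover have "(\<Sum>k=1..<b n. real k ^ 3 * wt (V n) k) \<ge> 0" by (intro sum_nonneg mult_nonneg_nonneg wt_nonneg) auto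
      moreover have "(sqrt c * V n powr (- (\<alpha> + 2) / 2)) ^ 3 \<le> (scale (V n)) ^ 3"
        using elim by (intro power_mono) auto
      moreover have "(sqrt c * V n powr (- (\<alpha> + 2) / 2)) ^ 3 > 0" using elim by (intro zero_less_power) auto
      ultimately show ?case using elim by (auto simp: abs_divide intro!: frac_le)
    qed
    show "((\<lambda>n. (\<lambda>v. D2 * v powr (- \<alpha> - 3) / (sqrt c * v powr (- (\<alpha> + 2) / 2)) ^ 3) (V n)) \<longlongrightarrow> 0) F"
      by (rule lim) (use c D2 \<alpha> in real_asymp)
  qed
qed

text \<open>A target within o(scale) of n and a truncation as low as about level v / v are both
  allowed, so one statement covers the numerator and the denominator of the coefficient
  ratio.\<close>

lemma local_limit_exp_coeff_wt:
  assumes V: "filterlim V (at_right 0) sequentially"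
    and mean: "\<forall>\<^sub>F n in sequentially. moment 0 (V n) = real n"
    and b: "\<forall>\<^sub>F n in sequentially. level (V n) - a \<le> real (b n) * V n"
    and N: "(\<lambda>n. (real n - real (N n)) / scale (V n)) \<longlonglongrightarrow> 0"
  shows "(\<lambda>n. scale (V n) * exp (- (\<Sum>k=1..<b n. wt (V n) k)) *
            exp_coeff (\<lambda>k. if k < b n then wt (V n) k else 0) (N n))
      \<longlonglongrightarrow> (LINT x|lborel. exp (- (x\<^sup>2) / 2)) / (2 * pi)"
proof -
  obtain C where C: "\<forall>\<^sub>F v in at_right 0. \<forall>b t. 16 * nat \<lceil>1 / v\<rceil> \<le> b \<longrightarrow> \<bar>t\<bar> \<le> pi \<longrightarrow>
     exp (- (\<Sum>k=1..<b. wt v k * (1 - cos (real k * t)))) \<le> C / (1 + (scale v * t)\<^sup>2)"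
    using char_fun_domination by blast
  show ?thesis
  proof (rule local_limit_exp_coeff)
    show "filterlim (\<lambda>n. scale (V n)) at_top sequentially"
      by (rule filterlim_compose[OF scale_at_top V])
    show "(\<lambda>n. ((\<Sum>k=1..<b n. real k * wt (V n) k) - real (N n)) / scale (V n)) \<longlonglongrightarrow> 0"
    proof (rule Lim_transform_eventually)
      show "(\<lambda>n. ((\<Sum>k=1..<b n. real k * wt (V n) k) - moment 0 (V n)) / scale (V n)
         + (real n - real (N n)) / scale (V n)) \<longlonglongrightarrow> 0"
        using tendsto_add[OF truncated_moment_lims(1)[OF V b] N] by simp
      show "\<forall>\<^sub>F n in sequentially. ((\<Sum>k=1..<b n. real k * wt (V n) k) - moment 0 (V n)) / scale (V n)
         + (real n - real (N n)) / scale (V n) = ((\<Sum>k=1..<b n. real k * wt (V n) k) - real (N n)) / scale (V n)"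
        using mean by eventually_elim (simp flip: add_divide_distrib)
    qed
    have "\<forall>\<^sub>F v in at_right 0. level v > a + 24" using level_at_top by (simp add: filterlim_at_top_dense)
    moreover have "\<forall>\<^sub>F v in at_right (0::real). v > 0" "\<forall>\<^sub>F v in at_right (0::real). v < 1/2" by real_asymp+
    ultimately have "\<forall>\<^sub>F v in at_right 0. level v > a + 24 \<and> v > 0 \<and> v < 1/2 \<and>
       (\<forall>b t. 16 * nat \<lceil>1 / v\<rceil> \<le> b \<longrightarrow> \<bar>t\<bar> \<le> pi \<longrightarrow>
         exp (- (\<Sum>k=1..<b. wt v k * (1 - cos (real k * t)))) \<le> C / (1 + (scale v * t)\<^sup>2))"
      using C by eventually_elim auto
    hence "\<forall>\<^sub>F n in sequentially. level (V n) > a + 24 \<and> V n > 0 \<and> V n < 1/2 \<and>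
       (\<forall>b t. 16 * nat \<lceil>1 / V n\<rceil> \<le> b \<longrightarrow> \<bar>t\<bar> \<le> pi \<longrightarrow>
         exp (- (\<Sum>k=1..<b. wt (V n) k * (1 - cos (real k * t)))) \<le> C / (1 + (scale (V n) * t)\<^sup>2))"
      using V unfolding filterlim_iff by blast
    with b show "\<forall>\<^sub>F n in sequentially. \<forall>t. \<bar>t\<bar> \<le> pi \<longrightarrow>
        exp (- (\<Sum>k=1..<b n. wt (V n) k * (1 - cos (real k * t)))) \<le> C / (1 + (scale (V n) * t)\<^sup>2)"
    proof eventually_elim
      case (elim n)
      have "real (nat \<lceil>1 / V n\<rceil>) \<le> 1 / V n + 1" using elim by (simp add: of_nat_nat)
      hence "16 * real (nat \<lceil>1 / V n\<rceil>) * V n \<le> 16 * (1 / V n + 1) * V n"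
        using elim by (intro mult_right_mono[where c = "V n"] mult_left_mono[where c = 16]) auto
      \<comment> \<open>16 (1 + v) \<le> 24 for v < 1/2. The level was taken above a + 24 so that
        the blocks used in \<open>char_fun_domination\<close> lie below the truncation.\<close>
      also have "\<dots> \<le> 24" using elim by (simp add: field_simps)
      also have "\<dots> \<le> real (b n) * V n" using elim by linarith
      finally have "16 * real (nat \<lceil>1 / V n\<rceil>) \<le> real (b n)" using elim by (simp add: mult_le_cancel_right)
      hence "16 * nat \<lceil>1 / V n\<rceil> \<le> b n" by linarith
      thus ?case using elim by blast
    qed
  qed (use wt_nonneg truncated_moment_lims[OF V b] in auto)
qed

end

section \<open>The saddle point\<close>

context polynomial_weights
begin

text \<open>The series of the saddle point equation in the variable q = exp(-v), where it becomes a
  power series.\<close>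

definition gen :: "real \<Rightarrow> real" where
  "gen q = (\<Sum>k. \<theta> (Suc k) * q ^ Suc k)"

lemma gen_summable: "0 \<le> q \<Longrightarrow> q < 1 \<Longrightarrow> summable (\<lambda>k. \<theta> (Suc k) * q ^ Suc k)"
proof -
  assume q: "0 \<le> q" "q < 1"
  \<comment> \<open>A rate in (0, 1] with q \<le> exp(-v), as \<open>moment_summable\<close>
    requires. The maximum with exp(-1) keeps v at most 1 and covers q = 0.\<close>
  define v where "v = min 1 (- ln (max q (exp (-1))))"
  have m: "0 < max q (exp (-1))" "max q (exp (-1)) < (1::real)" using q by (auto simp: less_max_iff_disj)
  have v: "0 < v" "v \<le> 1" using m by (auto simp: v_def min_def)
  have "ln (max q (exp (-1))) \<ge> ln (exp (-1 :: real))" using m by (subst ln_le_cancel_iff) auto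
  hence "v = - ln (max q (exp (-1)))" by (simp add: v_def)
  hence "exp (- v) = max q (exp (-1))" using m by simp
  hence qv: "q \<le> exp (- v)" by simp
  show ?thesis
  proof (rule summable_comparison_test')
    show "summable (\<lambda>k. real (k + 1) ^ 0 * \<theta> (k + 1) * exp (- v) ^ (k + 1))"
      by (rule moment_summable[OF v]) simp
    show "norm (\<theta> (Suc k) * q ^ Suc k) \<le> real (k + 1) ^ 0 * \<theta> (k + 1) * exp (- v) ^ (k + 1)" for k
      using q qv \<theta>_nonneg[of "Suc k"] power_mono[OF qv q(1), of "Suc k"]
      by (auto simp: abs_mult mult_left_mono simp del: power_Suc)
  qed
qed

lemma gen_strict_mono: "0 \<le> q \<Longrightarrow> q < q' \<Longrightarrow> q' < 1 \<Longrightarrow> gen q < gen q'"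
proof -
  assume q: "0 \<le> q" "q < q'" "q' < 1"
  obtain k0 where k0: "\<And>k. k \<ge> k0 \<Longrightarrow> k \<ge> 1 \<Longrightarrow> real k powr \<alpha> / 2 \<le> \<theta> k" using \<theta>_lower by blast
  \<comment> \<open>Strictness rests on one positive coefficient, which the asymptotics of \<theta>
    provide.\<close>
  have pos: "\<theta> (Suc k0) > 0"
    using k0[of "Suc k0"] by (auto intro: less_le_trans[of 0 "real (Suc k0) powr \<alpha> / 2"])
  have "0 < (\<Sum>k. \<theta> (Suc k) * q' ^ Suc k - \<theta> (Suc k) * q ^ Suc k)"
  proof (rule suminf_pos2[where i = k0])
    show "summable (\<lambda>k. \<theta> (Suc k) * q' ^ Suc k - \<theta> (Suc k) * q ^ Suc k)"
      using q by (intro summable_diff gen_summable) auto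
    show "0 \<le> \<theta> (Suc k) * q' ^ Suc k - \<theta> (Suc k) * q ^ Suc k" for k
      using q \<theta>_nonneg[of "Suc k"] by (auto intro!: mult_left_mono mult_mono power_mono)
    have "q ^ Suc k0 < q' ^ Suc k0" using q by (intro power_strict_mono) auto
    thus "0 < \<theta> (Suc k0) * q' ^ Suc k0 - \<theta> (Suc k0) * q ^ Suc k0"
      using pos by (simp add: mult_strict_left_mono del: power_Suc)
  qed
  also have "\<dots> = gen q' - gen q"
    unfolding gen_def using q by (intro suminf_diff[symmetric] gen_summable) auto
  finally show ?thesis by simp
qed

lemma gen_continuous: "0 \<le> q \<Longrightarrow> q < 1 \<Longrightarrow> isCont gen q"
proof -
  assume q: "0 \<le> q" "q < 1"
  \<comment> \<open>A power series also has a coefficient at 0, where the value of \<theta> is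
    arbitrary; it is set to 0.\<close>
  define c where "c n = (if n = 0 then 0 else \<theta> n)" for n
  define K where "K = (q + 1) / 2"
  have K: "0 \<le> K" "K < 1" "q < K" using q by (auto simp: K_def)
  have "summable (\<lambda>n. c (Suc n) * K ^ Suc n)" using gen_summable[OF K(1,2)] by (simp add: c_def)
  hence "summable (\<lambda>n. c n * K ^ n)" by (subst (asm) summable_Suc_iff)
  hence "isCont (\<lambda>x. \<Sum>n. c n * x ^ n) q" by (rule isCont_powser) (use K q in auto)
  moreover have "\<forall>\<^sub>F x in nhds q. x \<in> {-1<..<1}" using q by (intro eventually_nhds_in_open) auto
  hence "\<forall>\<^sub>F x in nhds q. (\<Sum>n. c n * x ^ n) = gen x"
  proof eventually_elim
    case (elim x)
    have "summable (\<lambda>k. \<theta> (Suc k) * x ^ Suc k)"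
      by (rule summable_norm_cancel, rule summable_cong[THEN iffD1, OF _ gen_summable[of "\<bar>x\<bar>"]])
         (use elim \<theta>_nonneg in \<open>auto simp: abs_mult power_abs\<close>)
    hence "summable (\<lambda>n. c (Suc n) * x ^ Suc n)" by (simp add: c_def)
    hence "summable (\<lambda>n. c n * x ^ n)" by (subst (asm) summable_Suc_iff)
    from suminf_split_head[OF this] show ?case by (simp add: c_def gen_def)
  qed
  ultimately show ?thesis by (simp add: isCont_cong)
qed

lemma moment_0_eq_gen: "moment 0 v = gen (exp (- v))"
  by (simp add: moment_def gen_def)

lemma moment_0_lower: obtains c where "c > 0" "\<forall>\<^sub>F v in at_right 0. c * v powr (- \<alpha> - 1) \<le> moment 0 v"
  by (rule moment_lower[of 0]) auto

text \<open>Existence by the intermediate value theorem: \<open>gen\<close> vanishes at 0 and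
  exceeds n close to 1 by the lower bound on \<open>moment 0\<close>. Uniqueness by strict
  monotonicity.\<close>

lemma saddle_unique:
  assumes n: "n \<ge> 1"
  shows "\<exists>!v. v > 0 \<and> (\<lambda>k. \<theta> (Suc k) * exp (- real (Suc k) * v)) sums real n"
proof -
  have sums_iff: "(\<lambda>k. \<theta> (Suc k) * exp (- real (Suc k) * v)) sums y \<longleftrightarrow> gen (exp (- v)) = y" if "v > 0" for v y
  proof -
    have "exp (- real (Suc k) * v) = exp (- v) ^ Suc k" for k
      by (subst exp_of_nat_mult[symmetric]) (simp add: algebra_simps)
    thus ?thesis using gen_summable[of "exp (- v)"] that by (simp add: sums_iff gen_def)
  qed
  obtain c where c: "c > 0" "\<forall>\<^sub>F v in at_right 0. c * v powr (- \<alpha> - 1) \<le> moment 0 v"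
    using moment_0_lower by blast
  have "filterlim (\<lambda>v::real. c * v powr (- \<alpha> - 1)) at_top (at_right 0)" using c \<alpha> by real_asymp
  hence "filterlim (moment 0) at_top (at_right 0)" using c(2) by (rule filterlim_at_top_mono)
  hence "\<forall>\<^sub>F v in at_right 0. real n < moment 0 v" by (simp add: filterlim_at_top_dense)
  moreover have "\<forall>\<^sub>F v in at_right (0::real). v > 0" by real_asymp
  ultimately have "\<forall>\<^sub>F v in at_right 0. real n < moment 0 v \<and> 0 < v" by eventually_elim auto
  then obtain v1 where v1: "real n < moment 0 v1" "0 < v1"
    using eventually_happens[of _ "at_right (0::real)"] trivial_limit_at_right_real by blast
  have "\<exists>q\<ge>0. q \<le> exp (- v1) \<and> gen q = real n"
  proof (rule IVT)
    show "gen 0 \<le> real n" by (simp add: gen_def)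
    show "\<forall>x. 0 \<le> x \<and> x \<le> exp (- v1) \<longrightarrow> isCont gen x"
      using v1 by (auto intro!: gen_continuous elim: le_less_trans)
  qed (use v1 in \<open>auto simp: moment_0_eq_gen\<close>)
  then obtain q where q: "q \<ge> 0" "q \<le> exp (- v1)" "gen q = real n" by blast
  have "q \<noteq> 0" using q(3) n by (auto simp: gen_def)
  hence q0: "q > 0" using q by simp
  have "exp (- v1) < 1" using v1 by simp
  hence q1: "q < 1" using q by linarith
  show ?thesis
  proof (rule ex1I[of _ "- ln q"])
    show "- ln q > 0 \<and> (\<lambda>k. \<theta> (Suc k) * exp (- real (Suc k) * (- ln q))) sums real n"
      using q0 q1 q(3) by (subst sums_iff) auto
  next
    fix v assume "v > 0 \<and> (\<lambda>k. \<theta> (Suc k) * exp (- real (Suc k) * v)) sums real n"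
    hence v: "v > 0" "gen (exp (- v)) = gen q" using sums_iff q by auto
    have "exp (- v) < 1" using v by simp
    hence "exp (- v) = q"
      using gen_strict_mono[of "exp (- v)" q] gen_strict_mono[of q "exp (- v)"] v q q1
      by (cases "exp (- v)" q rule: linorder_cases) auto
    thus "v = - ln q" by (metis ln_exp minus_minus)
  qed
qed

lemma saddle_point:
  assumes "n \<ge> 1"
  shows "saddle_point \<theta> n > 0" "moment 0 (saddle_point \<theta> n) = real n"
proof -
  have *: "saddle_point \<theta> n > 0 \<and> (\<lambda>k. \<theta> (Suc k) * exp (- real (Suc k) * saddle_point \<theta> n)) sums real n"
    unfolding saddle_point_def by (rule theI'[OF saddle_unique[OF assms]])
  thus "saddle_point \<theta> n > 0" by blast
  have "exp (- real (Suc k) * v) = exp (- v) ^ Suc k" for k v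
    by (subst exp_of_nat_mult[symmetric]) (simp add: algebra_simps)
  thus "moment 0 (saddle_point \<theta> n) = real n" using * by (simp add: moment_def sums_iff)
qed

text \<open>For v \<ge> a the mean is at most gen (exp (-a)), a constant that n eventually
  exceeds.\<close>

lemma saddle_point_lim: "filterlim (saddle_point \<theta>) (at_right 0) sequentially"
proof (rule tendsto_imp_filterlim_at_right)
  show pos: "\<forall>\<^sub>F n in sequentially. saddle_point \<theta> n > 0"
    by (rule eventually_sequentiallyI[of 1]) (rule saddle_point)
  show "saddle_point \<theta> \<longlonglongrightarrow> 0"
  proof (rule order_tendstoI)
    fix a :: real assume "a < 0"
    show "\<forall>\<^sub>F n in sequentially. a < saddle_point \<theta> n"
      using pos by eventually_elim (use \<open>a < 0\<close> in auto)
  next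
    fix a :: real assume a: "0 < a"
    have "\<forall>\<^sub>F n in sequentially. real n > gen (exp (- a))"
      using filterlim_real_sequentially by (simp add: filterlim_at_top_dense)
    thus "\<forall>\<^sub>F n in sequentially. saddle_point \<theta> n < a"
      using eventually_ge_at_top[of 1]
    proof eventually_elim
      case (elim n)
      note s = saddle_point[OF elim(2)]
      show ?case
      proof (rule ccontr)
        assume "\<not> saddle_point \<theta> n < a"
        hence "exp (- saddle_point \<theta> n) \<le> exp (- a)" "exp (- a) < 1" using a by auto
        hence "gen (exp (- saddle_point \<theta> n)) \<le> gen (exp (- a))"
          using gen_strict_mono[of "exp (- saddle_point \<theta> n)" "exp (- a)"]
          by (cases "exp (- saddle_point \<theta> n) = exp (- a)") (auto simp: less_le)
        thus False using elim s by (simp add: moment_0_eq_gen)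
      qed
    qed
  qed
qed

lemma ell_eq_level: "ell \<alpha> \<theta> n = level (saddle_point \<theta> n)"
  by (simp add: ell_def level_def nstar_def)

text \<open>n v is at least of order v^(-\<alpha>), while the level is only logarithmic. So any
  fixed number of lengths of order level v / v fits into n.\<close>

lemma size_times_saddle:
  "filterlim (\<lambda>n. real n * saddle_point \<theta> n - C * level (saddle_point \<theta> n)) at_top sequentially"
proof -
  obtain c where c: "c > 0" "\<forall>\<^sub>F v in at_right 0. c * v powr (- \<alpha> - 1) \<le> moment 0 v"
    using moment_0_lower by blast
  have "filterlim (\<lambda>v. c * v powr (- \<alpha> - 1) * v - C * level v) at_top (at_right 0)"
    unfolding level_def using c \<alpha> by real_asymp
  hence lim: "filterlim (\<lambda>n. c * saddle_point \<theta> n powr (- \<alpha> - 1) * saddle_point \<theta> n - C * level (saddle_point \<theta> n)) at_top sequentially"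
    by (rule filterlim_compose[OF _ saddle_point_lim])
  have "\<forall>\<^sub>F n in sequentially. c * saddle_point \<theta> n powr (- \<alpha> - 1) \<le> moment 0 (saddle_point \<theta> n)"
    using c(2) saddle_point_lim unfolding filterlim_iff by blast
  hence "\<forall>\<^sub>F n in sequentially. c * saddle_point \<theta> n powr (- \<alpha> - 1) * saddle_point \<theta> n - C * level (saddle_point \<theta> n)
     \<le> real n * saddle_point \<theta> n - C * level (saddle_point \<theta> n)"
    using eventually_ge_at_top[of 1]
  proof eventually_elim
    case (elim n)
    thus ?case using saddle_point[of n] by (simp add: mult_right_mono)
  qed
  with lim show ?thesis by (rule filterlim_at_top_mono)
qed

end

section \<open>Quantile coupling with exponential variables\<close>

text \<open>The factor exp(y) cancels the density exp(-y) on y \<ge> 0 and leaves Lebesgue measure,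
  which is invariant under the shift; the absent half-line causes the inequality.\<close>

lemma nn_integral_exponential_shift_le:
  assumes [measurable]: "A \<in> sets borel"
  shows "(\<integral>\<^sup>+y. indicator A (s + y) * ennreal (exp y) \<partial>density lborel (exponential_density 1)) \<le> emeasure lborel A"
proof -
  have "(\<integral>\<^sup>+y. indicator A (s + y) * ennreal (exp y) \<partial>density lborel (exponential_density 1))
      = (\<integral>\<^sup>+y. ennreal (exponential_density 1 y) * (indicator A (s + y) * ennreal (exp y)) \<partial>lborel)"
    by (subst nn_integral_density) (auto simp: exponential_density_nonneg)
  also have "\<dots> \<le> (\<integral>\<^sup>+y. indicator A (s + 1 * y) \<partial>lborel)"
  proof (rule nn_integral_mono)
    fix y :: real
    have "ennreal (exponential_density 1 y) * ennreal (exp y) = ennreal (exponential_density 1 y * exp y)"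
      by (subst ennreal_mult) (auto simp: exponential_density_nonneg)
    also have "\<dots> \<le> 1" by (auto simp: exponential_density_def exp_minus)
    finally show "ennreal (exponential_density 1 y) * (indicator A (s + y) * ennreal (exp y)) \<le> indicator A (s + 1 * y)"
      by (auto simp: indicator_def)
  qed
  also have "\<dots> = (\<integral>\<^sup>+y. indicator A y \<partial>lborel)"
    by (subst (2) nn_integral_real_affine[of _ 1 s]) auto
  also have "\<dots> = emeasure lborel A" by simp
  finally show ?thesis .
qed

text \<open>The partial sums have joint density exp(-s_K) on 0 < s_1 < ... < s_K. The weight
  exp(s_K) turns their law into Lebesgue measure on that region, which a product of sets dominates.
  Integrating out the last coordinate gives the induction step.\<close>

lemma nn_integral_PiM_exponential_le:
  fixes K :: nat
  assumes [measurable]: "\<And>i. A i \<in> sets (borel :: real measure)"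
  shows "(\<integral>\<^sup>+x. (\<Prod>i=1..K. indicator (A i) (\<Sum>j=1..i. x j)) * ennreal (exp (\<Sum>j=1..K. x j))
            \<partial>Pi\<^sub>M {1..K} (\<lambda>_. density lborel (exponential_density 1)))
       \<le> (\<Prod>i=1..K. emeasure lborel (A i))"
proof (induction K)
  case 0
  show ?case by (simp add: PiM_empty nn_integral_count_space_finite)
next
  case (Suc K)
  let ?D = "density lborel (exponential_density 1)"
  interpret product_sigma_finite "\<lambda>_::nat. density lborel (exponential_density 1)"
    by (intro product_sigma_finite.intro prob_space_imp_sigma_finite prob_space_exponential_density) simp
  let ?f = "\<lambda>K x. (\<Prod>i=1..K. indicator (A i) (\<Sum>j=1..i. x j)) * ennreal (exp (\<Sum>j=1..K. x j))"
  have set_eq: "{1..Suc K} = insert (Suc K) {1..K}" by auto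
  have comp: "(\<lambda>x. x j) \<in> borel_measurable (Pi\<^sub>M {1..K'} (\<lambda>_. ?D))" if "j \<in> {1..K'}" for j K'
  proof -
    have "(\<lambda>x. x j) \<in> measurable (Pi\<^sub>M {1..K'} (\<lambda>_. ?D)) ?D"
      using that by (rule measurable_component_singleton)
    thus ?thesis by (subst (asm) measurable_cong_sets[OF refl, of _ borel]) auto
  qed
  have meas_sum: "(\<lambda>x. \<Sum>j=1..i. x j) \<in> borel_measurable (Pi\<^sub>M {1..K'} (\<lambda>_. ?D))" if "i \<le> K'" for i K' :: nat
    using that by (intro borel_measurable_sum comp) auto
  have meas: "?f K' \<in> borel_measurable (Pi\<^sub>M {1..K'} (\<lambda>_. ?D))" for K'
  proof -
    have "(\<lambda>x. indicator (A i) (\<Sum>j=1..i. x j) :: ennreal) \<in> borel_measurable (Pi\<^sub>M {1..K'} (\<lambda>_. ?D))" if "i \<in> {1..K'}" for i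
      using measurable_compose[OF meas_sum[of i K'], of "indicator (A i)" borel] that by simp
    moreover have "(\<lambda>x. ennreal (exp (\<Sum>j=1..K'. x j))) \<in> borel_measurable (Pi\<^sub>M {1..K'} (\<lambda>_. ?D))"
      using measurable_compose[OF meas_sum[of K' K'], of "\<lambda>s. ennreal (exp s)" borel] by simp
    ultimately show ?thesis
      by (intro borel_measurable_times_ennreal borel_measurable_prod_ennreal) auto
  qed
  have "(\<integral>\<^sup>+x. ?f (Suc K) x \<partial>Pi\<^sub>M {1..Suc K} (\<lambda>_. ?D)) =
     (\<integral>\<^sup>+x. (\<integral>\<^sup>+y. ?f (Suc K) (x(Suc K := y)) \<partial>?D) \<partial>Pi\<^sub>M {1..K} (\<lambda>_. ?D))"
    using meas[of "Suc K"] unfolding set_eq by (intro product_nn_integral_insert) auto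
  also have "\<dots> \<le> (\<integral>\<^sup>+x. ?f K x * emeasure lborel (A (Suc K)) \<partial>Pi\<^sub>M {1..K} (\<lambda>_. ?D))"
  proof (rule nn_integral_mono)
    fix x :: "nat \<Rightarrow> real"
    let ?s = "\<Sum>j=1..K. x j"
    have upd: "(\<Sum>j=1..i. (x(Suc K := y)) j) = (\<Sum>j=1..i. x j)" if "i \<le> K" for i y
      using that by (intro sum.cong) auto
    have "?f (Suc K) (x(Suc K := y)) = ?f K x * (indicator (A (Suc K)) (?s + y) * ennreal (exp y))" for y
    proof -
      have "(\<Prod>i=1..K. indicator (A i) (\<Sum>j=1..i. (x(Suc K := y)) j)) = (\<Prod>i=1..K. indicator (A i) (\<Sum>j=1..i. x j) :: ennreal)"
        using upd by (intro prod.cong) auto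
      thus ?thesis using upd[of K y] by (simp add: exp_add ennreal_mult mult_ac)
    qed
    hence "(\<integral>\<^sup>+y. ?f (Suc K) (x(Suc K := y)) \<partial>?D) = ?f K x * (\<integral>\<^sup>+y. indicator (A (Suc K)) (?s + y) * ennreal (exp y) \<partial>?D)"
      by (simp only:) (subst nn_integral_cmult, auto)
    also have "\<dots> \<le> ?f K x * emeasure lborel (A (Suc K))"
      by (intro mult_left_mono nn_integral_exponential_shift_le) auto
    finally show "(\<integral>\<^sup>+y. ?f (Suc K) (x(Suc K := y)) \<partial>?D) \<le> ?f K x * emeasure lborel (A (Suc K))" .
  qed
  also have "\<dots> = (\<integral>\<^sup>+x. ?f K x \<partial>Pi\<^sub>M {1..K} (\<lambda>_. ?D)) * emeasure lborel (A (Suc K))"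
    by (rule nn_integral_multc[OF meas])
  also have "\<dots> \<le> (\<Prod>i=1..K. emeasure lborel (A i)) * emeasure lborel (A (Suc K))"
    by (intro mult_right_mono Suc.IH) auto
  finally show ?case by (simp add: mult.commute)
qed

lemma nn_integral_exponential_sums_le:
  fixes E :: "nat \<Rightarrow> 'b \<Rightarrow> real"
  assumes "prob_space N" "K \<ge> 1"
    and indep: "prob_space.indep_vars N (\<lambda>_. borel) E {1..K}"
    and distr: "\<And>j. j \<in> {1..K} \<Longrightarrow> distributed N lborel (E j) (exponential_density 1)"
    and A[measurable]: "\<And>i. A i \<in> sets borel"
  shows "(\<integral>\<^sup>+\<omega>. (\<Prod>i=1..K. indicator (A i) (\<Sum>j=1..i. E j \<omega>)) * ennreal (exp (\<Sum>j=1..K. E j \<omega>)) \<partial>N)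
       \<le> (\<Prod>i=1..K. emeasure lborel (A i))"
proof -
  interpret prob_space N by fact
  let ?D = "density lborel (exponential_density 1)"
  let ?f = "\<lambda>x. (\<Prod>i=1..K. indicator (A i) (\<Sum>j=1..i. x j)) * ennreal (exp (\<Sum>j=1..K. x j))"
  have rv: "E i \<in> borel_measurable N" if "i \<in> {1..K}" for i
    using distr[OF that] distributed_measurable by fastforce
  have "distr N (\<Pi>\<^sub>M i\<in>{1..K}. borel) (\<lambda>\<omega>. \<lambda>i\<in>{1..K}. E i \<omega>) = (\<Pi>\<^sub>M i\<in>{1..K}. distr N borel (E i))"
    using indep_vars_iff_distr_eq_PiM'[where I = "{1..K}" and X = E and M' = "\<lambda>_. borel"] indep rv \<open>K \<ge> 1\<close> by auto
  also have "\<dots> = (\<Pi>\<^sub>M i\<in>{1..K}. ?D)"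
  proof (rule PiM_cong)
    fix i assume i: "i \<in> {1..K}"
    have "distr N borel (E i) = distr N lborel (E i)" by (rule distr_cong) auto
    thus "distr N borel (E i) = ?D" using distributed_distr_eq_density[OF distr[OF i]] by simp
  qed simp
  finally have D: "distr N (\<Pi>\<^sub>M i\<in>{1..K}. borel) (\<lambda>\<omega>. \<lambda>i\<in>{1..K}. E i \<omega>) = (\<Pi>\<^sub>M i\<in>{1..K}. ?D)" .
  have m1: "(\<lambda>\<omega>. \<lambda>i\<in>{1..K}. E i \<omega>) \<in> measurable N (\<Pi>\<^sub>M i\<in>{1..K}. borel)"
    using rv by (intro measurable_restrict) auto
  have meas_sum: "(\<lambda>x. \<Sum>j=1..i. x j) \<in> borel_measurable (Pi\<^sub>M {1..K} (\<lambda>_. borel :: real measure))" if "i \<le> K" for i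
    using that by (intro borel_measurable_sum measurable_component_singleton) auto
  have m2: "?f \<in> borel_measurable (\<Pi>\<^sub>M i\<in>{1..K}. borel)"
  proof -
    have "(\<lambda>x. indicator (A i) (\<Sum>j=1..i. x j) :: ennreal) \<in> borel_measurable (Pi\<^sub>M {1..K} (\<lambda>_. borel))" if "i \<in> {1..K}" for i
      using measurable_compose[OF meas_sum[of i], of "indicator (A i)" borel] that by simp
    moreover have "(\<lambda>x. ennreal (exp (\<Sum>j=1..K. x j))) \<in> borel_measurable (Pi\<^sub>M {1..K} (\<lambda>_. borel))"
      using measurable_compose[OF meas_sum[of K], of "\<lambda>s. ennreal (exp s)" borel] by simp
    ultimately show ?thesis
      by (intro borel_measurable_times_ennreal borel_measurable_prod_ennreal) auto
  qed
  have "(\<integral>\<^sup>+\<omega>. ?f (\<lambda>i\<in>{1..K}. E i \<omega>) \<partial>N) = (\<integral>\<^sup>+x. ?f x \<partial>Pi\<^sub>M {1..K} (\<lambda>_. ?D))"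
    unfolding D[symmetric] by (subst nn_integral_distr[OF m1]) (use m2 in auto)
  also have "\<dots> \<le> (\<Prod>i=1..K. emeasure lborel (A i))" by (rule nn_integral_PiM_exponential_le) simp
  also have "(\<integral>\<^sup>+\<omega>. ?f (\<lambda>i\<in>{1..K}. E i \<omega>) \<partial>N) = (\<integral>\<^sup>+\<omega>. ?f (\<lambda>i. E i \<omega>) \<partial>N)"
  proof (rule nn_integral_cong)
    fix \<omega>
    have "(\<Sum>j=1..i. (\<lambda>i\<in>{1..K}. E i \<omega>) j) = (\<Sum>j=1..i. E j \<omega>)" if "i \<le> K" for i
      using that by (intro sum.cong) auto
    thus "?f (\<lambda>i\<in>{1..K}. E i \<omega>) = ?f (\<lambda>i. E i \<omega>)" by simp
  qed
  finally show ?thesis .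
qed

lemma exponential_AE_pos:
  assumes "distributed N lborel X (exponential_density 1)"
  shows "AE \<omega> in N. X \<omega> > 0"
proof -
  have "AE x in lborel. (0 :: real) \<noteq> x" by (rule AE_lborel_singleton[of 0, THEN AE_mp]) auto
  hence "AE x in density lborel (exponential_density 1). x > 0"
    by (subst AE_density) (auto simp: exponential_density_def elim!: eventually_mono)
  hence "AE x in distr N lborel X. x > 0"
    by (simp only: distributed_distr_eq_density[OF assms])
  thus ?thesis by (subst (asm) AE_distr_iff) (use assms in \<open>auto simp: distributed_def\<close>)
qed

text \<open>Only the sign of this constant matters: it cancels in the quotient of two local limits,
  and being positive it makes the normalization positive for large n.\<close>

lemma integral_exp_gaussian_pos: "(LINT x|lborel. exp (- (x\<^sup>2) / 2)) > (0::real)"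
proof -
  have "(LINT x|lborel. std_normal_density x) = 1"
    by simp
  hence "(LINT x|lborel. exp (- (x\<^sup>2) / 2)) = sqrt (2 * pi)"
    unfolding std_normal_density_def by (simp add: field_simps)
  thus ?thesis by simp
qed

section \<open>Quantiles of the tail sums\<close>

context polynomial_weights
begin

text \<open>For s > 0 and 0 < v \<le> 1 this is the largest k \<ge> 1 with s \<le> tail v k, or 0 if
  there is none: the tail sums decrease, so the set is an initial segment and its cardinality is its
  maximum.\<close>

definition kappa :: "real \<Rightarrow> real \<Rightarrow> nat" where
  "kappa v s = card {k. k \<ge> 1 \<and> s \<le> tail v k}"

lemma le_kappa_iff:
  assumes v: "0 < v" "v \<le> 1" and s: "s > 0" and k: "k \<ge> 1"
  shows "k \<le> kappa v s \<longleftrightarrow> s \<le> tail v k"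
proof -
  let ?A = "{k. k \<ge> 1 \<and> s \<le> tail v k}"
  have "\<forall>\<^sub>F k in sequentially. tail v k < s" using order_tendstoD(2)[OF tail_tendsto_0[OF v] s] .
  then obtain k0 where k0: "\<And>k. k \<ge> k0 \<Longrightarrow> tail v k < s" unfolding eventually_sequentially by blast
  have "?A \<subseteq> {..k0}"
  proof
    fix k assume "k \<in> ?A"
    thus "k \<in> {..k0}" using k0[of k] by (cases "k \<ge> k0") auto
  qed
  hence fin: "finite ?A" by (rule finite_subset) simp
  show ?thesis
  proof
    assume "s \<le> tail v k"
    hence "{1..k} \<subseteq> ?A" using tail_antimono[OF v] by (auto intro: order_trans)
    from card_mono[OF fin this] show "k \<le> kappa v s" by (simp add: kappa_def)
  next
    assume le: "k \<le> kappa v s"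
    show "s \<le> tail v k"
    proof (rule ccontr)
      assume "\<not> s \<le> tail v k"
      have "?A \<subseteq> {1..<k}"
      proof
        fix j assume j: "j \<in> ?A"
        show "j \<in> {1..<k}"
        proof (rule ccontr)
          assume "j \<notin> {1..<k}"
          hence "tail v j \<le> tail v k" using tail_antimono[OF v k, of j] j by auto
          thus False using j \<open>\<not> s \<le> tail v k\<close> by auto
        qed
      qed
      from card_mono[OF _ this] show False using le k by (simp add: kappa_def)
    qed
  qed
qed

text \<open>The interval has length wt v k, so the weight of a k-cycle becomes the Lebesgue measure
  of the set of s with quantile k.\<close>

lemma kappa_eq_iff:
  assumes v: "0 < v" "v \<le> 1" and s: "s > 0" and k: "k \<ge> 1"
  shows "kappa v s = k \<longleftrightarrow> s \<in> {tail v (Suc k)<..tail v k}"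
  using le_kappa_iff[OF assms] le_kappa_iff[OF v s, of "Suc k"] by auto

lemma cut_ge_1: "\<forall>\<^sub>F v in at_right 0. cut x v \<ge> 1"
  using filterlim_at_top[THEN iffD1, OF cut_nat_at_top[of x]] by blast

lemma cut_le_kappa:
  assumes "s > 0" "exp (- x) > s"
  shows "\<forall>\<^sub>F v in at_right 0. cut x v \<le> kappa v s"
  using order_tendstoD(1)[OF tail_lim assms(2)] cut_ge_1[of x] small_positive
  by eventually_elim (use assms in \<open>auto simp: le_kappa_iff\<close>)

lemma kappa_less_cut:
  assumes "s > 0" "exp (- x) < s"
  shows "\<forall>\<^sub>F v in at_right 0. kappa v s < cut x v"
  using order_tendstoD(2)[OF tail_lim assms(2)] cut_ge_1[of x] small_positive
  by eventually_elim (use assms in \<open>auto simp: le_kappa_iff not_le[symmetric]\<close>)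

text \<open>The tail sum at position x tends to exp(-x), which equals s at x = - ln s. This is the
  origin of the logarithm in the limit law.\<close>

lemma kappa_lim:
  assumes s: "s > 0"
  shows "((\<lambda>v. real (kappa v s) * v - level v) \<longlongrightarrow> - ln s) (at_right 0)"
proof (rule order_tendstoI)
  fix l assume "l < - ln s"
  then obtain x where x: "l < x" "x < - ln s" using dense by blast
  have "exp (- x) > s" using x s by (subst exp_ln[OF s, symmetric], subst exp_less_cancel_iff) simp
  from cut_le_kappa[OF s this] cut_bounds[of x] small_positive
  show "\<forall>\<^sub>F v in at_right 0. l < real (kappa v s) * v - level v"
  proof eventually_elim
    case (elim v)
    hence "real (cut x v) * v \<le> real (kappa v s) * v" by (intro mult_right_mono) auto
    thus ?case using elim x by linarith
  qed
next
  fix l assume "l > - ln s"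
  then obtain x where x: "x < l" "- ln s < x" using dense by blast
  have "exp (- x) < s" using x s by (subst exp_ln[OF s, symmetric], subst exp_less_cancel_iff) simp
  from kappa_less_cut[OF s this] order_tendstoD(2)[OF cut_lim x(1)] small_positive
  show "\<forall>\<^sub>F v in at_right 0. real (kappa v s) * v - level v < l"
  proof eventually_elim
    case (elim v)
    hence "real (kappa v s) * v \<le> real (cut x v) * v" by (intro mult_right_mono) auto
    thus ?case using elim x by linarith
  qed
qed

text \<open>The tail sum at its own quantile is at least s. From above, the quantile lies at or
  beyond cut x v whenever exp(-x) > s, so the tail sum there is eventually below anything larger
  than s.\<close>

lemma tail_kappa_lim:
  assumes s: "s > 0"
  shows "((\<lambda>v. tail v (kappa v s)) \<longlongrightarrow> s) (at_right 0)"
proof (rule order_tendstoI)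
  fix l assume l: "l < s"
  have "exp (- (- ln s - 1)) > s" using s by (simp add: exp_add)
  from cut_le_kappa[OF s this] cut_ge_1[of "- ln s - 1"] small_positive
  show "\<forall>\<^sub>F v in at_right 0. l < tail v (kappa v s)"
  proof eventually_elim
    case (elim v)
    hence "s \<le> tail v (kappa v s)" using le_kappa_iff[of v s "kappa v s"] s by auto
    thus ?case using l by linarith
  qed
next
  fix l assume l: "l > s"
  then obtain y where y: "s < y" "y < l" using dense by blast
  define x where "x = - ln y"
  have x: "exp (- x) = y" using y s by (simp add: x_def)
  from cut_le_kappa[OF s, of x] cut_ge_1[of x] small_positive order_tendstoD(2)[OF tail_lim[of x], of l] x y
  have "\<forall>\<^sub>F v in at_right 0. cut x v \<le> kappa v s \<and> 1 \<le> cut x v \<and> (0 < v \<and> v \<le> 1) \<and> tail v (cut x v) < l"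
    by (simp add: eventually_conj_iff)
  thus "\<forall>\<^sub>F v in at_right 0. tail v (kappa v s) < l"
    by eventually_elim (auto intro: le_less_trans[OF tail_antimono])
qed

section \<open>The coefficient ratio along quantiles\<close>

abbreviation sp :: "nat \<Rightarrow> real" where "sp \<equiv> saddle_point \<theta>"

definition coeff_ratio :: "nat \<Rightarrow> nat list \<Rightarrow> real" where
  "coeff_ratio n ks = exp_coeff (\<lambda>k. if k < last ks then wt (sp n) k else 0) (n - sum_list ks) / exp_coeff (wt (sp n)) n"

definition kappas :: "nat \<Rightarrow> nat \<Rightarrow> (nat \<Rightarrow> real) \<Rightarrow> nat list" where
  "kappas K n s = map (\<lambda>i. kappa (sp n) (s i)) [1..<Suc K]"

lemma sp_good: "\<forall>\<^sub>F n in sequentially. 0 < sp n \<and> sp n \<le> 1 \<and> moment 0 (sp n) = real n"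
proof -
  have "\<forall>\<^sub>F n in sequentially. 0 < sp n \<and> sp n \<le> 1"
    using small_positive saddle_point_lim unfolding filterlim_iff by blast
  thus ?thesis using eventually_ge_at_top[of 1] by eventually_elim (auto simp: saddle_point)
qed

lemma sp_compose: "\<forall>\<^sub>F v in at_right 0. P v \<Longrightarrow> \<forall>\<^sub>F n in sequentially. P (sp n)"
  using saddle_point_lim unfolding filterlim_iff by blast

lemma size_large: "\<forall>\<^sub>F n in sequentially. C * level (sp n) + x < real n * sp n"
proof -
  have "\<forall>\<^sub>F n in sequentially. x < real n * sp n - C * level (sp n)"
    using filterlim_at_top_dense[THEN iffD1, OF size_times_saddle[of C]] by blast
  thus ?thesis by eventually_elim simp
qed

text \<open>Weights beyond n do not enter the coefficient of z^n. Truncation at n + 1 therefore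
  changes nothing and brings the coefficient under the local limit theorem.\<close>

lemma denominator_lim:
  "(\<lambda>n. scale (sp n) * exp (- (\<Sum>k=1..<Suc n. wt (sp n) k)) * exp_coeff (wt (sp n)) n)
      \<longlonglongrightarrow> (LINT x|lborel. exp (- (x\<^sup>2) / 2)) / (2 * pi)"
proof -
  have b: "\<forall>\<^sub>F n in sequentially. level (sp n) - 0 \<le> real (Suc n) * sp n"
  proof -
    show ?thesis using size_large[of 1 0] sp_good by eventually_elim (auto simp: algebra_simps)
  qed
  have "(\<lambda>n. scale (sp n) * exp (- (\<Sum>k=1..<Suc n. wt (sp n) k)) *
            exp_coeff (\<lambda>k. if k < Suc n then wt (sp n) k else 0) n)
      \<longlonglongrightarrow> (LINT x|lborel. exp (- (x\<^sup>2) / 2)) / (2 * pi)"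
    using sp_good by (intro local_limit_exp_coeff_wt[OF saddle_point_lim _ b]) (auto elim: eventually_mono)
  moreover have "exp_coeff (\<lambda>k. if k < Suc n then wt v k else 0) n = exp_coeff (wt v) n" for n v
    by (rule exp_coeff_cong) auto
  ultimately show ?thesis by simp
qed

text \<open>The local limit is positive, so the tilted coefficient eventually is, and with it the
  untilted one, which is the normalization of the measure.\<close>

lemma exp_coeff_pos: "\<forall>\<^sub>F n in sequentially. exp_coeff (wt (sp n)) n > 0 \<and> exp_coeff (\<lambda>k. \<theta> k / real k) n > 0"
proof -
  have "\<forall>\<^sub>F n in sequentially. 0 < scale (sp n) * exp (- (\<Sum>k=1..<Suc n. wt (sp n) k)) * exp_coeff (wt (sp n)) n"
    using integral_exp_gaussian_pos by (intro order_tendstoD(1)[OF denominator_lim]) simp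
  moreover have "\<forall>\<^sub>F v in at_right 0. scale v > 0" using scale_at_top by (simp add: filterlim_at_top_dense)
  hence "\<forall>\<^sub>F n in sequentially. scale (sp n) > 0" by (rule sp_compose)
  ultimately show ?thesis
  proof eventually_elim
    case (elim n)
    have "scale (sp n) * exp (- (\<Sum>k=1..<Suc n. wt (sp n) k)) > 0" using elim by simp
    with elim have 1: "exp_coeff (wt (sp n)) n > 0" using zero_less_mult_pos by blast
    have "exp_coeff (wt (sp n)) n = exp (- sp n) ^ n * exp_coeff (\<lambda>k. \<theta> k / real k) n"
      unfolding wt_def[abs_def] by (rule exp_coeff_tilt)
    thus ?case using 1 by (simp add: zero_less_mult_iff)
  qed
qed

text \<open>For each x, n is eventually beyond cut x, where the tail sum tends to exp(-x); x is
  arbitrary.\<close>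

lemma tail_size_lim: "(\<lambda>n. tail (sp n) (Suc n)) \<longlonglongrightarrow> 0"
proof (rule order_tendstoI)
  fix l :: real assume "l < 0"
  show "\<forall>\<^sub>F n in sequentially. l < tail (sp n) (Suc n)"
    using sp_good
  proof eventually_elim
    case (elim n)
    thus ?case using tail_sum_nonneg[of "sp n" "Suc n"] \<open>l < 0\<close> by auto
  qed
next
  fix l :: real assume l: "0 < l"
  define x where "x = - ln (l / 2)"
  have x: "exp (- x) < l" using l by (simp add: x_def)
  have "\<forall>\<^sub>F n in sequentially. tail (sp n) (cut x (sp n)) < l"
    by (rule sp_compose[OF order_tendstoD(2)[OF tail_lim x]])
  thus "\<forall>\<^sub>F n in sequentially. tail (sp n) (Suc n) < l"
    using size_large[of 1 "x + 1"] sp_good sp_compose[OF cut_ge_1[of x]] sp_compose[OF cut_bounds[of x]]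
  proof eventually_elim
    case (elim n)
    have "real (cut x (sp n)) * sp n \<le> real n * sp n" using elim by linarith
    hence "cut x (sp n) \<le> n" using elim by (simp add: mult_le_cancel_right)
    hence "tail (sp n) (Suc n) \<le> tail (sp n) (cut x (sp n))" using elim by (intro tail_antimono) auto
    thus ?case using elim by linarith
  qed
qed

lemma sum_list_kappas: "sum_list (kappas K n s) = (\<Sum>i=1..K. kappa (sp n) (s i))"
  unfolding kappas_def sum_set_upt_conv_sum_list_nat[symmetric] set_upt by (rule sum.cong) auto

text \<open>Numerator and denominator have the same local limit, so the ratio is decided by their
  normalising exponentials. These differ by the total weight between the smallest leading length and
  n, a difference of two tail sums with limits s K and 0.\<close>

lemma kappas_properties:
  assumes K: "K \<ge> 1" and s: "\<And>i. i \<in> {1..K} \<Longrightarrow> s i > 0" "\<And>i j. 1 \<le> i \<Longrightarrow> i < j \<Longrightarrow> j \<le> K \<Longrightarrow> s i < s j"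
  shows "\<forall>\<^sub>F n in sequentially. kappas K n s \<in> leading_lengths K n"
    and "(\<lambda>n. coeff_ratio n (kappas K n s)) \<longlonglongrightarrow> exp (- s K)"
proof -
  define k where "k i n = kappa (sp n) (s i)" for i n
  have k_lim: "(\<lambda>n. real (k i n) * sp n - level (sp n)) \<longlonglongrightarrow> - ln (s i)" if "i \<in> {1..K}" for i
    unfolding k_def using that by (intro filterlim_compose[OF kappa_lim saddle_point_lim] s(1))
  have k_pos: "\<forall>\<^sub>F n in sequentially. k i n \<ge> 1" if i: "i \<in> {1..K}" for i
  proof -
    have "exp (- (- ln (s i) - 1)) > s i" using s(1)[OF i] by (simp add: exp_add)
    from sp_compose[OF cut_le_kappa[OF s(1)[OF i] this]] sp_compose[OF cut_ge_1[of "- ln (s i) - 1"]]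
    show ?thesis by eventually_elim (auto simp: k_def)
  qed
  have k_upper: "\<forall>\<^sub>F n in sequentially. real (k i n) * sp n \<le> level (sp n) + (1 - ln (s i))" if "i \<in> {1..K}" for i
    using order_tendstoD(2)[OF k_lim[OF that], of "1 - ln (s i)"] by simp (auto elim: eventually_mono)
  define C where "C = (\<Sum>i=1..K. 1 - ln (s i))"
  have sum_upper: "\<forall>\<^sub>F n in sequentially. real (\<Sum>i=1..K. k i n) * sp n \<le> real K * level (sp n) + C"
  proof -
    have "\<forall>\<^sub>F n in sequentially. \<forall>i\<in>{1..K}. real (k i n) * sp n \<le> level (sp n) + (1 - ln (s i))"
      using k_upper by (intro eventually_ball_finite) auto
    thus ?thesis
    proof eventually_elim
      case (elim n)
      have "real (\<Sum>i=1..K. k i n) * sp n = (\<Sum>i=1..K. real (k i n) * sp n)" by (simp add: sum_distrib_right)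
      also have "\<dots> \<le> (\<Sum>i=1..K. level (sp n) + (1 - ln (s i)))" using elim by (intro sum_mono) auto
      also have "\<dots> = real K * level (sp n) + C" by (simp add: C_def sum.distrib)
      finally show ?case .
    qed
  qed
  have sum_le: "\<forall>\<^sub>F n in sequentially. (\<Sum>i=1..K. k i n) \<le> n"
  proof -
    show ?thesis using size_large[of "real K" C] sum_upper sp_good
    proof eventually_elim
      case (elim n)
      have "real (\<Sum>i=1..K. k i n) * sp n \<le> real n * sp n" using elim by linarith
      thus ?case using elim by (simp add: mult_le_cancel_right del: of_nat_sum)
    qed
  qed
  have decr: "\<forall>\<^sub>F n in sequentially. k j n < k i n" if ij: "1 \<le> i" "i < j" "j \<le> K" for i j
  proof -
    have i: "i \<in> {1..K}" and j: "j \<in> {1..K}" using ij by auto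
    have "- ln (s j) < - ln (s i)" using s(2)[OF ij] s(1)[OF i] s(1)[OF j] by simp
    then obtain l where l: "- ln (s j) < l" "l < - ln (s i)" using dense by blast
    from order_tendstoD(2)[OF k_lim[OF j] l(1)] order_tendstoD(1)[OF k_lim[OF i] l(2)] sp_good
    show ?thesis
    proof eventually_elim
      case (elim n)
      hence "real (k j n) * sp n < real (k i n) * sp n" by linarith
      thus ?case using elim by (simp add: mult_less_cancel_right)
    qed
  qed
  have kappas: "kappas K n s = map (\<lambda>i. k i n) [1..<Suc K]" for n by (simp add: kappas_def k_def)
  have "\<forall>\<^sub>F n in sequentially. \<forall>i\<in>{1..K}. \<forall>j\<in>{1..K}. i < j \<longrightarrow> k j n < k i n"
    using decr by (intro eventually_ball_finite ballI) auto
  moreover have "\<forall>\<^sub>F n in sequentially. \<forall>i\<in>{1..K}. k i n \<ge> 1"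
    using k_pos by (intro eventually_ball_finite) auto
  ultimately show lead: "\<forall>\<^sub>F n in sequentially. kappas K n s \<in> leading_lengths K n"
    using sum_le
  proof eventually_elim
    case (elim n)
    have "sorted_wrt (>) (kappas K n s)"
      using elim(1) by (auto simp: sorted_wrt_iff_nth_less kappas simp del: upt_Suc)
    moreover have "0 \<notin> set (kappas K n s)" using elim(2) by (force simp: kappas simp del: upt_Suc)
    moreover have "sum_list (kappas K n s) \<le> n" using elim(3) by (simp add: sum_list_kappas k_def)
    ultimately show ?case by (simp add: leading_lengths_def kappas del: upt_Suc)
  qed
  have KK: "K \<in> {1..K}" using K by simp
  define N where "N n = n - (\<Sum>i=1..K. k i n)" for n
  have b: "\<forall>\<^sub>F n in sequentially. level (sp n) - (ln (s K) + 1) \<le> real (k K n) * sp n"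
    using order_tendstoD(1)[OF k_lim[OF KK], of "- ln (s K) - 1"] by simp (auto elim: eventually_mono)
  have Nlim: "(\<lambda>n. (real n - real (N n)) / scale (sp n)) \<longlonglongrightarrow> 0"
  proof (rule Lim_null_comparison)
    show "(\<lambda>n. (real K * level (sp n) + C) / sp n / scale (sp n)) \<longlonglongrightarrow> 0"
      by (rule filterlim_compose[OF log_over_scale saddle_point_lim])
    have "\<forall>\<^sub>F v in at_right 0. scale v > 0" using scale_at_top by (simp add: filterlim_at_top_dense)
    from sp_compose[OF this] sum_le sum_upper sp_good
    show "\<forall>\<^sub>F n in sequentially. norm ((real n - real (N n)) / scale (sp n)) \<le> (real K * level (sp n) + C) / sp n / scale (sp n)"
    proof eventually_elim
      case (elim n)
      have "real n - real (N n) = real (\<Sum>i=1..K. k i n)" using elim by (simp add: N_def of_nat_diff del: of_nat_sum)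
      moreover have "real (\<Sum>i=1..K. k i n) \<le> (real K * level (sp n) + C) / sp n"
        using elim by (simp add: field_simps del: of_nat_sum)
      moreover have "real (\<Sum>i=1..K. k i n) \<ge> 0" by (rule of_nat_0_le_iff)
      ultimately have "\<bar>real n - real (N n)\<bar> \<le> (real K * level (sp n) + C) / sp n" by linarith
      hence "\<bar>real n - real (N n)\<bar> / scale (sp n) \<le> (real K * level (sp n) + C) / sp n / scale (sp n)"
        using elim by (intro divide_right_mono) auto
      thus ?case using elim by (simp add: abs_divide)
    qed
  qed
  let ?L = "(LINT x|lborel. exp (- (x\<^sup>2) / 2)) / (2 * pi)"
  have num: "(\<lambda>n. scale (sp n) * exp (- (\<Sum>j=1..<k K n. wt (sp n) j)) *
            exp_coeff (\<lambda>j. if j < k K n then wt (sp n) j else 0) (N n)) \<longlonglongrightarrow> ?L"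
    using sp_good by (intro local_limit_exp_coeff_wt[OF saddle_point_lim _ b Nlim]) (auto elim: eventually_mono)
  have L: "?L > 0" using integral_exp_gaussian_pos by simp
  have "(\<lambda>n. tail (sp n) (k K n) - tail (sp n) (Suc n)) \<longlonglongrightarrow> s K - 0"
    unfolding k_def using s(1)[OF KK]
    by (intro tendsto_diff tail_size_lim filterlim_compose[OF tail_kappa_lim saddle_point_lim])
  hence ex: "(\<lambda>n. exp (- (tail (sp n) (k K n) - tail (sp n) (Suc n)))) \<longlonglongrightarrow> exp (- (s K - 0))"
    by (intro tendsto_exp tendsto_minus)
  \<comment> \<open>The last factor undoes the difference between the two normalising exponentials,
    so that the whole expression is the coefficient ratio.\<close>
  have lim: "(\<lambda>n. (scale (sp n) * exp (- (\<Sum>j=1..<k K n. wt (sp n) j)) * exp_coeff (\<lambda>j. if j < k K n then wt (sp n) j else 0) (N n))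
     / (scale (sp n) * exp (- (\<Sum>k=1..<Suc n. wt (sp n) k)) * exp_coeff (wt (sp n)) n)
     * exp (- (tail (sp n) (k K n) - tail (sp n) (Suc n)))) \<longlonglongrightarrow> ?L / ?L * exp (- (s K - 0))"
    using L by (intro tendsto_mult tendsto_divide num denominator_lim ex) auto
  have "\<forall>\<^sub>F v in at_right 0. scale v > 0" using scale_at_top by (simp add: filterlim_at_top_dense)
  from sp_compose[OF this] k_pos[OF KK] sum_le sp_good lead
  have ev: "\<forall>\<^sub>F n in sequentially. (scale (sp n) * exp (- (\<Sum>j=1..<k K n. wt (sp n) j)) * exp_coeff (\<lambda>j. if j < k K n then wt (sp n) j else 0) (N n))
     / (scale (sp n) * exp (- (\<Sum>k=1..<Suc n. wt (sp n) k)) * exp_coeff (wt (sp n)) n)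
     * exp (- (tail (sp n) (k K n) - tail (sp n) (Suc n))) = coeff_ratio n (kappas K n s)"
  proof eventually_elim
    case (elim n)
    have "k K n \<le> (\<Sum>i=1..K. k i n)" using KK by (intro member_le_sum) auto
    hence le: "k K n \<le> Suc n" using elim by linarith
    have "(\<Sum>j=1..<Suc n. wt (sp n) j) = (\<Sum>j=1..<k K n. wt (sp n) j) + (\<Sum>j=k K n..<Suc n. wt (sp n) j)"
      using elim le by (intro sum.atLeastLessThan_concat[symmetric]) auto
    also have "(\<Sum>j=k K n..<Suc n. wt (sp n) j) = tail (sp n) (k K n) - tail (sp n) (Suc n)"
      using tail_split[of "sp n" "k K n" "Suc n"] elim le by simp
    finally have e: "exp (- (\<Sum>j=1..<Suc n. wt (sp n) j)) = exp (- (\<Sum>j=1..<k K n. wt (sp n) j)) * exp (- (tail (sp n) (k K n) - tail (sp n) (Suc n)))"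
      by (simp flip: exp_add)
    have "last (kappas K n s) = k K n" using K by (simp add: kappas last_map)
    moreover have "n - sum_list (kappas K n s) = N n" by (simp add: N_def sum_list_kappas k_def)
    ultimately have "coeff_ratio n (kappas K n s) = exp_coeff (\<lambda>j. if j < k K n then wt (sp n) j else 0) (N n) / exp_coeff (wt (sp n)) n"
      by (simp add: coeff_ratio_def)
    thus ?case unfolding e using elim by (simp add: field_simps)
  qed
  have eq: "?L / ?L * exp (- (s K - 0)) = exp (- s K)"
    by (simp only: divide_self[OF less_imp_neq[OF L, symmetric]] diff_zero mult_1)
  show "(\<lambda>n. coeff_ratio n (kappas K n s)) \<longlonglongrightarrow> exp (- s K)"
    using Lim_transform_eventually[OF lim ev] unfolding eq .
qed

end

section \<open>Convergence in distribution\<close>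

lemma prod_list_map_nth:
  "prod_list (map w ks) = (\<Prod>i=1..length ks. w (ks ! (i - 1)) :: real)"
proof (induction ks rule: rev_induct)
  case (snoc x xs)
  have "(\<Prod>i=1..length xs. w ((xs @ [x]) ! (i - 1))) = (\<Prod>i=1..length xs. w (xs ! (i - 1)))"
    by (intro prod.cong) (auto simp: nth_append)
  thus ?case using snoc by simp
qed simp

lemma tendsto_fun_iff:
  fixes f :: "'a \<Rightarrow> 'i \<Rightarrow> 'b :: topological_space"
  shows "(f \<longlongrightarrow> l) F \<longleftrightarrow> (\<forall>i. ((\<lambda>x. f x i) \<longlongrightarrow> l i) F)"
proof -
  have "(f \<longlongrightarrow> l) F \<longleftrightarrow> limitin (product_topology (\<lambda>i. euclidean) UNIV) f l F"
    unfolding euclidean_product_topology by simp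
  also have "\<dots> \<longleftrightarrow> (\<forall>i. ((\<lambda>x. f x i) \<longlongrightarrow> l i) F)"
    by (auto simp: limitin_componentwise)
  finally show ?thesis .
qed

context polynomial_weights
begin

text \<open>Coordinates outside 1..K are 0, so that values live in the type of all functions with
  its product topology, where continuity and Borel measurability are at hand.\<close>

definition rescaled :: "nat \<Rightarrow> nat \<Rightarrow> (nat \<Rightarrow> nat) \<Rightarrow> nat \<Rightarrow> real" where
  "rescaled K n x = (\<lambda>i. if i \<in> {1..K} then real (x i) * sp n - level (sp n) else 0)"

text \<open>The term of a list ks is spread over the event that each S_i falls into the quantile
  interval of the i-th entry, with weight exp(S_K). Integration gives at most the original term, so
  the integral of \<open>Z n\<close> stays below the expectation, while at a fixed outcome only the
  list of quantiles survives.\<close>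

lemma expectation_eventually_greater:
  fixes N :: "'b measure" and E :: "nat \<Rightarrow> 'b \<Rightarrow> real" and h :: "(nat \<Rightarrow> real) \<Rightarrow> real"
  assumes K: "K \<ge> 1" and N: "prob_space N"
    and indep: "prob_space.indep_vars N (\<lambda>_. borel) E {1..K}"
    and distr: "\<And>j. j \<in> {1..K} \<Longrightarrow> distributed N lborel (E j) (exponential_density 1)"
    and h: "continuous_on UNIV h" "\<And>x. h x \<ge> 0" "\<And>x. h x \<le> B"
  defines "Y \<equiv> \<lambda>\<omega> i. if i \<in> {1..K} then - ln (\<Sum>j=1..i. E j \<omega>) else 0"
  assumes c: "c < (\<integral>\<omega>. h (Y \<omega>) \<partial>N)"
  shows "\<forall>\<^sub>F n in sequentially. c < (\<integral>\<sigma>. h (rescaled K n (\<lambda>i. longest_cycle n i \<sigma>)) \<partial>weighted_measure \<theta> n)"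
proof -
  interpret prob_space N by fact
  define S where "S i \<omega> = (\<Sum>j=1..i. E j \<omega>)" for i \<omega>
  have E_meas: "E j \<in> borel_measurable N" if "j \<in> {1..K}" for j
    using distr[OF that] distributed_measurable by fastforce
  have S_meas: "S i \<in> borel_measurable N" if "i \<in> {1..K}" for i
    unfolding S_def using that by (intro borel_measurable_sum E_meas) auto
  define J where "J n k = {tail (sp n) (Suc k)<..tail (sp n) k}" for n k
  define G where "G n ks \<omega> = (\<Prod>i=1..K. indicator (J n (ks ! (i - 1))) (S i \<omega>)) * ennreal (exp (S K \<omega>))" for n ks \<omega>
  define a where "a n ks = h (rescaled K n (\<lambda>i. ks ! (i - 1))) * coeff_ratio n ks" for n ks
  define Z where "Z n \<omega> = (\<Sum>ks\<in>leading_lengths K n. ennreal (a n ks) * G n ks \<omega>)" for n \<omega>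
  define A where "A n = (\<integral>\<sigma>. h (rescaled K n (\<lambda>i. longest_cycle n i \<sigma>)) \<partial>weighted_measure \<theta> n)" for n
  have a_nonneg: "a n ks \<ge> 0" for n ks
    unfolding a_def coeff_ratio_def
    by (intro mult_nonneg_nonneg h divide_nonneg_nonneg exp_coeff_nonneg) (auto intro: wt_nonneg)
  have G_meas: "G n ks \<in> borel_measurable N" for n ks
  proof -
    have "(\<lambda>\<omega>. indicator (J n k) (S i \<omega>) :: ennreal) \<in> borel_measurable N" if "i \<in> {1..K}" for i k
      using measurable_compose[OF S_meas[OF that], of "indicator (J n k)" borel] by (simp add: J_def)
    moreover have "(\<lambda>\<omega>. ennreal (exp (S K \<omega>))) \<in> borel_measurable N"
      using measurable_compose[OF S_meas[of K], of "\<lambda>s. ennreal (exp s)" borel] K by simp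
    ultimately show ?thesis unfolding G_def
      by (intro borel_measurable_times_ennreal borel_measurable_prod_ennreal) auto
  qed
  have Z_meas: "Z n \<in> borel_measurable N" for n
    unfolding Z_def using G_meas by measurable
  have Z_le: "\<forall>\<^sub>F n in sequentially. (\<integral>\<^sup>+\<omega>. Z n \<omega> \<partial>N) \<le> ennreal (A n)"
    using sp_good
  proof eventually_elim
    case (elim n)
    have "(\<integral>\<^sup>+\<omega>. Z n \<omega> \<partial>N) = (\<Sum>ks\<in>leading_lengths K n. ennreal (a n ks) * (\<integral>\<^sup>+\<omega>. G n ks \<omega> \<partial>N))"
      unfolding Z_def using G_meas by (simp add: nn_integral_sum nn_integral_cmult)
    also have "\<dots> \<le> (\<Sum>ks\<in>leading_lengths K n. ennreal (a n ks * prod_list (map (wt (sp n)) ks)))"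
    proof (rule sum_mono)
      fix ks assume ks: "ks \<in> leading_lengths K n"
      have pos: "ks ! (i - 1) \<ge> 1" if "i \<in> {1..K}" for i
      proof -
        have "ks ! (i - 1) \<in> set ks" using ks that by (auto simp: leading_lengths_def)
        moreover have "0 \<notin> set ks" using ks by (simp add: leading_lengths_def)
        ultimately have "ks ! (i - 1) \<noteq> 0" by metis
        thus ?thesis by simp
      qed
      have "(\<integral>\<^sup>+\<omega>. G n ks \<omega> \<partial>N) \<le> (\<Prod>i=1..K. emeasure lborel (J n (ks ! (i - 1))))"
        unfolding G_def S_def
        by (rule nn_integral_exponential_sums_le[OF N K indep distr]) (auto simp: J_def)
      also have "\<dots> = (\<Prod>i=1..K. ennreal (wt (sp n) (ks ! (i - 1))))"
      proof (rule prod.cong)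
        fix i assume i: "i \<in> {1..K}"
        have sp: "tail (sp n) (ks ! (i - 1)) = wt (sp n) (ks ! (i - 1)) + tail (sp n) (Suc (ks ! (i - 1)))"
          using tail_split[of "sp n" "ks ! (i - 1)" "Suc (ks ! (i - 1))"] pos[OF i] elim by simp
        thus "emeasure lborel (J n (ks ! (i - 1))) = ennreal (wt (sp n) (ks ! (i - 1)))"
          using wt_nonneg[OF pos[OF i]] by (simp add: J_def)
      qed simp
      also have "\<dots> = ennreal (\<Prod>i=1..K. wt (sp n) (ks ! (i - 1)))"
        using pos by (intro prod_ennreal wt_nonneg)
      also have "(\<Prod>i=1..K. wt (sp n) (ks ! (i - 1))) = prod_list (map (wt (sp n)) ks)"
        using ks by (simp add: prod_list_map_nth leading_lengths_def)
      finally have "ennreal (a n ks) * (\<integral>\<^sup>+\<omega>. G n ks \<omega> \<partial>N) \<le> ennreal (a n ks) * ennreal (prod_list (map (wt (sp n)) ks))"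
        by (intro mult_left_mono) auto
      thus "ennreal (a n ks) * (\<integral>\<^sup>+\<omega>. G n ks \<omega> \<partial>N) \<le> ennreal (a n ks * prod_list (map (wt (sp n)) ks))"
        by (simp add: ennreal_mult'[OF a_nonneg])
    qed
    also have "\<dots> = ennreal (\<Sum>ks\<in>leading_lengths K n. a n ks * prod_list (map (wt (sp n)) ks))"
    proof (intro sum_ennreal mult_nonneg_nonneg a_nonneg)
      fix ks assume "ks \<in> leading_lengths K n"
      hence "\<forall>k\<in>set ks. k \<ge> 1" by (auto simp: leading_lengths_def Suc_le_eq intro: Nat.gr0I)
      thus "0 \<le> prod_list (map (wt (sp n)) ks)" by (intro prod_list_nonneg) (auto intro: wt_nonneg)
    qed
    also have "\<dots> \<le> ennreal (A n)"
    proof (rule ennreal_leI)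
      have "(\<Sum>ks\<in>leading_lengths K n. h (rescaled K n (\<lambda>i. ks ! (i - 1))) * prod_list (map (\<lambda>k. \<theta> k / real k * exp (- sp n) ^ k) ks) *
            (exp_coeff (\<lambda>k. if k < last ks then \<theta> k / real k * exp (- sp n) ^ k else 0) (n - sum_list ks) / exp_coeff (\<lambda>k. \<theta> k / real k * exp (- sp n) ^ k) n))
         \<le> A n"
        unfolding A_def
      proof (rule expectation_longest_ge[OF \<theta>_nonneg K])
        fix x y :: "nat \<Rightarrow> nat" assume "\<And>i. i \<in> {1..K} \<Longrightarrow> x i = y i"
        hence "rescaled K n x = rescaled K n y" by (auto simp: rescaled_def fun_eq_iff)
        thus "h (rescaled K n x) = h (rescaled K n y)" by simp
      qed (use h in auto)
      thus "(\<Sum>ks\<in>leading_lengths K n. a n ks * prod_list (map (wt (sp n)) ks)) \<le> A n"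
        unfolding a_def coeff_ratio_def wt_def[abs_def] by (simp only: mult_ac times_divide_eq_right times_divide_eq_left)
    qed
    finally show ?case .
  qed
  have lim: "AE \<omega> in N. (\<lambda>n. Z n \<omega>) \<longlonglongrightarrow> ennreal (h (Y \<omega>))"
  proof -
    have "AE \<omega> in N. \<forall>j\<in>{1..K}. E j \<omega> > 0"
      using distr by (intro AE_finite_allI exponential_AE_pos) auto
    thus ?thesis
    proof eventually_elim
      case (elim \<omega>)
      define s where "s i = S i \<omega>" for i
      have s_pos: "s i > 0" if "i \<in> {1..K}" for i
        unfolding s_def S_def using elim that by (intro sum_pos) auto
      have s_mono: "s i < s j" if "1 \<le> i" "i < j" "j \<le> K" for i j
        unfolding s_def S_def using elim that by (intro sum_strict_mono2[where b = j]) (auto intro: less_imp_le)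
      have kp: "\<forall>\<^sub>F n in sequentially. kappas K n s \<in> leading_lengths K n"
        "(\<lambda>n. coeff_ratio n (kappas K n s)) \<longlonglongrightarrow> exp (- s K)"
        using kappas_properties[OF K, of s] s_pos s_mono by blast+
      have nth: "kappas K n s ! (i - 1) = kappa (sp n) (s i)" if "i \<in> {1..K}" for n i
        using that by (auto simp: kappas_def simp del: upt_Suc)
      have "(\<lambda>n. rescaled K n (\<lambda>i. kappas K n s ! (i - 1))) \<longlonglongrightarrow> Y \<omega>"
        unfolding tendsto_fun_iff
      proof
        fix i
        show "(\<lambda>n. rescaled K n (\<lambda>i. kappas K n s ! (i - 1)) i) \<longlonglongrightarrow> Y \<omega> i"
        proof (cases "i \<in> {1..K}")
          case True
          have "(\<lambda>n. real (kappa (sp n) (s i)) * sp n - level (sp n)) \<longlonglongrightarrow> - ln (s i)"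
            by (rule filterlim_compose[OF kappa_lim[OF s_pos[OF True]] saddle_point_lim])
          moreover have "Y \<omega> i = - ln (s i)" using True by (simp add: Y_def s_def S_def)
          moreover have "rescaled K n (\<lambda>i. kappas K n s ! (i - 1)) i = real (kappa (sp n) (s i)) * sp n - level (sp n)" for n
            using True nth[OF True, of n] by (simp add: rescaled_def)
          ultimately show ?thesis by simp
        next
          case False
          thus ?thesis by (auto simp: rescaled_def Y_def)
        qed
      qed
      hence "(\<lambda>n. h (rescaled K n (\<lambda>i. kappas K n s ! (i - 1)))) \<longlonglongrightarrow> h (Y \<omega>)"
        using h(1) by (intro continuous_on_tendsto_compose[OF h(1)]) auto
      \<comment> \<open>exp(- s K) is the limit of the coefficient ratio and exp(s K) the weight in
        \<open>G\<close>; they cancel.\<close>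
      hence "(\<lambda>n. a n (kappas K n s) * exp (s K)) \<longlonglongrightarrow> h (Y \<omega>) * exp (- s K) * exp (s K)"
        unfolding a_def by (intro tendsto_mult kp(2) tendsto_const) auto
      hence "(\<lambda>n. ennreal (a n (kappas K n s) * exp (s K))) \<longlonglongrightarrow> ennreal (h (Y \<omega>) * exp (- s K) * exp (s K))"
        by (rule tendsto_ennrealI)
      also have "h (Y \<omega>) * exp (- s K) * exp (s K) = h (Y \<omega>)" by (simp add: exp_minus)
      finally have l: "(\<lambda>n. ennreal (a n (kappas K n s) * exp (s K))) \<longlonglongrightarrow> ennreal (h (Y \<omega>))" .
      have "\<forall>\<^sub>F n in sequentially. ennreal (a n (kappas K n s) * exp (s K)) = Z n \<omega>"
        using kp(1) sp_good
      proof eventually_elim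
        case n: (elim n)
        have J_iff: "s i \<in> J n k \<longleftrightarrow> kappa (sp n) (s i) = k" if "i \<in> {1..K}" "k \<ge> 1" for i k
          unfolding J_def using kappa_eq_iff[of "sp n" "s i" k] n s_pos that by auto
        \<comment> \<open>Any other list differs from the quantiles in some entry, whose interval
          misses the corresponding partial sum.\<close>
        have "G n ks \<omega> = 0" if ks: "ks \<in> leading_lengths K n - {kappas K n s}" for ks
        proof -
          have len: "length ks = K" "0 \<notin> set ks" using ks by (auto simp: leading_lengths_def)
          have "\<exists>i\<in>{1..K}. ks ! (i - 1) \<noteq> kappa (sp n) (s i)"
          proof (rule ccontr)
            assume "\<not> ?thesis"
            hence *: "ks ! (i - 1) = kappa (sp n) (s i)" if "i \<in> {1..K}" for i using that by blast
            have "ks = kappas K n s"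
            proof (rule nth_equalityI)
              show "length ks = length (kappas K n s)" using len by (simp add: kappas_def del: upt_Suc)
              fix j assume "j < length ks"
              thus "ks ! j = kappas K n s ! j" using *[of "Suc j"] nth[of "Suc j" n] len by simp
            qed
            thus False using ks by simp
          qed
          then obtain i where i: "i \<in> {1..K}" "ks ! (i - 1) \<noteq> kappa (sp n) (s i)" by blast
          have "ks ! (i - 1) \<in> set ks" using i len by auto
          hence "ks ! (i - 1) \<noteq> 0" using len by metis
          hence "ks ! (i - 1) \<ge> 1" by simp
          hence "S i \<omega> \<notin> J n (ks ! (i - 1))" using J_iff[OF i(1)] i(2) by (auto simp: s_def)
          thus ?thesis unfolding G_def using i(1)
            by (simp only: mult_eq_0_iff) (intro disjI1 prod_zero bexI[of _ i], auto)
        qed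
        hence "Z n \<omega> = ennreal (a n (kappas K n s)) * G n (kappas K n s) \<omega>"
          unfolding Z_def using n by (subst sum.remove[of _ "kappas K n s"]) auto
        also have "G n (kappas K n s) \<omega> = ennreal (exp (s K))"
        proof -
          have "S i \<omega> \<in> J n (kappas K n s ! (i - 1))" if i: "i \<in> {1..K}" for i
          proof -
            have "kappas K n s ! (i - 1) \<in> set (kappas K n s)"
              using i by (intro nth_mem) (auto simp: kappas_def simp del: upt_Suc)
            moreover have "0 \<notin> set (kappas K n s)" using n by (simp add: leading_lengths_def)
            ultimately have "kappas K n s ! (i - 1) \<noteq> 0" by metis
            hence "kappas K n s ! (i - 1) \<ge> 1" by simp
            thus ?thesis using J_iff[OF i] nth[OF i, of n] by (auto simp: s_def)
          qed
          hence "(\<Prod>i=1..K. indicator (J n (kappas K n s ! (i - 1))) (S i \<omega>)) = (1 :: ennreal)"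
            by (intro prod.neutral) auto
          thus ?thesis by (simp add: G_def s_def)
        qed
        also have "ennreal (a n (kappas K n s)) * ennreal (exp (s K)) = ennreal (a n (kappas K n s) * exp (s K))"
          using a_nonneg by (simp add: ennreal_mult)
        finally show ?case by simp
      qed
      with l show ?case by (rule Lim_transform_eventually)
    qed
  qed
  have Y_meas: "(\<lambda>\<omega>. h (Y \<omega>)) \<in> borel_measurable N"
  proof (rule measurable_compose[of Y N borel h borel])
    show "Y \<in> borel_measurable N"
    proof (rule measurable_coordinatewise_then_product)
      fix i show "(\<lambda>\<omega>. Y \<omega> i) \<in> borel_measurable N"
      proof (cases "i \<in> {1..K}")
        case True
        have "(\<lambda>\<omega>. - ln (S i \<omega>)) \<in> borel_measurable N" using S_meas[OF True] by measurable
        thus ?thesis using True by (simp add: Y_def S_def)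
      qed (auto simp: Y_def)
    qed
    show "h \<in> borel_measurable borel" by (rule borel_measurable_continuous_onI[OF h(1)])
  qed
  have Y_int: "integrable N (\<lambda>\<omega>. h (Y \<omega>))"
    using h by (intro integrable_const_bound[of _ B] Y_meas) auto
  have "ennreal (\<integral>\<omega>. h (Y \<omega>) \<partial>N) = (\<integral>\<^sup>+\<omega>. ennreal (h (Y \<omega>)) \<partial>N)"
    using h by (intro nn_integral_eq_integral[symmetric] Y_int) auto
  also have "\<dots> = (\<integral>\<^sup>+\<omega>. liminf (\<lambda>n. Z n \<omega>) \<partial>N)"
    using lim by (intro nn_integral_cong_AE) (auto elim!: eventually_mono simp: lim_imp_Liminf)
  also have "\<dots> \<le> liminf (\<lambda>n. \<integral>\<^sup>+\<omega>. Z n \<omega> \<partial>N)" by (rule nn_integral_liminf[OF Z_meas])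
  finally have le: "ennreal (\<integral>\<omega>. h (Y \<omega>) \<partial>N) \<le> liminf (\<lambda>n. \<integral>\<^sup>+\<omega>. Z n \<omega> \<partial>N)" .
  have A_nonneg: "A n \<ge> 0" for n unfolding A_def using h by (intro integral_nonneg_AE) auto
  show ?thesis
  \<comment> \<open>\<open>ennreal\<close> sends negative c to 0, so a strict inequality would not
    carry over; for such c the claim follows from h \<ge> 0.\<close>
  proof (cases "c < 0")
    case True
    thus ?thesis using A_nonneg by (auto simp: A_def intro!: always_eventually less_le_trans[of c 0])
  next
    case False
    hence "ennreal c < ennreal (\<integral>\<omega>. h (Y \<omega>) \<partial>N)" using c by (simp add: ennreal_less_iff)
    hence "\<forall>\<^sub>F n in sequentially. ennreal c < (\<integral>\<^sup>+\<omega>. Z n \<omega> \<partial>N)"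
      using le unfolding le_Liminf_iff by blast
    thus ?thesis using Z_le
    proof eventually_elim
      case (elim n)
      hence "ennreal c < ennreal (A n)" by (rule less_le_trans)
      thus ?case using False by (simp add: A_def ennreal_less_iff)
    qed
  qed
qed

end

text \<open>Passes from the product space over I, whose points are undefined outside I, to the space
  of all functions in which \<open>expectation_eventually_greater\<close> is stated.\<close>

lemma continuous_on_restrict_compose:
  fixes f :: "('i \<Rightarrow> real) \<Rightarrow> real"
  assumes "continuous_map (powertop_real I) euclideanreal f"
  shows "continuous_on UNIV (\<lambda>x. f (restrict x I))"
proof -
  have "continuous_map (product_topology (\<lambda>i. euclidean) UNIV) (powertop_real I) (\<lambda>x. restrict x I)"
    unfolding continuous_map_componentwise
    using continuous_map_product_projection[of _ UNIV "\<lambda>i. euclideanreal"] by auto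
  from continuous_map_compose[OF this assms] show ?thesis
    unfolding euclidean_product_topology by (simp add: o_def)
qed

theorem theorem1p2:
  fixes \<alpha> :: real and \<theta> :: "nat \<Rightarrow> real" and K :: nat
    and N :: "'b measure" and E :: "nat \<Rightarrow> 'b \<Rightarrow> real"
  assumes "\<alpha> > 0"
    and "\<And>k. k \<ge> 1 \<Longrightarrow> \<theta> k \<ge> 0"
    and "\<theta> \<sim>[sequentially] (\<lambda>k. real k powr \<alpha>)"
    and "K \<ge> 1"
    and "prob_space N"
    and "prob_space.indep_vars N (\<lambda>_. borel) E {1..K}"
    and "\<And>j. j \<in> {1..K} \<Longrightarrow> distributed N lborel (E j) (exponential_density 1)"
  shows "converges_in_distribution (powertop_real {1..K})
           (weighted_measure \<theta>)
           (\<lambda>n \<sigma>. \<lambda>i\<in>{1..K}.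
              1 / nstar \<theta> n * (real (longest_cycle n i \<sigma>) - nstar \<theta> n * ell \<alpha> \<theta> n))
           N
           (\<lambda>\<omega>. \<lambda>i\<in>{1..K}. - ln (\<Sum>j=1..i. E j \<omega>))"
  unfolding converges_in_distribution_def
proof (intro allI impI, elim conjE)
  interpret polynomial_weights \<alpha> \<theta> by unfold_locales fact+
  interpret N: prob_space N by fact
  fix f :: "(nat \<Rightarrow> real) \<Rightarrow> real"
  assume f: "continuous_map (powertop_real {1..K}) euclideanreal f"
    and "bounded (f ` topspace (powertop_real {1..K}))"
  then obtain B where B: "\<And>x. x \<in> extensional {1..K} \<Longrightarrow> \<bar>f x\<bar> \<le> B"
    by (auto simp: bounded_iff PiE_def)
  define g where "g x = f (restrict x {1..K})" for x
  have g_cont: "continuous_on UNIV g" unfolding g_def by (rule continuous_on_restrict_compose[OF f])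
  have g_bound: "\<bar>g x\<bar> \<le> B" for x unfolding g_def by (intro B) auto
  define Y where "Y \<omega> = (\<lambda>i. if i \<in> {1..K} then - ln (\<Sum>j=1..i. E j \<omega>) else 0)" for \<omega>
  define X where "X n \<sigma> = rescaled K n (\<lambda>i. longest_cycle n i \<sigma>)" for n \<sigma>
  have fY: "f (\<lambda>i\<in>{1..K}. - ln (\<Sum>j=1..i. E j \<omega>)) = g (Y \<omega>)" for \<omega>
    unfolding g_def Y_def by (intro arg_cong[of _ _ f]) auto
  \<comment> \<open>From n = 1 on the saddle point v is positive, and multiplying out 1/nstar = v
    turns the rescaled length into v L - ell.\<close>
  have fX: "f (\<lambda>i\<in>{1..K}. 1 / nstar \<theta> n * (real (longest_cycle n i \<sigma>) - nstar \<theta> n * ell \<alpha> \<theta> n)) = g (X n \<sigma>)"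
    if "n \<ge> 1" for n \<sigma>
    unfolding g_def X_def
  proof (intro arg_cong[of _ _ f] restrict_ext)
    fix i assume "i \<in> {1..K}"
    thus "1 / nstar \<theta> n * (real (longest_cycle n i \<sigma>) - nstar \<theta> n * ell \<alpha> \<theta> n) = rescaled K n (\<lambda>i. longest_cycle n i \<sigma>) i"
      using saddle_point(1)[OF that] by (simp add: rescaled_def nstar_def ell_eq_level field_simps)
  qed
  have Y_meas: "(\<lambda>\<omega>. g (Y \<omega>)) \<in> borel_measurable N"
  proof (rule measurable_compose[of Y N borel g borel])
    have E_meas: "E j \<in> borel_measurable N" if "j \<in> {1..K}" for j
      using assms(7)[OF that] distributed_measurable by fastforce
    show "Y \<in> borel_measurable N"
    proof (rule measurable_coordinatewise_then_product)
      fix i show "(\<lambda>\<omega>. Y \<omega> i) \<in> borel_measurable N"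
      proof (cases "i \<in> {1..K}")
        case True
        hence "(\<lambda>\<omega>. \<Sum>j=1..i. E j \<omega>) \<in> borel_measurable N" by (intro borel_measurable_sum E_meas) auto
        hence "(\<lambda>\<omega>. - ln (\<Sum>j=1..i. E j \<omega>)) \<in> borel_measurable N" by measurable
        thus ?thesis using True by (simp add: Y_def)
      qed (auto simp: Y_def)
    qed
    show "g \<in> borel_measurable borel" by (rule borel_measurable_continuous_onI[OF g_cont])
  qed
  have Y_int: "integrable N (\<lambda>\<omega>. g (Y \<omega>))"
    using g_bound by (intro N.integrable_const_bound[of _ B] Y_meas) auto
  have X_int: "integrable (weighted_measure \<theta> n) u" for n and u :: "(nat \<Rightarrow> nat) \<Rightarrow> real"
    unfolding weighted_measure_def by (intro integrable_point_measure_finite) (simp add: finite_permutations)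
  \<comment> \<open>Total mass 1 allows the constant B to be split off from the integrals of B + g
    and B - g.\<close>
  have prob: "\<forall>\<^sub>F n in sequentially. prob_space (weighted_measure \<theta> n)"
    using exp_coeff_pos by eventually_elim (auto intro: prob_weighted_measure \<theta>_nonneg)
  note main = expectation_eventually_greater[OF assms(4-6), folded Y_def X_def]
  have "(\<lambda>n. \<integral>\<sigma>. g (X n \<sigma>) \<partial>weighted_measure \<theta> n) \<longlonglongrightarrow> (\<integral>\<omega>. g (Y \<omega>) \<partial>N)"
  proof (rule order_tendstoI)
    fix c assume c: "c < (\<integral>\<omega>. g (Y \<omega>) \<partial>N)"
    have "\<forall>\<^sub>F n in sequentially. B + c < (\<integral>\<sigma>. B + g (X n \<sigma>) \<partial>weighted_measure \<theta> n)"
    proof (rule main)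
      show "B + c < (\<integral>\<omega>. B + g (Y \<omega>) \<partial>N)" using c Y_int by (simp add: N.prob_space)
      show "0 \<le> B + g x" "B + g x \<le> 2 * B" for x using g_bound[of x] by (auto simp: abs_le_iff)
    qed (rule assms(7), assumption, intro continuous_intros g_cont)
    thus "\<forall>\<^sub>F n in sequentially. c < (\<integral>\<sigma>. g (X n \<sigma>) \<partial>weighted_measure \<theta> n)"
      using prob
    proof eventually_elim
      case (elim n)
      interpret P: prob_space "weighted_measure \<theta> n" by fact
      show ?case using elim X_int by (simp add: P.prob_space)
    qed
  next
    fix c assume c: "c > (\<integral>\<omega>. g (Y \<omega>) \<partial>N)"
    have "\<forall>\<^sub>F n in sequentially. B - c < (\<integral>\<sigma>. B - g (X n \<sigma>) \<partial>weighted_measure \<theta> n)"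
    proof (rule main)
      show "B - c < (\<integral>\<omega>. B - g (Y \<omega>) \<partial>N)" using c Y_int by (simp add: N.prob_space)
      show "0 \<le> B - g x" "B - g x \<le> 2 * B" for x using g_bound[of x] by (auto simp: abs_le_iff)
    qed (rule assms(7), assumption, intro continuous_intros g_cont)
    thus "\<forall>\<^sub>F n in sequentially. c > (\<integral>\<sigma>. g (X n \<sigma>) \<partial>weighted_measure \<theta> n)"
      using prob
    proof eventually_elim
      case (elim n)
      interpret P: prob_space "weighted_measure \<theta> n" by fact
      show ?case using elim X_int by (simp add: P.prob_space)
    qed
  qed
  moreover have "\<forall>\<^sub>F n in sequentially. (\<integral>\<sigma>. g (X n \<sigma>) \<partial>weighted_measure \<theta> n) =
      (\<integral>\<sigma>. f (\<lambda>i\<in>{1..K}. 1 / nstar \<theta> n * (real (longest_cycle n i \<sigma>) - nstar \<theta> n * ell \<alpha> \<theta> n)) \<partial>weighted_measure \<theta> n)"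
    using eventually_ge_at_top[of 1] by eventually_elim (simp only: fX)
  ultimately show "(\<lambda>n. \<integral>\<sigma>. f (\<lambda>i\<in>{1..K}. 1 / nstar \<theta> n * (real (longest_cycle n i \<sigma>) - nstar \<theta> n * ell \<alpha> \<theta> n)) \<partial>weighted_measure \<theta> n)
      \<longlonglongrightarrow> (\<integral>\<omega>. f (\<lambda>i\<in>{1..K}. - ln (\<Sum>j=1..i. E j \<omega>)) \<partial>N)"
    unfolding fY by (rule Lim_transform_eventually)
qed

end
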